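(* Let $k\in\mathbb{R}$ and let $\omega_0\in\mathbb{R}$. Assume: (A-E) $\omega_0\neq 0$ is an algebraically simple, isolated eigenvalue of the operator pencil $L_k$. Let $\varphi_0\in D(A)$ be an eigenfunction, $L_k(\omega_0)\varphi_0=0$, with $\|\varphi_0\|=1$, and $\varphi_0^*$ the adjoint eigenfunction, $L_k(\omega_0)^*\varphi_0^*=0$, with $\langle\varphi_0,\varphi_0^*\rangle=1$. (A-T) $\langle \partial_\omega B(\cdot,\omega_0)\varphi_0,\varphi_0^*\rangle\neq 0$. There exists $\delta>0$ such that: (A-V) for each $j\in\{1,\dots,m\}$ and almost every $x\in I_j$ the map $V_j(x,\cdot)$ is holomorphic on $B_\delta(\omega_0)\subset\mathbb{C}$, and $V_j(\cdot,\omega),\ \frac{1}{V_j(\cdot,\omega)},\ \partial_\omega V_j(\cdot,\omega),\ \partial_\omega^2V_j(\cdot,\omega)\in W^{1,\infty}(I_j,\mathbb{C})$ for all $j$ and $\omega\in B_\delta(\omega_0)$; (A-Na) there is $L_a>0$ such that $\hat\chi^{(3)}(\cdot,\omega)|_{I_j}\in W^{1,\infty}(I_j,\mathbb{C})$ for all $j$ and $\omega\in B_\delta(\omega_0)$ and $\max_{j}\|\hat\chi^{(3)}(\cdot,\omega_1)-\hat\chi^{(3)}(\cdot,\omega_2)\|_{W^{1,\infty}(I_j)}\le L_a|\omega_1-\omega_2|$ for all $\omega_1,\omega_2\in B_\delta(\omega_0)$. Assume in addition that the material is $\mathcal{PT}$-symmetric, i.e. for some $\delta>0$ $$V(x,\omega)=\overline{V(-x,\omega)},\qquad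 \hat\chi^{(3)}(x,\omega)=\overline{\hat\chi^{(3)}(-x,\omega)}\qquad\text{for all }x\in\mathbb{R},\ \omega\in(\omega_0-\delta,\omega_0+\delta).$$ Consider the unique branch of solutions $(\omega,u)\in\mathbb{C}\times(D(A)\cap\mathcal{H}^1)$ of $L_k(x,\omega)u=h(x,\omega,u)$ on $\mathbb{R}$ bifurcating from $(\omega_0,0)$, parametrized by $\varepsilon\in(0,\varepsilon_0)$ (for some $\varepsilon_0>0$) via $\langle u,\varphi_0^*\rangle=\varepsilon^{1/2}$ and having the form $\omega=\omega_0+\varepsilon\nu+\varepsilon^2\sigma$, $u=\varepsilon^{1/2}\varphi_0+\varepsilon^{3/2}\phi+\varepsilon^{5/2}\psi$ with $$\nu=-\frac{\langle h(\cdot,\omega_0,\varphi_0),\varphi_0^*\rangle}{\langle\partial_\omega B(\cdot,\omega_0)\varphi_0,\varphi_0^*\rangle},$$ $\phi$ the unique solution in $D(A)\cap\mathcal{H}^1\cap\langle\varphi_0^*\rangle^\perp$ of $L_k(x,\omega_0)\phi=h(x,\omega_0,\varphi_0)+\nu\partial_\omega B(x,\omega_0)\varphi_0$, $\sigma\in\mathbb{C}$ and $\psi\in D(A)\cap\mathcal{H}^1\cap\langle\varphi_0^*\rangle^\perp$. Then this solution family with $\varepsilon\in(0,\varepsilon_0)$ satisfies $\omega\in\mathbb{R}$, and $u$ can be chosen $\mathcal{PT}$-symmetric, i.e. $u(x)=\overline{u(-x)}$.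
   Context: Layers: $m\in\mathbb{N}$, $-\infty=x_0<x_1<\dots<x_{m-1}<x_m=\infty$, $I_j=(x_{j-1},x_j)$. $\langle\cdot,\cdot\rangle$ is the $L^2(\mathbb{R},\mathbb{C}^n)$ inner product (linear in the first argument), $\|\cdot\|$ the $L^2(\mathbb{R})$ norm. $\mathcal{H}^1=\{f\in L^2(\mathbb{R},\mathbb{C}^n): f|_{I_j}\in H^1(I_j,\mathbb{C}^n)\ \forall j\}$ with norm $\|f\|_{\mathcal{H}^1}=\sum_{j=1}^m\|f\|_{H^1(I_j)}$ (here $n=3$). $\langle\varphi_0^*\rangle^\perp$ is the $L^2$-orthogonal complement of $\mathrm{span}\{\varphi_0^*\}$; $B_\delta(\omega_0)$ is the ball of radius $\delta$ in $\mathbb{C}$. Material functions: $\epsilon_0,\mu_0>0$ are physical constants ($\epsilon_0$ is unrelated to the small number $\varepsilon_0$); $\hat\chi^{(1)}(x,\omega),\hat\chi^{(3)}(x,\omega)$ are given complex-valued functions; $V(x,\omega)=-\omega\epsilon_0\mu_0(1+\hat\chi^{(1)}(x,\omega))$; $V_j(\cdot,\omega)=V(\cdot,\omega)|_{I_j}$; $\Omega\subset\mathbb{C}$ is the set of $\omega$ with $V_j(\cdot,\omega)\in L^\infty(I_j)$ for all $j$. Operators: $$A=\begin{pmatrix}0&0&\mathrm{i}k\\0&0&-\partial_x\\-\mathrm{i}k&\partial_x&0\end{pmatrix},\quad D(A)=\{u\in L^2(\mathbb{R},\mathbb{C}^3):u_2,u_3\in H^1(\mathbb{R},\mathbb{C})\},$$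 $B(x,\omega)=\mathrm{diag}(\mathrm{i}V(x,\omega),\mathrm{i}V(x,\omega),\mathrm{i}\omega)$, and $L_k(\omega)=L_k(x,\omega)=A-B(x,\omega):D(A)\to L^2(\mathbb{R},\mathbb{C}^3)$ for $\omega\in\Omega$. Nonlinearity: with $u_E=(u_1,u_2,0)^T$, $h(x,\omega,u)=-\mathrm{i}\omega\epsilon_0\mu_0^3\hat\chi^{(3)}(x,\omega)\left(2|u_E|^2u_E+(u_E\cdot u_E)\overline{u_E}\right)$, where $u_E\cdot u_E=u_1^2+u_2^2$ (no conjugation) and $|u_E|^2=|u_1|^2+|u_2|^2$. Spectral notions for the pencil: $\omega\in\Omega$ is an eigenvalue of $L_k$ if $\ker L_k(\omega)\neq\{0\}$. It is algebraically simple if $\lambda=0$ is an algebraically simple eigenvalue of the operator $L_k(\omega)$ ($\omega$ fixed), i.e. $\dim\ker L_k(\omega)=1$ and there is no $u\in D(A)$ with $L_k(\omega)u=v$, $v\in\ker L_k(\omega)\setminus\{0\}$, $u,v$ linearly independent. It is isolated if $\lambda=0$ is an isolated point of the spectrum of the operator $L_k(\omega)$ ($\omega$ fixed). Under (A-E), (A-T), (A-V), (A-Na) the existence and uniqueness of the branch described in the claim is a theorem of the same paper and may be taken as the setting. *)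

theory Defs
  imports
    "HOL-Analysis.Analysis"
    "HOL-Probability.Essential_Supremum"
begin

text \<open>
  Elements of the Lebesgue and Sobolev spaces are represented by functions; two functions
  represent the same element iff they agree almost everywhere. Accordingly every equation
  between such elements is stated almost everywhere.
\<close>

definition L2 :: "real set \<Rightarrow> (real \<Rightarrow> 'b::euclidean_space) set" where
  "L2 S = {f. f \<in> borel_measurable (lebesgue_on S) \<and>
              integrable (lebesgue_on S) (\<lambda>x. (norm (f x))\<^sup>2)}"

definition L2_nrm :: "real set \<Rightarrow> (real \<Rightarrow> 'b::euclidean_space) \<Rightarrow> real" where
  "L2_nrm S f = sqrt (LINT x|lebesgue_on S. (norm (f x))\<^sup>2)"

definition L2_inner :: "(real \<Rightarrow> complex^3) \<Rightarrow> (real \<Rightarrow> complex^3) \<Rightarrow> complex" where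
  "L2_inner f g = (LINT x|lebesgue. (\<Sum>i\<in>UNIV. f x $ i * cnj (g x $ i)))"

definition Linf_nrm :: "real set \<Rightarrow> (real \<Rightarrow> 'b::euclidean_space) \<Rightarrow> ereal" where
  "Linf_nrm S f = esssup (lebesgue_on S) (\<lambda>x. ereal (norm (f x)))"

definition Linf :: "real set \<Rightarrow> (real \<Rightarrow> 'b::euclidean_space) set" where
  "Linf S = {f. f \<in> borel_measurable (lebesgue_on S) \<and> Linf_nrm S f < \<infinity>}"

definition locally_integrable :: "real set \<Rightarrow> (real \<Rightarrow> 'b::euclidean_space) \<Rightarrow> bool" where
  "locally_integrable S f \<longleftrightarrow> (\<forall>K. compact K \<and> K \<subseteq> S \<longrightarrow> integrable (lebesgue_on K) f)"

definition test_fun :: "real set \<Rightarrow> (real \<Rightarrow> real) \<Rightarrow> bool" where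
  "test_fun S \<eta> \<longleftrightarrow> \<eta> C1_differentiable_on UNIV \<and>
     (\<exists>K. compact K \<and> K \<subseteq> S \<and> (\<forall>x. x \<notin> K \<longrightarrow> \<eta> x = 0))"

text \<open>Real-valued test functions suffice for vector-valued \<open>f\<close>, by linearity.\<close>

definition is_weak_deriv ::
    "real set \<Rightarrow> (real \<Rightarrow> 'b::euclidean_space) \<Rightarrow> (real \<Rightarrow> 'b) \<Rightarrow> bool" where
  "is_weak_deriv S f g \<longleftrightarrow> locally_integrable S f \<and> locally_integrable S g \<and>
     (\<forall>\<eta>. test_fun S \<eta> \<longrightarrow>
        (LINT x|lebesgue_on S. deriv \<eta> x *\<^sub>R f x) = - (LINT x|lebesgue_on S. \<eta> x *\<^sub>R g x))"

text \<open>Unspecified if there is no weak derivative; otherwise determined almost everywhere on \<open>S\<close>.\<close>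

definition weak_deriv :: "real set \<Rightarrow> (real \<Rightarrow> 'b::euclidean_space) \<Rightarrow> real \<Rightarrow> 'b" where
  "weak_deriv S f = (SOME g. is_weak_deriv S f g)"

definition H1 :: "real set \<Rightarrow> (real \<Rightarrow> 'b::euclidean_space) set" where
  "H1 S = {f \<in> L2 S. \<exists>g \<in> L2 S. is_weak_deriv S f g}"

definition H1_nrm :: "real set \<Rightarrow> (real \<Rightarrow> 'b::euclidean_space) \<Rightarrow> real" where
  "H1_nrm S f = sqrt ((L2_nrm S f)\<^sup>2 + (L2_nrm S (weak_deriv S f))\<^sup>2)"

definition W1inf :: "real set \<Rightarrow> (real \<Rightarrow> 'b::euclidean_space) set" where
  "W1inf S = {f \<in> Linf S. \<exists>g \<in> Linf S. is_weak_deriv S f g}"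

definition W1inf_nrm :: "real set \<Rightarrow> (real \<Rightarrow> 'b::euclidean_space) \<Rightarrow> ereal" where
  "W1inf_nrm S f = Linf_nrm S f + Linf_nrm S (weak_deriv S f)"

text \<open>The interfaces are \<open>X 0 = -\<infinity> < X 1 < \<dots> < X m = \<infinity>\<close>, so that \<open>m \<ge> 1\<close> is automatic.\<close>

definition layers :: "nat \<Rightarrow> (nat \<Rightarrow> ereal) \<Rightarrow> bool" where
  "layers m X \<longleftrightarrow> X 0 = -\<infinity> \<and> X m = \<infinity> \<and> (\<forall>j<m. X j < X (Suc j))"

definition layer :: "(nat \<Rightarrow> ereal) \<Rightarrow> nat \<Rightarrow> real set" where
  "layer X j = {t. X (j - 1) < ereal t \<and> ereal t < X j}"

definition PH1 :: "nat \<Rightarrow> (nat \<Rightarrow> ereal) \<Rightarrow> (real \<Rightarrow> complex^3) set" where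
  "PH1 m X = {f \<in> L2 UNIV. \<forall>j\<in>{1..m}. f \<in> H1 (layer X j)}"

definition PH1_nrm :: "nat \<Rightarrow> (nat \<Rightarrow> ereal) \<Rightarrow> (real \<Rightarrow> complex^3) \<Rightarrow> real" where
  "PH1_nrm m X f = (\<Sum>j=1..m. H1_nrm (layer X j) f)"

definition D_A :: "(real \<Rightarrow> complex^3) set" where
  "D_A = {u \<in> L2 UNIV. (\<lambda>x. u x $ 2) \<in> H1 UNIV \<and> (\<lambda>x. u x $ 3) \<in> H1 UNIV}"

definition A_op :: "real \<Rightarrow> (real \<Rightarrow> complex^3) \<Rightarrow> real \<Rightarrow> complex^3" where
  "A_op k u x = vector
     [\<i> * of_real k * u x $ 3,
      - weak_deriv UNIV (\<lambda>y. u y $ 3) x,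
      - \<i> * of_real k * u x $ 1 + weak_deriv UNIV (\<lambda>y. u y $ 2) x]"

definition diag3 :: "complex \<Rightarrow> complex \<Rightarrow> complex \<Rightarrow> complex^3^3" where
  "diag3 a b c = (\<chi> i j. if i = j then vector [a, b, c] $ i else 0)"

definition B_mat :: "(real \<Rightarrow> complex \<Rightarrow> complex) \<Rightarrow> real \<Rightarrow> complex \<Rightarrow> complex^3^3" where
  "B_mat V x \<omega> = diag3 (\<i> * V x \<omega>) (\<i> * V x \<omega>) (\<i> * \<omega>)"

definition dB_mat :: "(real \<Rightarrow> complex \<Rightarrow> complex) \<Rightarrow> real \<Rightarrow> complex \<Rightarrow> complex^3^3" where
  "dB_mat V x \<omega> = (\<chi> i j. deriv (\<lambda>w. B_mat V x w $ i $ j) \<omega>)"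

definition L_op ::
    "real \<Rightarrow> (real \<Rightarrow> complex \<Rightarrow> complex) \<Rightarrow> complex \<Rightarrow> (real \<Rightarrow> complex^3) \<Rightarrow> real \<Rightarrow> complex^3" where
  "L_op k V \<omega> u x = A_op k u x - B_mat V x \<omega> *v u x"

definition pencil_dom :: "nat \<Rightarrow> (nat \<Rightarrow> ereal) \<Rightarrow> (real \<Rightarrow> complex \<Rightarrow> complex) \<Rightarrow> complex set" where
  "pencil_dom m X V = {\<omega>. \<forall>j\<in>{1..m}. (\<lambda>x. V x \<omega>) \<in> Linf (layer X j)}"

definition ker_L ::
    "real \<Rightarrow> (real \<Rightarrow> complex \<Rightarrow> complex) \<Rightarrow> complex \<Rightarrow> (real \<Rightarrow> complex^3) set" where
  "ker_L k V \<omega> = {u \<in> D_A. AE x in lebesgue. L_op k V \<omega> u x = 0}"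

definition resolvent_set_L ::
    "real \<Rightarrow> (real \<Rightarrow> complex \<Rightarrow> complex) \<Rightarrow> complex \<Rightarrow> complex set" where
  "resolvent_set_L k V \<omega> = {\<mu>.
     (\<forall>f \<in> L2 UNIV. \<exists>u \<in> D_A. AE x in lebesgue. L_op k V \<omega> u x - \<mu> *s u x = f x) \<and>
     (\<forall>u \<in> D_A. (AE x in lebesgue. L_op k V \<omega> u x - \<mu> *s u x = 0) \<longrightarrow>
        (AE x in lebesgue. u x = 0)) \<and>
     (\<exists>C. \<forall>u \<in> D_A. L2_nrm UNIV u \<le> C * L2_nrm UNIV (\<lambda>x. L_op k V \<omega> u x - \<mu> *s u x))}"

definition spectrum_L ::
    "real \<Rightarrow> (real \<Rightarrow> complex \<Rightarrow> complex) \<Rightarrow> complex \<Rightarrow> complex set" where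
  "spectrum_L k V \<omega> = - resolvent_set_L k V \<omega>"

definition pencil_eigenvalue ::
    "nat \<Rightarrow> (nat \<Rightarrow> ereal) \<Rightarrow> real \<Rightarrow> (real \<Rightarrow> complex \<Rightarrow> complex) \<Rightarrow> complex \<Rightarrow> bool" where
  "pencil_eigenvalue m X k V \<omega> \<longleftrightarrow> \<omega> \<in> pencil_dom m X V \<and>
     (\<exists>u \<in> ker_L k V \<omega>. \<not> (AE x in lebesgue. u x = 0))"

definition lin_indep2 :: "(real \<Rightarrow> complex^3) \<Rightarrow> (real \<Rightarrow> complex^3) \<Rightarrow> bool" where
  "lin_indep2 u v \<longleftrightarrow>
     (\<forall>a b. (AE x in lebesgue. a *s u x + b *s v x = 0) \<longrightarrow> a = 0 \<and> b = 0)"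

text \<open>First conjunct: the kernel, as a space of classes of functions, has dimension one.\<close>

definition alg_simple ::
    "real \<Rightarrow> (real \<Rightarrow> complex \<Rightarrow> complex) \<Rightarrow> complex \<Rightarrow> bool" where
  "alg_simple k V \<omega> \<longleftrightarrow>
     (\<exists>u0 \<in> ker_L k V \<omega>. \<not> (AE x in lebesgue. u0 x = 0) \<and>
        (\<forall>u \<in> ker_L k V \<omega>. \<exists>c. AE x in lebesgue. u x = c *s u0 x)) \<and>
     \<not> (\<exists>u \<in> D_A. \<exists>v \<in> ker_L k V \<omega>. \<not> (AE x in lebesgue. v x = 0) \<and>
          (AE x in lebesgue. L_op k V \<omega> u x = v x) \<and> lin_indep2 u v)"

text \<open>\<open>v\<close> is in the domain of the adjoint of \<open>L_op k V \<omega>\<close>, which maps it to \<open>w\<close>.\<close>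

definition adjoint_L ::
    "real \<Rightarrow> (real \<Rightarrow> complex \<Rightarrow> complex) \<Rightarrow> complex \<Rightarrow>
     (real \<Rightarrow> complex^3) \<Rightarrow> (real \<Rightarrow> complex^3) \<Rightarrow> bool" where
  "adjoint_L k V \<omega> v w \<longleftrightarrow> v \<in> L2 UNIV \<and> w \<in> L2 UNIV \<and>
     (\<forall>u \<in> D_A. L2_inner (L_op k V \<omega> u) v = L2_inner u w)"

definition E_part :: "complex^3 \<Rightarrow> complex^3" where
  "E_part v = vector [v $ 1, v $ 2, 0]"

definition cnjv :: "complex^3 \<Rightarrow> complex^3" where
  "cnjv v = (\<chi> i. cnj (v $ i))"

definition h_nl ::
    "real \<Rightarrow> real \<Rightarrow> (real \<Rightarrow> complex \<Rightarrow> complex) \<Rightarrow> real \<Rightarrow> complex \<Rightarrow> complex^3 \<Rightarrow> complex^3" where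
  "h_nl eps0 mu0 chi3 x \<omega> v =
     (- \<i> * \<omega> * of_real eps0 * of_real mu0 ^ 3 * chi3 x \<omega>) *s
       ((2 * of_real ((norm (E_part v))\<^sup>2)) *s E_part v +
        ((v $ 1)\<^sup>2 + (v $ 2)\<^sup>2) *s cnjv (E_part v))"

definition A_E ::
    "nat \<Rightarrow> (nat \<Rightarrow> ereal) \<Rightarrow> real \<Rightarrow> (real \<Rightarrow> complex \<Rightarrow> complex) \<Rightarrow> real \<Rightarrow>
     (real \<Rightarrow> complex^3) \<Rightarrow> (real \<Rightarrow> complex^3) \<Rightarrow> bool" where
  "A_E m X k V \<omega>0 \<phi>0 \<phi>0s \<longleftrightarrow>
     \<omega>0 \<noteq> 0 \<and>
     pencil_eigenvalue m X k V (of_real \<omega>0) \<and>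
     alg_simple k V (of_real \<omega>0) \<and>
     0 isolated_in spectrum_L k V (of_real \<omega>0) \<and>
     \<phi>0 \<in> ker_L k V (of_real \<omega>0) \<and> L2_nrm UNIV \<phi>0 = 1 \<and>
     adjoint_L k V (of_real \<omega>0) \<phi>0s (\<lambda>_. 0) \<and> L2_inner \<phi>0 \<phi>0s = 1"

definition A_T ::
    "(real \<Rightarrow> complex \<Rightarrow> complex) \<Rightarrow> real \<Rightarrow> (real \<Rightarrow> complex^3) \<Rightarrow> (real \<Rightarrow> complex^3) \<Rightarrow> bool" where
  "A_T V \<omega>0 \<phi>0 \<phi>0s \<longleftrightarrow> L2_inner (\<lambda>x. dB_mat V x (of_real \<omega>0) *v \<phi>0 x) \<phi>0s \<noteq> 0"

text \<open>
  Since \<open>1 / 0 = 0\<close> in HOL, that \<open>V\<close> is nonzero almost everywhere, which is part of the meaning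
  of \<open>1 / V \<in> W\<^sup>1\<^sup>,\<^sup>\<infinity>\<close>, has to be said separately.
\<close>

definition A_V ::
    "nat \<Rightarrow> (nat \<Rightarrow> ereal) \<Rightarrow> (real \<Rightarrow> complex \<Rightarrow> complex) \<Rightarrow> real \<Rightarrow> real \<Rightarrow> bool" where
  "A_V m X V \<omega>0 \<delta> \<longleftrightarrow> (\<forall>j\<in>{1..m}.
     (AE x in lebesgue_on (layer X j). V x holomorphic_on ball (of_real \<omega>0) \<delta>) \<and>
     (\<forall>\<omega> \<in> ball (of_real \<omega>0) \<delta>.
        (AE x in lebesgue_on (layer X j). V x \<omega> \<noteq> 0) \<and>
        (\<lambda>x. V x \<omega>) \<in> W1inf (layer X j) \<and>
        (\<lambda>x. 1 / V x \<omega>) \<in> W1inf (layer X j) \<and>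
        (\<lambda>x. deriv (V x) \<omega>) \<in> W1inf (layer X j) \<and>
        (\<lambda>x. (deriv ^^ 2) (V x) \<omega>) \<in> W1inf (layer X j)))"

definition A_Na ::
    "nat \<Rightarrow> (nat \<Rightarrow> ereal) \<Rightarrow> (real \<Rightarrow> complex \<Rightarrow> complex) \<Rightarrow> real \<Rightarrow> real \<Rightarrow> bool" where
  "A_Na m X chi3 \<omega>0 \<delta> \<longleftrightarrow> (\<exists>La>0.
     (\<forall>j\<in>{1..m}. \<forall>\<omega> \<in> ball (of_real \<omega>0) \<delta>. (\<lambda>x. chi3 x \<omega>) \<in> W1inf (layer X j)) \<and>
     (\<forall>\<omega>1 \<in> ball (of_real \<omega>0) \<delta>. \<forall>\<omega>2 \<in> ball (of_real \<omega>0) \<delta>.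
        (MAX j\<in>{1..m}. W1inf_nrm (layer X j) (\<lambda>x. chi3 x \<omega>1 - chi3 x \<omega>2))
          \<le> ereal (La * cmod (\<omega>1 - \<omega>2))))"

definition PT_material :: "(real \<Rightarrow> complex \<Rightarrow> complex) \<Rightarrow> real \<Rightarrow> real \<Rightarrow> bool" where
  "PT_material F \<omega>0 \<delta> \<longleftrightarrow>
     (\<forall>x. \<forall>w \<in> {\<omega>0 - \<delta> <..< \<omega>0 + \<delta>}. F x (of_real w) = cnj (F (- x) (of_real w)))"

definition PT_symmetric :: "(real \<Rightarrow> complex^3) \<Rightarrow> bool" where
  "PT_symmetric u \<longleftrightarrow> (AE x in lebesgue. u x = cnjv (u (- x)))"

definition solves ::
    "nat \<Rightarrow> (nat \<Rightarrow> ereal) \<Rightarrow> real \<Rightarrow> real \<Rightarrow> real \<Rightarrow> (real \<Rightarrow> complex \<Rightarrow> complex) \<Rightarrow>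
     (real \<Rightarrow> complex \<Rightarrow> complex) \<Rightarrow> complex \<Rightarrow> (real \<Rightarrow> complex^3) \<Rightarrow> bool" where
  "solves m X k eps0 mu0 V chi3 \<omega> u \<longleftrightarrow>
     \<omega> \<in> pencil_dom m X V \<and> u \<in> D_A \<inter> PH1 m X \<and>
     (AE x in lebesgue. L_op k V \<omega> u x = h_nl eps0 mu0 chi3 x \<omega> (u x))"

definition nu_coeff ::
    "real \<Rightarrow> real \<Rightarrow> (real \<Rightarrow> complex \<Rightarrow> complex) \<Rightarrow> (real \<Rightarrow> complex \<Rightarrow> complex) \<Rightarrow> real \<Rightarrow>
     (real \<Rightarrow> complex^3) \<Rightarrow> (real \<Rightarrow> complex^3) \<Rightarrow> complex" where
  "nu_coeff eps0 mu0 V chi3 \<omega>0 \<phi>0 \<phi>0s =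
     - (L2_inner (\<lambda>x. h_nl eps0 mu0 chi3 x (of_real \<omega>0) (\<phi>0 x)) \<phi>0s /
        L2_inner (\<lambda>x. dB_mat V x (of_real \<omega>0) *v \<phi>0 x) \<phi>0s)"

definition perp_space ::
    "nat \<Rightarrow> (nat \<Rightarrow> ereal) \<Rightarrow> (real \<Rightarrow> complex^3) \<Rightarrow> (real \<Rightarrow> complex^3) set" where
  "perp_space m X \<phi>0s = {f \<in> D_A \<inter> PH1 m X. L2_inner f \<phi>0s = 0}"

definition phi_eq ::
    "real \<Rightarrow> real \<Rightarrow> real \<Rightarrow> (real \<Rightarrow> complex \<Rightarrow> complex) \<Rightarrow> (real \<Rightarrow> complex \<Rightarrow> complex) \<Rightarrow> real \<Rightarrow>
     (real \<Rightarrow> complex^3) \<Rightarrow> (real \<Rightarrow> complex^3) \<Rightarrow> (real \<Rightarrow> complex^3) \<Rightarrow> bool" where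
  "phi_eq k eps0 mu0 V chi3 \<omega>0 \<phi>0 \<phi>0s \<phi> \<longleftrightarrow>
     (AE x in lebesgue. L_op k V (of_real \<omega>0) \<phi> x =
        h_nl eps0 mu0 chi3 x (of_real \<omega>0) (\<phi>0 x) +
        nu_coeff eps0 mu0 V chi3 \<omega>0 \<phi>0 \<phi>0s *s (dB_mat V x (of_real \<omega>0) *v \<phi>0 x))"

definition is_phi ::
    "nat \<Rightarrow> (nat \<Rightarrow> ereal) \<Rightarrow> real \<Rightarrow> real \<Rightarrow> real \<Rightarrow> (real \<Rightarrow> complex \<Rightarrow> complex) \<Rightarrow>
     (real \<Rightarrow> complex \<Rightarrow> complex) \<Rightarrow> real \<Rightarrow>
     (real \<Rightarrow> complex^3) \<Rightarrow> (real \<Rightarrow> complex^3) \<Rightarrow> (real \<Rightarrow> complex^3) \<Rightarrow> bool" where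
  "is_phi m X k eps0 mu0 V chi3 \<omega>0 \<phi>0 \<phi>0s \<phi> \<longleftrightarrow>
     \<phi> \<in> perp_space m X \<phi>0s \<and> phi_eq k eps0 mu0 V chi3 \<omega>0 \<phi>0 \<phi>0s \<phi> \<and>
     (\<forall>\<phi>' \<in> perp_space m X \<phi>0s. phi_eq k eps0 mu0 V chi3 \<omega>0 \<phi>0 \<phi>0s \<phi>' \<longrightarrow>
        (AE x in lebesgue. \<phi>' x = \<phi> x))"

text \<open>
  A family of solutions indexed by \<open>\<epsilon> \<in> (0, \<epsilon>0)\<close> with the stated normalisation and expansion
  (\<open>\<sigma>\<close> and \<open>\<psi>\<close> depend on \<open>\<epsilon>\<close>). Bifurcation from \<open>(\<omega>0, 0)\<close> means convergence to this point as
  \<open>\<epsilon>\<close> tends to 0, for \<open>u\<close> in the norm \<open>PH1_nrm\<close>.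
\<close>

definition bifurcating_branch ::
    "nat \<Rightarrow> (nat \<Rightarrow> ereal) \<Rightarrow> real \<Rightarrow> real \<Rightarrow> real \<Rightarrow> (real \<Rightarrow> complex \<Rightarrow> complex) \<Rightarrow>
     (real \<Rightarrow> complex \<Rightarrow> complex) \<Rightarrow> real \<Rightarrow> (real \<Rightarrow> complex^3) \<Rightarrow> (real \<Rightarrow> complex^3) \<Rightarrow>
     real \<Rightarrow> (real \<Rightarrow> complex) \<Rightarrow> (real \<Rightarrow> real \<Rightarrow> complex^3) \<Rightarrow> bool" where
  "bifurcating_branch m X k eps0 mu0 V chi3 \<omega>0 \<phi>0 \<phi>0s \<epsilon>0 \<omega> u \<longleftrightarrow>
     \<epsilon>0 > 0 \<and>
     (\<exists>\<phi>. is_phi m X k eps0 mu0 V chi3 \<omega>0 \<phi>0 \<phi>0s \<phi> \<and>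
       (\<forall>\<epsilon> \<in> {0<..<\<epsilon>0}.
          solves m X k eps0 mu0 V chi3 (\<omega> \<epsilon>) (u \<epsilon>) \<and>
          L2_inner (u \<epsilon>) \<phi>0s = of_real (\<epsilon> powr (1/2)) \<and>
          (\<exists>\<sigma>. \<omega> \<epsilon> = of_real \<omega>0 + of_real \<epsilon> * nu_coeff eps0 mu0 V chi3 \<omega>0 \<phi>0 \<phi>0s +
                 of_real (\<epsilon>\<^sup>2) * \<sigma>) \<and>
          (\<exists>\<psi> \<in> perp_space m X \<phi>0s. AE x in lebesgue.
              u \<epsilon> x = (\<epsilon> powr (1/2)) *\<^sub>R \<phi>0 x + (\<epsilon> powr (3/2)) *\<^sub>R \<phi> x +
                      (\<epsilon> powr (5/2)) *\<^sub>R \<psi> x))) \<and>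
     (\<omega> \<longlongrightarrow> of_real \<omega>0) (at_right 0) \<and>
     ((\<lambda>\<epsilon>. PH1_nrm m X (u \<epsilon>)) \<longlongrightarrow> 0) (at_right 0)"

text \<open>
  Uniqueness: near \<open>(\<omega>0, 0)\<close> the branch contains all solutions with
  \<open>\<langle>u, \<phi>0s\<rangle> = \<epsilon>\<^sup>1\<^sup>/\<^sup>2\<close> for some \<open>\<epsilon> \<in> (0, \<epsilon>0)\<close>.
\<close>

definition unique_branch ::
    "nat \<Rightarrow> (nat \<Rightarrow> ereal) \<Rightarrow> real \<Rightarrow> real \<Rightarrow> real \<Rightarrow> (real \<Rightarrow> complex \<Rightarrow> complex) \<Rightarrow>
     (real \<Rightarrow> complex \<Rightarrow> complex) \<Rightarrow> real \<Rightarrow> (real \<Rightarrow> complex^3) \<Rightarrow> (real \<Rightarrow> complex^3) \<Rightarrow>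
     real \<Rightarrow> (real \<Rightarrow> complex) \<Rightarrow> (real \<Rightarrow> real \<Rightarrow> complex^3) \<Rightarrow> bool" where
  "unique_branch m X k eps0 mu0 V chi3 \<omega>0 \<phi>0 \<phi>0s \<epsilon>0 \<omega> u \<longleftrightarrow>
     bifurcating_branch m X k eps0 mu0 V chi3 \<omega>0 \<phi>0 \<phi>0s \<epsilon>0 \<omega> u \<and>
     (\<exists>r>0. \<forall>\<epsilon> \<in> {0<..<\<epsilon>0}. \<forall>w v.
        solves m X k eps0 mu0 V chi3 w v \<and> L2_inner v \<phi>0s = of_real (\<epsilon> powr (1/2)) \<and>
        cmod (w - of_real \<omega>0) < r \<and> PH1_nrm m X v < r
        \<longrightarrow> w = \<omega> \<epsilon> \<and> (AE x in lebesgue. v x = u \<epsilon> x))"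

text \<open>
  Existence and uniqueness of the branch, as a known theorem about the eigenvalue \<open>\<omega>0\<close> of the
  pencil given by \<open>k\<close> and \<open>V\<close>. The linear data are fixed; the layering, the susceptibility \<open>chi3\<close>
  and the radius \<open>\<delta>\<close> range over everything that the assumptions admit.
\<close>

definition bifurcation_thm ::
    "real \<Rightarrow> real \<Rightarrow> real \<Rightarrow> (real \<Rightarrow> complex \<Rightarrow> complex) \<Rightarrow> real \<Rightarrow>
     (real \<Rightarrow> complex^3) \<Rightarrow> (real \<Rightarrow> complex^3) \<Rightarrow> bool" where
  "bifurcation_thm k eps0 mu0 V \<omega>0 \<phi>0 \<phi>0s \<longleftrightarrow>
     (\<forall>m X chi3 \<delta>. layers m X \<and> \<delta> > 0 \<and> A_E m X k V \<omega>0 \<phi>0 \<phi>0s \<and> A_T V \<omega>0 \<phi>0 \<phi>0s \<and>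
        A_V m X V \<omega>0 \<delta> \<and> A_Na m X chi3 \<omega>0 \<delta> \<longrightarrow>
        (\<exists>\<epsilon>0 \<omega> u. unique_branch m X k eps0 mu0 V chi3 \<omega>0 \<phi>0 \<phi>0s \<epsilon>0 \<omega> u))"

end

theory Submission
  imports Defs "HOL-Complex_Analysis.Conformal_Mappings"
begin

text \<open>
  Let \<open>PT u x = cnjv (u (- x))\<close>. Symmetry of the material gives \<open>L (cnj \<omega>) (PT u) = - PT (L \<omega> u)\<close>,
  and likewise for the nonlinearity, so \<open>PT\<close> maps solutions at \<open>\<omega>\<close> to solutions at \<open>cnj \<omega>\<close>.
  The kernel of \<open>L \<omega>0\<close> and that of its adjoint are lines that \<open>PT\<close> preserves, hence \<open>\<phi>0\<close> and
  \<open>\<phi>0s\<close> are multiplied by one and the same phase \<open>d\<close>. Therefore \<open>cnj d *s PT u\<close> has the same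
  normalisation as \<open>u\<close>, and uniqueness of the branch gives \<open>cnj \<omega> = \<omega>\<close> and \<open>cnj d *s PT u = u\<close>;
  multiplication by a square root of \<open>d\<close> makes \<open>u\<close> symmetric.

  Two adjustments are needed. The interfaces need not be symmetric about 0, so uniqueness is used for
  a common refinement of the layers and their mirror images. The symmetry of \<open>chi3\<close> holds at real
  frequencies only, so the argument is run for \<open>chi3 x (Re \<omega>)\<close>, whose branch turns out to be real and
  thus to be the branch for \<open>chi3\<close> as well.
\<close>

subsection \<open>Weak derivatives\<close>

text \<open>\<open>weak_deriv\<close> is picked by \<open>SOME\<close>, so nothing can be computed
  with it until weak derivatives are known to be unique almost everywhere; hence the fundamental
  lemma of the calculus of variations, proved here from an explicit family of C1 bumps.

  The main obstacle is an order of inference: the uniqueness statement speaks about complex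
  frequencies, and the mirror image of a solution has frequency \<open>cnj \<omega>\<close>, so the
  coefficients must be symmetric at complex frequencies before the frequency is known to be real.
  For \<open>V\<close> the identity theorem supplies this from the real interval. For
  \<open>chi3\<close>, which is only Lipschitz in the frequency, no such continuation exists; taking
  the real part keeps the Lipschitz constant and so stays within \<open>A_Na\<close>.

  That the two phases agree comes from the normalisation
  \<open>L2_inner \<phi>0 \<phi>0s = 1\<close>, which \<open>PT\<close> conjugates and thus
  preserves.

  A family of solutions is only compared with a unique branch after it has entered the uniqueness
  neighbourhood, so every comparison holds for small \<open>\<epsilon>\<close> only; this is the
  origin of the smaller interval in the conclusion.\<close>

lemma test_funE:
  assumes "test_fun S \<eta>"
  obtains K where "compact K" "K \<subseteq> S" "\<And>x. x \<notin> K \<Longrightarrow> \<eta> x = 0" "\<And>x. x \<notin> K \<Longrightarrow> deriv \<eta> x = 0"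
    "\<And>x. (\<eta> has_real_derivative deriv \<eta> x) (at x)"
    "continuous_on UNIV \<eta>" "continuous_on UNIV (deriv \<eta>)"
proof -
  obtain K where K: "compact K" "K \<subseteq> S" "\<And>x. x \<notin> K \<Longrightarrow> \<eta> x = 0"
    using assms by (auto simp: test_fun_def)
  obtain D where D: "\<And>x. (\<eta> has_vector_derivative D x) (at x)" "continuous_on UNIV D"
    using assms by (auto simp: test_fun_def C1_differentiable_on_def)
  have d: "(\<eta> has_real_derivative D x) (at x)" for x
    using D(1) by (simp add: has_real_derivative_iff_has_vector_derivative)
  have e: "deriv \<eta> = D" using d by (auto intro!: DERIV_imp_deriv)
  have z: "D x = 0" if "x \<notin> K" for x
  proof -
    \<comment> \<open>Around a point off \<open>K\<close> the function \<open>\<eta>\<close> is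
      identically 0, which determines its derivative there.\<close>
    have "open (- K)" using K(1) by (simp add: compact_imp_closed open_Compl)
    moreover have "((\<lambda>x. 0) has_real_derivative 0) (at x)" by simp
    ultimately have "(\<eta> has_real_derivative 0) (at x)"
      using that K(3) by (elim has_field_derivative_transform_within_open) auto
    with d show ?thesis by (blast intro: DERIV_unique)
  qed
  have "continuous_on UNIV \<eta>"
    using d by (intro continuous_at_imp_continuous_on ballI) (blast intro: DERIV_isCont)
  show ?thesis
  proof (rule that)
    show "compact K" "K \<subseteq> S" by fact+
    show "\<eta> x = 0" if "x \<notin> K" for x by (rule K(3)[OF that])
    show "deriv \<eta> x = 0" if "x \<notin> K" for x unfolding e by (rule z[OF that])
    show "(\<eta> has_real_derivative deriv \<eta> x) (at x)" for x unfolding e by (rule d)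
    show "continuous_on UNIV \<eta>" "continuous_on UNIV (deriv \<eta>)" unfolding e by fact+
  qed
qed

lemma lebesgue_on_integral_support:
  fixes f :: "real \<Rightarrow> 'b::euclidean_space"
  assumes "open S" "\<And>x. x \<notin> S \<Longrightarrow> f x = 0"
  shows "(LINT x|lebesgue_on S. f x) = (LINT x|lebesgue. f x)"
proof -
  have "(LINT x|lebesgue_on S. f x) = (LINT x|lebesgue. indicator S x *\<^sub>R f x)"
    using assms(1) by (intro integral_restrict_space) auto
  also have "\<dots> = (LINT x|lebesgue. f x)"
    by (intro Bochner_Integration.integral_cong) (use assms in \<open>auto simp: indicator_def\<close>)
  finally show ?thesis .
qed

text \<open>The weight \<open>z\<close> is bounded on \<open>K\<close> and zero elsewhere, so the
  product is dominated by a multiple of \<open>f\<close> cut off to \<open>K\<close>.\<close>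

lemma integrable_cont_locally_integrable:
  fixes f :: "real \<Rightarrow> 'b::euclidean_space" and z :: "real \<Rightarrow> real"
  assumes "locally_integrable S f" "compact K" "K \<subseteq> S" "continuous_on UNIV z" "\<And>x. x \<notin> K \<Longrightarrow> z x = 0"
  shows "integrable lebesgue (\<lambda>x. z x *\<^sub>R f x)"
proof -
  have Km: "K \<in> sets lebesgue" using assms(2) by (simp add: lmeasurable_compact fmeasurableD)
  have i: "integrable lebesgue (\<lambda>x. indicator K x *\<^sub>R f x)"
    using assms(1-3) Km unfolding locally_integrable_def
    by (auto simp: integrable_restrict_space)
  have "bounded (z ` K)"
    using assms(2,4) by (intro compact_imp_bounded compact_continuous_image) (auto intro: continuous_on_subset)
  then obtain B where B: "\<And>x. x \<in> K \<Longrightarrow> \<bar>z x\<bar> \<le> B" by (auto simp: bounded_iff)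
  have zm: "z \<in> borel_measurable lebesgue"
    using assms(4) by (simp add: borel_measurable_continuous_onI measurable_completion)
  have eq: "z x *\<^sub>R f x = z x *\<^sub>R (indicator K x *\<^sub>R f x)" for x
    using assms(5)[of x] by (auto simp: indicator_def)
  show ?thesis
    unfolding eq
  proof (rule Bochner_Integration.integrable_bound[OF integrable_scaleR_right[OF i, of "B"]])
    show "(\<lambda>x. z x *\<^sub>R (indicator K x *\<^sub>R f x)) \<in> borel_measurable lebesgue"
      using zm borel_measurable_integrable[OF i] by (rule borel_measurable_scaleR)
    show "AE x in lebesgue. norm (z x *\<^sub>R indicat_real K x *\<^sub>R f x) \<le> norm (B *\<^sub>R indicat_real K x *\<^sub>R f x)"
    proof (rule AE_I2)
      fix x
      show "norm (z x *\<^sub>R indicat_real K x *\<^sub>R f x) \<le> norm (B *\<^sub>R indicat_real K x *\<^sub>R f x)"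
        using B[of x] mult_right_mono[of "\<bar>z x\<bar>" "\<bar>B\<bar>" "norm (f x)"] by (cases "x \<in> K") auto
    qed
  qed
qed

lemma integrable_test_fun:
  fixes f :: "real \<Rightarrow> 'b::euclidean_space"
  assumes "locally_integrable S f" "test_fun S \<eta>"
  shows "integrable lebesgue (\<lambda>x. \<eta> x *\<^sub>R f x)" "integrable lebesgue (\<lambda>x. deriv \<eta> x *\<^sub>R f x)"
proof -
  obtain K where K: "compact K" "K \<subseteq> S" "\<And>x. x \<notin> K \<Longrightarrow> \<eta> x = 0" "\<And>x. x \<notin> K \<Longrightarrow> deriv \<eta> x = 0"
    "\<And>x. (\<eta> has_real_derivative deriv \<eta> x) (at x)" "continuous_on UNIV \<eta>" "continuous_on UNIV (deriv \<eta>)"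
    by (rule test_funE[OF assms(2)], rule that)
  show "integrable lebesgue (\<lambda>x. \<eta> x *\<^sub>R f x)"
    by (rule integrable_cont_locally_integrable[OF assms(1) K(1,2,6,3)])
  show "integrable lebesgue (\<lambda>x. deriv \<eta> x *\<^sub>R f x)"
    by (rule integrable_cont_locally_integrable[OF assms(1) K(1,2,7,4)])
qed

text \<open>Test functions and their derivatives vanish off \<open>S\<close>. With all integrals
  taken over the whole line, changing or reflecting \<open>S\<close> no longer changes the
  measure.\<close>

lemma is_weak_deriv_iff:
  fixes f :: "real \<Rightarrow> 'b::euclidean_space"
  assumes "open S"
  shows "is_weak_deriv S f g \<longleftrightarrow> locally_integrable S f \<and> locally_integrable S g \<and>
     (\<forall>\<eta>. test_fun S \<eta> \<longrightarrow>
        (LINT x|lebesgue. deriv \<eta> x *\<^sub>R f x) = - (LINT x|lebesgue. \<eta> x *\<^sub>R g x))"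
proof -
  \<comment> \<open>\<open>J\<close> keeps the integrals folded, so that the equivalence under the
    quantifier over test functions is plain rewriting.\<close>
  define J where "J M f \<eta> = (LINT x|M. \<eta> x *\<^sub>R f x)"
    for M and f :: "real \<Rightarrow> 'b" and \<eta> :: "real \<Rightarrow> real"
  have "J (lebesgue_on S) g \<eta> = J lebesgue g \<eta> \<and> J (lebesgue_on S) f (deriv \<eta>) = J lebesgue f (deriv \<eta>)"
    if t: "test_fun S \<eta>" for \<eta>
  proof -
    have "\<eta> x = 0 \<and> deriv \<eta> x = 0" if "x \<notin> S" for x
      by (rule test_funE[OF t]) (use that in blast)
    then show ?thesis
      unfolding J_def by (intro conjI lebesgue_on_integral_support assms) simp_all
  qed
  then have "(\<forall>\<eta>. test_fun S \<eta> \<longrightarrow> J (lebesgue_on S) f (deriv \<eta>) = - J (lebesgue_on S) g \<eta>) \<longleftrightarrow>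
      (\<forall>\<eta>. test_fun S \<eta> \<longrightarrow> J lebesgue f (deriv \<eta>) = - J lebesgue g \<eta>)"
    by auto
  then show ?thesis unfolding is_weak_deriv_def J_def by (simp only:)
qed

lemma is_weak_derivD:
  fixes f :: "real \<Rightarrow> 'b::euclidean_space"
  assumes "is_weak_deriv S f g" "open S"
  shows "locally_integrable S f" "locally_integrable S g"
    "test_fun S \<eta> \<Longrightarrow> (LINT x|lebesgue. deriv \<eta> x *\<^sub>R f x) = - (LINT x|lebesgue. \<eta> x *\<^sub>R g x)"
  using assms(1) unfolding is_weak_deriv_iff[OF assms(2)] by blast+

lemma is_weak_derivI:
  fixes f :: "real \<Rightarrow> 'b::euclidean_space"
  assumes "open S" "locally_integrable S f" "locally_integrable S g"
    "\<And>\<eta>. test_fun S \<eta> \<Longrightarrow> (LINT x|lebesgue. deriv \<eta> x *\<^sub>R f x) = - (LINT x|lebesgue. \<eta> x *\<^sub>R g x)"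
  shows "is_weak_deriv S f g"
  unfolding is_weak_deriv_iff[OF assms(1)] by (intro conjI allI impI assms)

lemma test_fun_mono: "test_fun T \<eta> \<Longrightarrow> T \<subseteq> S \<Longrightarrow> test_fun S \<eta>"
  by (auto simp: test_fun_def)

lemma locally_integrable_mono: "locally_integrable S f \<Longrightarrow> T \<subseteq> S \<Longrightarrow> locally_integrable T f"
  by (auto simp: locally_integrable_def)

lemma is_weak_deriv_mono:
  assumes "is_weak_deriv S f g" "open S" "open T" "T \<subseteq> S"
  shows "is_weak_deriv T f g"
proof (rule is_weak_derivI[OF assms(3)])
  show "locally_integrable T f" "locally_integrable T g"
    using is_weak_derivD(1,2)[OF assms(1,2)] assms(4) by (auto intro: locally_integrable_mono)
  show "(LINT x|lebesgue. deriv \<eta> x *\<^sub>R f x) = - (LINT x|lebesgue. \<eta> x *\<^sub>R g x)" if "test_fun T \<eta>" for \<eta>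
    by (rule is_weak_derivD(3)[OF assms(1,2) test_fun_mono[OF that assms(4)]])
qed

lemma locally_integrable_bounded_linear:
  assumes "bounded_linear T" "locally_integrable S f"
  shows "locally_integrable S (\<lambda>x. T (f x))"
  using assms by (auto simp: locally_integrable_def intro: integrable_bounded_linear)

lemma is_weak_deriv_bounded_linear:
  assumes "open S" "bounded_linear T" "is_weak_deriv S f g"
  shows "is_weak_deriv S (\<lambda>x. T (f x)) (\<lambda>x. T (g x))"
proof -
  interpret T: bounded_linear T by fact
  have "(LINT x|lebesgue. deriv \<eta> x *\<^sub>R T (f x)) = - (LINT x|lebesgue. \<eta> x *\<^sub>R T (g x))"
    if t: "test_fun S \<eta>" for \<eta>
  proof -
    note l = is_weak_derivD(1,2)[OF assms(3,1)]
    have "(LINT x|lebesgue. deriv \<eta> x *\<^sub>R T (f x)) = T (LINT x|lebesgue. deriv \<eta> x *\<^sub>R f x)"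
      using integral_bounded_linear[OF assms(2) integrable_test_fun(2)[OF l(1) t]]
      by (simp add: T.scaleR)
    also have "\<dots> = T (- (LINT x|lebesgue. \<eta> x *\<^sub>R g x))"
      by (simp only: is_weak_derivD(3)[OF assms(3,1) t])
    also have "\<dots> = - (LINT x|lebesgue. \<eta> x *\<^sub>R T (g x))"
      using integral_bounded_linear[OF assms(2) integrable_test_fun(1)[OF l(2) t]]
      by (simp add: T.scaleR T.neg)
    finally show ?thesis .
  qed
  then show ?thesis
    by (rule is_weak_derivI[OF assms(1) locally_integrable_bounded_linear[OF assms(2) is_weak_derivD(1)[OF assms(3,1)]]
          locally_integrable_bounded_linear[OF assms(2) is_weak_derivD(2)[OF assms(3,1)]]])
qed

lemma locally_integrable_diff:
  "locally_integrable S f \<Longrightarrow> locally_integrable S g \<Longrightarrow> locally_integrable S (\<lambda>x. f x - g x)"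
  by (auto simp: locally_integrable_def)

lemma is_weak_deriv_diff:
  fixes f1 f2 :: "real \<Rightarrow> 'b::euclidean_space"
  assumes S: "open S" and "is_weak_deriv S f1 g1" "is_weak_deriv S f2 g2"
  shows "is_weak_deriv S (\<lambda>x. f1 x - f2 x) (\<lambda>x. g1 x - g2 x)"
proof -
  note l = is_weak_derivD(1)[OF assms(2) S] is_weak_derivD(1)[OF assms(3) S]
    is_weak_derivD(2)[OF assms(2) S] is_weak_derivD(2)[OF assms(3) S]
  have "(LINT x|lebesgue. deriv \<eta> x *\<^sub>R (f1 x - f2 x)) = - (LINT x|lebesgue. \<eta> x *\<^sub>R (g1 x - g2 x))"
    if t: "test_fun S \<eta>" for \<eta>
  proof -
    have "(LINT x|lebesgue. deriv \<eta> x *\<^sub>R (f1 x - f2 x))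
      = (LINT x|lebesgue. deriv \<eta> x *\<^sub>R f1 x) - (LINT x|lebesgue. deriv \<eta> x *\<^sub>R f2 x)"
      unfolding scaleR_right_diff_distrib
      by (rule Bochner_Integration.integral_diff[OF integrable_test_fun(2)[OF l(1) t] integrable_test_fun(2)[OF l(2) t]])
    also have "\<dots> = - ((LINT x|lebesgue. \<eta> x *\<^sub>R g1 x) - (LINT x|lebesgue. \<eta> x *\<^sub>R g2 x))"
      unfolding is_weak_derivD(3)[OF assms(2) S t] is_weak_derivD(3)[OF assms(3) S t] by simp
    also have "\<dots> = - (LINT x|lebesgue. \<eta> x *\<^sub>R (g1 x - g2 x))"
      unfolding scaleR_right_diff_distrib
      by (subst Bochner_Integration.integral_diff[OF integrable_test_fun(1)[OF l(3) t] integrable_test_fun(1)[OF l(4) t]]) simp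
    finally show ?thesis .
  qed
  then show ?thesis
    by (rule is_weak_derivI[OF S locally_integrable_diff[OF l(1,2)] locally_integrable_diff[OF l(3,4)]])
qed

subsection \<open>Uniqueness of weak derivatives\<close>

text \<open>Squaring removes the kink of the positive part: at 0 the difference quotient is at most
  \<open>\<bar>h\<bar>\<close>. This is what makes the bumps below C1.\<close>

lemma has_real_derivative_max_0_power2:
  "((\<lambda>t::real. (max 0 t)\<^sup>2) has_real_derivative 2 * max 0 t) (at t)"
proof -
  consider "t < 0" | "t > 0" | "t = 0" by linarith
  then show ?thesis
  proof cases
    case 1
    have "((\<lambda>t::real. 0) has_real_derivative 0) (at t)" by simp
    then have "((\<lambda>t::real. (max 0 t)\<^sup>2) has_real_derivative 0) (at t)"
      by (rule has_field_derivative_transform_within_open[where S="{..<0}"]) (use 1 in auto)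
    with 1 show ?thesis by simp
  next
    case 2
    have "((\<lambda>t::real. t\<^sup>2) has_real_derivative 2 * t) (at t)"
      by (auto intro!: derivative_eq_intros)
    then have "((\<lambda>t::real. (max 0 t)\<^sup>2) has_real_derivative 2 * t) (at t)"
      by (rule has_field_derivative_transform_within_open[where S="{0<..}"]) (use 2 in auto)
    with 2 show ?thesis by simp
  next
    case 3
    have "((\<lambda>h::real. (max 0 h)\<^sup>2 / h) \<longlongrightarrow> 0) (at 0)"
    proof (rule Lim_null_comparison[where g = "\<lambda>h. \<bar>h\<bar>"])
      have "norm ((max 0 h)\<^sup>2 / h) \<le> \<bar>h\<bar>" for h :: real
        by (cases "h = 0") (auto simp: max_def power2_eq_square)
      then show "\<forall>\<^sub>F h::real in at 0. norm ((max 0 h)\<^sup>2 / h) \<le> \<bar>h\<bar>" by simp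
      show "((\<lambda>h::real. \<bar>h\<bar>) \<longlongrightarrow> 0) (at 0)" by (auto intro!: tendsto_eq_intros)
    qed
    then show ?thesis using 3 by (simp add: DERIV_def)
  qed
qed

text \<open>The parabola \<open>q\<close> is positive exactly on the open interval, and its squared
  positive part \<open>p\<close> is C1 with values in \<open>[0, 1]\<close>. Hence
  \<open>(1 - p) ^ n\<close> tends to 0 where \<open>p > 0\<close> and stays 1 elsewhere, so
  \<open>1 - (1 - p) ^ n\<close> tends to the indicator.\<close>

lemma ex_test_fun_approx_interval:
  fixes a b :: real
  assumes "a < b"
  obtains \<zeta> :: "nat \<Rightarrow> real \<Rightarrow> real" where
    "\<And>n. \<zeta> n C1_differentiable_on UNIV" "\<And>n x. x \<notin> {a..b} \<Longrightarrow> \<zeta> n x = 0"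
    "\<And>n x. \<bar>\<zeta> n x\<bar> \<le> 1" "\<And>x. (\<lambda>n. \<zeta> n x) \<longlonglongrightarrow> indicator {a<..<b} x"
proof -
  \<comment> \<open>This scaling bounds the parabola by 1 (its maximum is a quarter of
    \<open>c\<close>), so that \<open>1 - p\<close> lies in \<open>[0, 1]\<close>.\<close>
  define c where "c = (b - a)\<^sup>2"
  have c: "c > 0" using assms by (simp add: c_def)
  define q where "q x = (x - a) * (b - x) / c" for x
  define p where "p x = (max 0 (q x))\<^sup>2" for x
  define \<zeta> where "\<zeta> n x = 1 - (1 - p x) ^ n" for n x
  have qpos: "q x > 0 \<longleftrightarrow> x \<in> {a<..<b}" for x
    using c assms by (auto simp: q_def zero_less_divide_iff zero_less_mult_iff)
  have q1: "q x \<le> 1" for x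
  proof -
    \<comment> \<open>With \<open>s = x - a\<close> and \<open>t = b - x\<close>, whose sum is
      \<open>b - a\<close>, this reads
      \<open>(s + t)^2 - s * t = (s - t)^2 + 3 * s * t\<close>.\<close>
    have "(b - a)\<^sup>2 - (x - a) * (b - x) = ((x - a) - (b - x))\<^sup>2 + 3 * ((x - a) * (b - x))"
      by (simp add: power2_eq_square algebra_simps)
    moreover have "(x - a) * (b - x) \<le> (b - a)\<^sup>2"
    proof (cases "(x - a) * (b - x) \<ge> 0")
      case False then show ?thesis by (smt (verit) zero_le_power2)
    next
      case True with calculation show ?thesis by (smt (verit) zero_le_power2)
    qed
    ultimately show ?thesis using c by (simp add: q_def c_def)
  qed
  have p01: "0 \<le> p x" "p x \<le> 1" for x
    using q1[of x] by (auto simp: p_def power_le_one_iff)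
  have ppos: "p x > 0" if "x \<in> {a<..<b}" for x
    using that qpos[of x] by (simp add: p_def)
  have p0: "p x = 0" if "x \<notin> {a<..<b}" for x
    using that qpos[of x] by (auto simp: p_def max_def)
  have dp: "(p has_real_derivative (2 * max 0 (q x) * ((a + b - 2 * x) / c))) (at x)" for x
  proof -
    have "(q has_real_derivative (a + b - 2 * x) / c) (at x)"
      unfolding q_def using c by (auto intro!: derivative_eq_intros simp: divide_simps algebra_simps)
    from DERIV_chain2[OF has_real_derivative_max_0_power2 this] show ?thesis unfolding p_def .
  qed
  have cq: "continuous_on UNIV q" unfolding q_def using c by (auto intro!: continuous_intros)
  have cp: "continuous_on UNIV p" unfolding p_def by (intro continuous_intros cq)
  show ?thesis
  proof (rule that[of \<zeta>])
    fix n
    let ?D = "\<lambda>x. real n * (1 - p x) ^ (n - 1) * (2 * max 0 (q x) * ((a + b - 2 * x) / c))"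
    have "(\<zeta> n has_vector_derivative ?D x) (at x)" for x
      unfolding \<zeta>_def has_real_derivative_iff_has_vector_derivative[symmetric]
      by (auto intro!: derivative_eq_intros dp)
    moreover have "continuous_on UNIV ?D"
      using c by (intro continuous_intros cp cq) auto
    ultimately show "\<zeta> n C1_differentiable_on UNIV"
      unfolding C1_differentiable_on_def by (intro exI[of _ ?D] conjI ballI)
  next
    fix n x assume "x \<notin> {a..b}"
    then have "p x = 0" by (intro p0) auto
    then show "\<zeta> n x = 0" by (simp add: \<zeta>_def)
  next
    fix n x
    have "0 \<le> (1 - p x) ^ n" "(1 - p x) ^ n \<le> 1"
      using p01[of x] by (auto simp: power_le_one_iff)
    then show "\<bar>\<zeta> n x\<bar> \<le> 1" by (simp add: \<zeta>_def)
  next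
    fix x
    show "(\<lambda>n. \<zeta> n x) \<longlonglongrightarrow> indicator {a<..<b} x"
    proof (cases "x \<in> {a<..<b}")
      case True
      have "(\<lambda>n. (1 - p x) ^ n) \<longlonglongrightarrow> 0"
        using ppos[OF True] p01[of x] by (intro LIMSEQ_realpow_zero) auto
      then have "(\<lambda>n. 1 - (1 - p x) ^ n) \<longlonglongrightarrow> 1 - 0" by (rule tendsto_diff[OF tendsto_const])
      moreover have "indicator {a<..<b} x = (1 - 0 :: real)" using True by simp
      ultimately show ?thesis unfolding \<zeta>_def by (simp only:)
    next
      case False
      then show ?thesis using p0[OF False] by (simp add: \<zeta>_def)
    qed
  qed
qed

text \<open>Dominated convergence passes from bounded intervals to half-lines. The positive and
  negative parts are then densities of finite measures that agree on half-lines, so the measures and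
  hence their densities coincide.\<close>

lemma AE_zero_if_interval_integrals_zero:
  fixes f :: "real \<Rightarrow> real"
  assumes f: "integrable lebesgue f"
    and z: "\<And>a b. (LINT x|lebesgue. indicator {a<..<b} x * f x) = 0"
  shows "AE x in lebesgue. f x = 0"
proof -
  \<comment> \<open>A Borel representative is taken because the measures compared below live on the
    Borel sets.\<close>
  obtain g where g: "g \<in> borel_measurable lborel" and fg: "AE x in lborel. f x = g x"
    using completion_ex_borel_measurable_real[of f lborel] f by auto
  have fg': "AE x in lebesgue. f x = g x" using fg by (rule AE_completion)
  have gl: "integrable lebesgue g"
    by (rule integrable_cong_AE_imp[OF f]) (use g fg' in \<open>auto intro: measurable_completion\<close>)
  then have gi: "integrable lborel g" by (simp add: integrable_completion[OF g])
  have half: "(LINT x|lborel. indicator {y<..} x * g x) = 0" for y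
  proof -
    have a: "(LINT x|lborel. indicator {y<..<y + real n} x * g x) = 0" for n
    proof -
      have "(LINT x|lborel. indicator {y<..<y + real n} x * g x) = (LINT x|lebesgue. indicator {y<..<y + real n} x * g x)"
        using g by (intro integral_completion[symmetric]) auto
      also have "\<dots> = (LINT x|lebesgue. indicator {y<..<y + real n} x * f x)"
        using fg' borel_measurable_integrable[OF f] borel_measurable_integrable[OF gl]
        by (intro integral_cong_AE borel_measurable_times borel_measurable_indicator) (auto elim: AE_mp)
      finally show ?thesis using z by simp
    qed
    have "(\<lambda>n. LINT x|lborel. indicator {y<..<y + real n} x * g x) \<longlonglongrightarrow> (LINT x|lborel. indicator {y<..} x * g x)"
    proof (rule integral_dominated_convergence[where w = "\<lambda>x. norm (g x)"])
      show "AE x in lborel. (\<lambda>n. indicator {y<..<y + real n} x * g x) \<longlonglongrightarrow> indicator {y<..} x * g x"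
      proof (rule AE_I2)
        fix x
        obtain N where "x - y < real N" using reals_Archimedean2 by blast
        then have N: "x < y + real N" by simp
        have "\<forall>n\<ge>N. indicator {y<..<y + real n} x * g x = indicator {y<..} x * g x"
          using N by (auto simp: indicator_def)
        then show "(\<lambda>n. indicator {y<..<y + real n} x * g x) \<longlonglongrightarrow> indicator {y<..} x * g x"
          by (intro tendsto_eventually) (auto simp: eventually_sequentially)
      qed
    qed (use g gi in \<open>auto simp: indicator_def\<close>)
    then show ?thesis unfolding a by (simp add: LIMSEQ_const_iff)
  qed
  define gp gn where "gp x = max 0 (g x)" and "gn x = max 0 (- g x)" for x
  have ints: "integrable lborel gp" "integrable lborel gn"
    unfolding gp_def[abs_def] gn_def[abs_def] using gi by auto
  have em: "emeasure (density lborel h) {y<..} = ennreal (LINT x|lborel. indicator {y<..} x * h x)"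
    if "integrable lborel h" "\<And>x. h x \<ge> 0" for h :: "real \<Rightarrow> real" and y
  proof -
    have "emeasure (density lborel h) {y<..} = (\<integral>\<^sup>+x. ennreal (indicator {y<..} x * h x) \<partial>lborel)"
      using that by (subst emeasure_density)
        (auto intro!: nn_integral_cong simp: indicator_def)
    also have "\<dots> = ennreal (LINT x|lborel. indicator {y<..} x * h x)"
      using that integrable_mult_indicator[of "{y<..}" lborel h]
      by (intro nn_integral_eq_integral) auto
    finally show ?thesis .
  qed
  have "density lborel gp = density lborel gn"
  proof (rule measure_eqI_lessThan)
    fix y
    show "emeasure (density lborel gp) {y<..} < \<infinity>"
      using em[OF ints(1), of y] by (simp add: gp_def)
    have i: "integrable lborel (\<lambda>x. indicator {y<..} x * gp x)" "integrable lborel (\<lambda>x. indicator {y<..} x * gn x)"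
      using integrable_mult_indicator[of "{y<..}" lborel gp] integrable_mult_indicator[of "{y<..}" lborel gn] ints
      by auto
    have "(LINT x|lborel. indicator {y<..} x * gp x) - (LINT x|lborel. indicator {y<..} x * gn x)
        = (LINT x|lborel. indicator {y<..} x * gp x - indicator {y<..} x * gn x)"
      using i by simp
    also have "\<dots> = (LINT x|lborel. indicator {y<..} x * g x)"
      by (intro Bochner_Integration.integral_cong) (auto simp: gp_def gn_def indicator_def)
    finally have "(LINT x|lborel. indicator {y<..} x * gp x) = (LINT x|lborel. indicator {y<..} x * gn x)"
      using half by simp
    with em[OF ints(1), of y] em[OF ints(2), of y]
    show "emeasure (density lborel gp) {y<..} = emeasure (density lborel gn) {y<..}"
      by (simp add: gp_def gn_def)
  qed auto
  \<comment> \<open>At each point one of \<open>gp\<close>, \<open>gn\<close> is 0, so their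
    equality forces both to vanish.\<close>
  then have "AE x in lborel. ennreal (gp x) = ennreal (gn x)"
    using ints by (subst (asm) sigma_finite_measure.density_unique_iff[OF sigma_finite_lborel]) auto
  then have "AE x in lborel. g x = 0"
    by eventually_elim (auto simp: gp_def gn_def max_def split: if_splits)
  then have "AE x in lebesgue. g x = 0" by (rule AE_completion)
  with fg' show ?thesis by eventually_elim simp
qed

text \<open>Fundamental lemma of the calculus of variations: on a compact interval inside
  \<open>S\<close>, bumps approximate indicators boundedly, so all interval integrals of
  \<open>g\<close> vanish there; countably many intervals then exhaust \<open>S\<close>.\<close>

lemma AE_zero_if_test_fun_orthogonal_real:
  fixes g :: "real \<Rightarrow> real"
  assumes S: "open S" and g: "locally_integrable S g"
    and z: "\<And>\<eta>. test_fun S \<eta> \<Longrightarrow> (LINT x|lebesgue. \<eta> x * g x) = 0"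
  shows "AE x in lebesgue. x \<in> S \<longrightarrow> g x = 0"
proof -
  have box: "AE x in lebesgue. x \<in> {c<..<d} \<longrightarrow> g x = 0" if cd: "{c..d} \<subseteq> S" for c d
  proof -
    define f where "f x = indicator {c..d} x * g x" for x
    have "integrable (lebesgue_on {c..d}) g"
      using g cd by (simp add: locally_integrable_def)
    then have f: "integrable lebesgue f"
      unfolding f_def by (simp add: integrable_restrict_space)
    have "(LINT x|lebesgue. indicator {a<..<b} x * (indicator {c<..<d} x * f x)) = 0" for a b
    proof -
      \<comment> \<open>Intersecting with \<open>{c<..<d}\<close> keeps the support of the bumps
        inside \<open>S\<close>, so they are admissible test functions.\<close>
      define a' b' where "a' = max a c" and "b' = min b d"
      have eq: "indicator {a<..<b} x * (indicator {c<..<d} x * f x) = indicator {a'<..<b'} x * f x" for x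
        by (auto simp: indicator_def a'_def b'_def)
      have "(LINT x|lebesgue. indicator {a'<..<b'} x * f x) = 0"
      proof (cases "a' < b'")
        case True
        obtain \<zeta> :: "nat \<Rightarrow> real \<Rightarrow> real" where \<zeta>: "\<And>n. \<zeta> n C1_differentiable_on UNIV"
          "\<And>n x. x \<notin> {a'..b'} \<Longrightarrow> \<zeta> n x = 0" "\<And>n x. \<bar>\<zeta> n x\<bar> \<le> 1"
          "\<And>x. (\<lambda>n. \<zeta> n x) \<longlonglongrightarrow> indicator {a'<..<b'} x"
          by (rule ex_test_fun_approx_interval[OF True], rule that)
        have sub: "{a'..b'} \<subseteq> {c..d}" by (auto simp: a'_def b'_def)
        have m: "\<zeta> n \<in> borel_measurable lebesgue" for n
          using C1_differentiable_imp_continuous_on[OF \<zeta>(1)[of n]]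
          by (simp add: borel_measurable_continuous_onI measurable_completion)
        have n0: "(LINT x|lebesgue. \<zeta> n x * f x) = 0" for n
        proof -
          have "test_fun S (\<zeta> n)"
            unfolding test_fun_def using \<zeta>(1,2) sub cd by (intro conjI exI[of _ "{a'..b'}"]) auto
          from z[OF this] have "(LINT x|lebesgue. \<zeta> n x * g x) = 0" .
          moreover have "\<zeta> n x * g x = \<zeta> n x * f x" for x
            using \<zeta>(2)[of x n] sub by (cases "x \<in> {a'..b'}") (auto simp: f_def indicator_def)
          ultimately show ?thesis by simp
        qed
        have "(\<lambda>n. LINT x|lebesgue. \<zeta> n x * f x) \<longlonglongrightarrow> (LINT x|lebesgue. indicator {a'<..<b'} x * f x)"
        proof (rule integral_dominated_convergence[where w = "\<lambda>x. norm (f x)"])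
          show "AE x in lebesgue. (\<lambda>n. \<zeta> n x * f x) \<longlonglongrightarrow> indicator {a'<..<b'} x * f x"
            by (intro AE_I2 tendsto_mult_right \<zeta>(4))
          show "AE x in lebesgue. norm (\<zeta> n x * f x) \<le> norm (f x)" for n
            using \<zeta>(3) mult_right_mono[of "\<bar>\<zeta> n _\<bar>" 1 "\<bar>f _\<bar>"] by (intro AE_I2) (simp add: abs_mult)
          show "integrable lebesgue (\<lambda>x. norm (f x))" using f by simp
          show "(\<lambda>x. \<zeta> n x * f x) \<in> borel_measurable lebesgue" for n
            by (rule borel_measurable_times[OF m borel_measurable_integrable[OF f]])
          show "(\<lambda>x. indicator {a'<..<b'} x * f x) \<in> borel_measurable lebesgue"
            by (rule borel_measurable_times[OF borel_measurable_indicator borel_measurable_integrable[OF f]]) simp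
        qed
        then show ?thesis unfolding n0 by (simp add: LIMSEQ_const_iff)
      qed simp
      then show ?thesis unfolding eq .
    qed
    moreover have "integrable lebesgue (\<lambda>x. indicator {c<..<d} x * f x)"
      using integrable_mult_indicator[of "{c<..<d}" lebesgue f] f by simp
    ultimately have "AE x in lebesgue. indicator {c<..<d} x * f x = 0"
      by (intro AE_zero_if_interval_integrals_zero)
    then show ?thesis by eventually_elim (auto simp: f_def indicator_def)
  qed
  \<comment> \<open>Rational end points leave only countably many exceptional null sets.\<close>
  have "AE x in lebesgue. \<forall>p\<in>\<rat> \<times> \<rat>. {fst p..snd p} \<subseteq> S \<longrightarrow> x \<in> {fst p<..<snd p} \<longrightarrow> g x = 0"
    using box by (subst AE_ball_countable) (auto intro: countable_SIGMA countable_rat)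
  then show ?thesis
  proof eventually_elim
    case (elim x)
    show ?case
    proof
      assume "x \<in> S"
      then obtain e where e: "e > 0" "ball x e \<subseteq> S" using S by (auto simp: open_contains_ball)
      obtain c d where "c \<in> \<rat>" "x - e < c" "c < x" "d \<in> \<rat>" "x < d" "d < x + e"
        using Rats_dense_in_real[of "x - e" x] Rats_dense_in_real[of x "x + e"] e(1) by auto
      moreover from this have "{c..d} \<subseteq> S" using e(2) by (intro subset_trans[OF _ e(2)]) (auto simp: dist_real_def)
      ultimately show "g x = 0" using elim[rule_format, of "(c, d)"] by simp
    qed
  qed
qed

lemma AE_lebesgue_on_open:
  fixes S :: "real set"
  assumes "open S"
  shows "(AE x in lebesgue_on S. P x) \<longleftrightarrow> (AE x in lebesgue. x \<in> S \<longrightarrow> P x)"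
  using assms by (intro AE_restrict_space_iff) auto

text \<open>The difference of the two derivatives is a weak derivative of 0, so each of its
  coordinates is orthogonal to all test functions.\<close>

lemma is_weak_deriv_unique:
  fixes f :: "real \<Rightarrow> 'b::euclidean_space"
  assumes S: "open S" and "is_weak_deriv S f g" "is_weak_deriv S f h"
  shows "AE x in lebesgue_on S. g x = h x"
proof -
  have w: "is_weak_deriv S (\<lambda>x. f x - f x) (\<lambda>x. g x - h x)"
    using assms by (rule is_weak_deriv_diff)
  have "AE x in lebesgue. x \<in> S \<longrightarrow> (g x - h x) \<bullet> b = 0" if "b \<in> Basis" for b
  proof -
    have wb: "is_weak_deriv S (\<lambda>x. (f x - f x) \<bullet> b) (\<lambda>x. (g x - h x) \<bullet> b)"
      by (rule is_weak_deriv_bounded_linear[OF S bounded_linear_inner_left w])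
    show ?thesis
    proof (rule AE_zero_if_test_fun_orthogonal_real[OF S is_weak_derivD(2)[OF wb S]])
      fix \<eta> assume "test_fun S \<eta>"
      from is_weak_derivD(3)[OF wb S this]
      show "(LINT x|lebesgue. \<eta> x * ((g x - h x) \<bullet> b)) = 0" by simp
    qed
  qed
  then have "AE x in lebesgue. \<forall>b\<in>Basis. x \<in> S \<longrightarrow> (g x - h x) \<bullet> b = 0"
    by (subst AE_ball_countable) (auto intro: countable_finite)
  then show ?thesis
    unfolding AE_lebesgue_on_open[OF S] by eventually_elim (rule impI, rule euclidean_eqI, simp add: inner_diff_left)
qed

lemma is_weak_deriv_weak_deriv:
  assumes "is_weak_deriv S f g"
  shows "is_weak_deriv S f (weak_deriv S f)"
  unfolding weak_deriv_def by (rule someI[of "is_weak_deriv S f", OF assms])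

lemma weak_deriv_AE_eq:
  assumes "open S" "is_weak_deriv S f g"
  shows "AE x in lebesgue_on S. weak_deriv S f x = g x"
  by (rule is_weak_deriv_unique[OF assms(1) is_weak_deriv_weak_deriv[OF assms(2)] assms(2)])

subsection \<open>Lebesgue and Sobolev spaces\<close>

text \<open>An open set is a countable union of compact boxes, and on each of them \<open>f\<close>
  is integrable. Needed for \<open>weak_deriv\<close>, of which the choice guarantees only local
  integrability.\<close>

lemma locally_integrable_borel_measurable:
  fixes f :: "real \<Rightarrow> 'b::euclidean_space"
  assumes "open S" "locally_integrable S f"
  shows "f \<in> borel_measurable (lebesgue_on S)"
proof -
  obtain \<D> where D: "countable \<D>" "\<D> \<subseteq> Pow S" "\<And>X. X \<in> \<D> \<Longrightarrow> \<exists>a b. X = cbox a b" "\<Union>\<D> = S"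
    using open_countable_Union_open_cbox[OF assms(1)] by metis
  show ?thesis
  proof (rule measurable_piecewise_restrict[OF D(1)])
    fix K assume K: "K \<in> \<D>"
    have cK: "compact K" "K \<subseteq> S" using D(2,3) K by auto
    then have "K \<in> sets lebesgue" by (simp add: lmeasurable_compact fmeasurableD)
    then show "K \<inter> space (lebesgue_on S) \<in> sets (lebesgue_on S)"
      using cK(2) assms(1) by (auto simp: sets_restrict_space)
    have "restrict_space (lebesgue_on S) K = lebesgue_on K"
      using cK(2) \<open>K \<in> sets lebesgue\<close> assms(1) by (subst restrict_restrict_space) (auto simp: Int_absorb1)
    moreover have "integrable (lebesgue_on K) f"
      using assms(2) cK by (simp add: locally_integrable_def)
    ultimately show "f \<in> borel_measurable (restrict_space (lebesgue_on S) K)" by auto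
  next
    show "space (lebesgue_on S) \<subseteq> \<Union>\<D>" using D(4) by simp
  qed
qed

text \<open>On a compact set the constant 1 is integrable, and \<open>norm (f x)\<close> is at most
  \<open>1 + (norm (f x))^2\<close>.\<close>

lemma L2_locally_integrable:
  fixes f :: "real \<Rightarrow> 'b::euclidean_space"
  assumes "f \<in> L2 S" "open S"
  shows "locally_integrable S f"
  unfolding locally_integrable_def
proof (intro allI impI, elim conjE)
  fix K assume K: "compact K" "K \<subseteq> S"
  have Km: "K \<in> sets lebesgue" "K \<in> lmeasurable"
    using K(1) lmeasurable_compact by (auto simp: fmeasurableD)
  have rs: "restrict_space (lebesgue_on S) K = lebesgue_on K"
    using K(2) Km assms(2) by (subst restrict_restrict_space) (auto simp: Int_absorb1)
  have fm: "f \<in> borel_measurable (lebesgue_on K)"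
    using assms(1) K(2) by (auto simp: L2_def intro: measurable_restrict_mono)
  have "integrable (restrict_space (lebesgue_on S) K) (\<lambda>x. (norm (f x))\<^sup>2)"
  proof (subst integrable_restrict_space)
    show "K \<inter> space (lebesgue_on S) \<in> sets (lebesgue_on S)"
      using K(2) Km assms(2) by (auto simp: sets_restrict_space)
    show "integrable (lebesgue_on S) (\<lambda>x. indicator K x *\<^sub>R (norm (f x))\<^sup>2)"
      using assms(1) K(2) Km assms(2)
      by (intro integrable_mult_indicator) (auto simp: L2_def sets_restrict_space)
  qed
  then have i: "integrable (lebesgue_on K) (\<lambda>x. (norm (f x))\<^sup>2)" unfolding rs .
  have "integrable (lebesgue_on K) (\<lambda>x. 1 :: real)"
    using integrable_real_indicator[OF Km(1)] fmeasurableD2[OF Km(2)] Km(1)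
    by (simp add: integrable_restrict_space top.not_eq_extremum)
  with i have "integrable (lebesgue_on K) (\<lambda>x. 1 + (norm (f x))\<^sup>2)" by simp
  then show "integrable (lebesgue_on K) f"
  proof (rule Bochner_Integration.integrable_bound)
    have "norm (f x) \<le> 1 + (norm (f x))\<^sup>2" for x
    proof -
      have "2 * norm (f x) \<le> (norm (f x))\<^sup>2 + 1"
        using zero_le_power2[of "norm (f x) - 1"] unfolding power2_diff by simp
      then show ?thesis using norm_ge_zero[of "f x"] by linarith
    qed
    then show "AE x in lebesgue_on K. norm (f x) \<le> norm (1 + (norm (f x))\<^sup>2)"
      by (intro AE_I2) simp
  qed (rule fm)
qed

lemma L2_AE_cong:
  assumes "g \<in> L2 S" "f \<in> borel_measurable (lebesgue_on S)" "AE x in lebesgue_on S. f x = g x"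
  shows "f \<in> L2 S"
proof -
  have "integrable (lebesgue_on S) (\<lambda>x. (norm (g x))\<^sup>2)" using assms(1) by (simp add: L2_def)
  then have "integrable (lebesgue_on S) (\<lambda>x. (norm (f x))\<^sup>2)"
    by (rule integrable_cong_AE_imp) (use assms in \<open>auto elim: AE_mp\<close>)
  then show ?thesis using assms(2) by (simp add: L2_def)
qed

lemma L2_nrm_AE_cong:
  assumes "f \<in> borel_measurable (lebesgue_on S)" "g \<in> borel_measurable (lebesgue_on S)"
    "AE x in lebesgue_on S. norm (f x) = norm (g x)"
  shows "L2_nrm S f = L2_nrm S g"
proof -
  have "(LINT x|lebesgue_on S. (norm (f x))\<^sup>2) = (LINT x|lebesgue_on S. (norm (g x))\<^sup>2)"
  proof (rule integral_cong_AE)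
    show "AE x in lebesgue_on S. (norm (f x))\<^sup>2 = (norm (g x))\<^sup>2"
      using assms(3) by eventually_elim simp
  qed (use assms in simp_all)
  then show ?thesis by (simp add: L2_nrm_def)
qed

lemma L2_bounded_linear:
  assumes "bounded_linear T" "f \<in> L2 S"
  shows "(\<lambda>x. T (f x)) \<in> L2 S"
proof -
  obtain B where B: "\<And>x. norm (T x) \<le> norm x * B" "B > 0"
    using bounded_linear.pos_bounded[OF assms(1)] by blast
  have fm: "f \<in> borel_measurable (lebesgue_on S)" and fi: "integrable (lebesgue_on S) (\<lambda>x. (norm (f x))\<^sup>2)"
    using assms(2) by (auto simp: L2_def)
  have m: "(\<lambda>x. T (f x)) \<in> borel_measurable (lebesgue_on S)"
    using fm by (rule measurable_compose)
      (rule borel_measurable_continuous_onI[OF linear_continuous_on[OF assms(1)]])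
  have "integrable (lebesgue_on S) (\<lambda>x. (norm (T (f x)))\<^sup>2)"
  proof (rule Bochner_Integration.integrable_bound)
    show "integrable (lebesgue_on S) (\<lambda>x. B\<^sup>2 * (norm (f x))\<^sup>2)" using fi by simp
    show "AE x in lebesgue_on S. norm ((norm (T (f x)))\<^sup>2) \<le> norm (B\<^sup>2 * (norm (f x))\<^sup>2)"
    proof (rule AE_I2)
      fix x
      have "(norm (T (f x)))\<^sup>2 \<le> (norm (f x) * B)\<^sup>2" by (intro power_mono B) simp
      then show "norm ((norm (T (f x)))\<^sup>2) \<le> norm (B\<^sup>2 * (norm (f x))\<^sup>2)"
        by (simp add: power_mult_distrib mult.commute)
    qed
  qed (use m in simp)
  with m show ?thesis by (simp add: L2_def)
qed

lemma L2_restrict: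
  assumes "f \<in> L2 S" "open S" "open T" "T \<subseteq> S"
  shows "f \<in> L2 T"
proof -
  have "integrable lebesgue (\<lambda>x. indicator S x *\<^sub>R (norm (f x))\<^sup>2)"
    using assms by (simp add: L2_def integrable_restrict_space)
  then have "integrable lebesgue (\<lambda>x. indicator T x *\<^sub>R (indicator S x *\<^sub>R (norm (f x))\<^sup>2))"
    by (rule integrable_mult_indicator[rotated]) (use assms(3) in simp)
  also have "(\<lambda>x. indicator T x *\<^sub>R (indicator S x *\<^sub>R (norm (f x))\<^sup>2)) = (\<lambda>x. indicator T x *\<^sub>R (norm (f x))\<^sup>2)"
    using assms(4) by (auto simp: indicator_def fun_eq_iff)
  finally have "integrable (lebesgue_on T) (\<lambda>x. (norm (f x))\<^sup>2)"
    using assms by (simp add: integrable_restrict_space)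
  then show ?thesis using assms by (auto simp: L2_def intro: measurable_restrict_mono)
qed

lemma L2_nrm_restrict:
  assumes "f \<in> L2 S" "open S" "open T" "T \<subseteq> S"
  shows "L2_nrm T f \<le> L2_nrm S f"
proof -
  have "integrable (lebesgue_on S) (\<lambda>x. (norm (f x))\<^sup>2)" "integrable (lebesgue_on T) (\<lambda>x. (norm (f x))\<^sup>2)"
    using assms(1) L2_restrict[OF assms] by (auto simp: L2_def)
  then have "integrable lebesgue (\<lambda>x. indicator S x *\<^sub>R (norm (f x))\<^sup>2)" "integrable lebesgue (\<lambda>x. indicator T x *\<^sub>R (norm (f x))\<^sup>2)"
    using assms(2,3) by (auto simp: integrable_restrict_space)
  then have "(LINT x|lebesgue. indicator T x *\<^sub>R (norm (f x))\<^sup>2) \<le> (LINT x|lebesgue. indicator S x *\<^sub>R (norm (f x))\<^sup>2)"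
    using assms(4) by (intro integral_mono) (auto simp: indicator_def)
  then show ?thesis
    using assms(2,3) by (simp add: L2_nrm_def integral_restrict_space)
qed

text \<open>Membership in \<open>H1\<close> provides some square integrable weak derivative, not
  necessarily the chosen one; uniqueness almost everywhere transfers integrability to
  \<open>weak_deriv\<close>.\<close>

lemma H1_weak_deriv:
  assumes "f \<in> H1 S" "open S"
  shows "f \<in> L2 S" "is_weak_deriv S f (weak_deriv S f)" "weak_deriv S f \<in> L2 S"
proof -
  obtain g where g: "g \<in> L2 S" "is_weak_deriv S f g" using assms(1) by (auto simp: H1_def)
  show "f \<in> L2 S" using assms(1) by (simp add: H1_def)
  show w: "is_weak_deriv S f (weak_deriv S f)" by (rule is_weak_deriv_weak_deriv[OF g(2)])
  show "weak_deriv S f \<in> L2 S"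
    by (rule L2_AE_cong[OF g(1) locally_integrable_borel_measurable[OF assms(2) is_weak_derivD(2)[OF w assms(2)]]
          weak_deriv_AE_eq[OF assms(2) g(2)]])
qed

lemma H1I: "f \<in> L2 S \<Longrightarrow> is_weak_deriv S f g \<Longrightarrow> g \<in> L2 S \<Longrightarrow> f \<in> H1 S"
  by (auto simp: H1_def)

text \<open>Frees the norm from the choice made in \<open>weak_deriv\<close>, so that restricted,
  reflected or transformed derivatives can be inserted.\<close>

lemma H1_nrm_eq:
  assumes "open S" "is_weak_deriv S f g" "g \<in> L2 S"
  shows "H1_nrm S f = sqrt ((L2_nrm S f)\<^sup>2 + (L2_nrm S g)\<^sup>2)"
proof -
  have "weak_deriv S f \<in> borel_measurable (lebesgue_on S)"
    by (rule locally_integrable_borel_measurable[OF assms(1)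
          is_weak_derivD(2)[OF is_weak_deriv_weak_deriv[OF assms(2)] assms(1)]])
  moreover have "g \<in> borel_measurable (lebesgue_on S)" using assms(3) by (simp add: L2_def)
  moreover have "AE x in lebesgue_on S. norm (weak_deriv S f x) = norm (g x)"
    using weak_deriv_AE_eq[OF assms(1,2)] by eventually_elim simp
  ultimately have "L2_nrm S (weak_deriv S f) = L2_nrm S g" by (rule L2_nrm_AE_cong)
  then show ?thesis by (simp add: H1_nrm_def)
qed

lemma H1_bounded_linear:
  assumes "bounded_linear T" "f \<in> H1 S" "open S"
  shows "(\<lambda>x. T (f x)) \<in> H1 S"
proof -
  note f = H1_weak_deriv[OF assms(2,3)]
  show ?thesis
    by (rule H1I[OF L2_bounded_linear[OF assms(1) f(1)] is_weak_deriv_bounded_linear[OF assms(3,1) f(2)]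
          L2_bounded_linear[OF assms(1) f(3)]])
qed

lemma L2_nrm_isometry: "(\<And>x. norm (T x) = norm x) \<Longrightarrow> L2_nrm S (\<lambda>x. T (f x)) = L2_nrm S f"
  by (simp add: L2_nrm_def)

lemma H1_nrm_isometry:
  assumes "bounded_linear T" "\<And>x. norm (T x) = norm x" "f \<in> H1 S" "open S"
  shows "H1_nrm S (\<lambda>x. T (f x)) = H1_nrm S f"
proof -
  note f = H1_weak_deriv[OF assms(3,4)]
  show ?thesis
    unfolding H1_nrm_eq[OF assms(4) is_weak_deriv_bounded_linear[OF assms(4,1) f(2)] L2_bounded_linear[OF assms(1) f(3)]]
    using L2_nrm_isometry[OF assms(2), of S] by (simp add: H1_nrm_def)
qed

lemma H1_restrict:
  assumes "f \<in> H1 S" "open S" "open T" "T \<subseteq> S"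
  shows "f \<in> H1 T" "H1_nrm T f \<le> H1_nrm S f"
proof -
  note f = H1_weak_deriv[OF assms(1,2)]
  note w = is_weak_deriv_mono[OF f(2) assms(2-4)] and l = L2_restrict[OF f(3) assms(2-4)]
  show "f \<in> H1 T" by (rule H1I[OF L2_restrict[OF f(1) assms(2-4)] w l])
  have "(L2_nrm T f)\<^sup>2 + (L2_nrm T (weak_deriv S f))\<^sup>2 \<le> (L2_nrm S f)\<^sup>2 + (L2_nrm S (weak_deriv S f))\<^sup>2"
    by (intro add_mono power_mono L2_nrm_restrict f assms) (simp_all add: L2_nrm_def)
  then show "H1_nrm T f \<le> H1_nrm S f"
    unfolding H1_nrm_eq[OF assms(3) w l] by (simp add: H1_nrm_def)
qed

subsection \<open>Bounded functions on subintervals\<close>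

lemma Linf_restrict:
  assumes "f \<in> Linf S" "open S" "open T" "T \<subseteq> S"
  shows "f \<in> Linf T" "Linf_nrm T f \<le> Linf_nrm S f"
proof -
  have m: "f \<in> borel_measurable (lebesgue_on T)"
    using assms by (auto simp: Linf_def intro: measurable_restrict_mono)
  have "AE x in lebesgue_on S. ereal (norm (f x)) \<le> Linf_nrm S f"
    unfolding Linf_nrm_def by (rule esssup_AE)
  then have "AE x in lebesgue_on T. ereal (norm (f x)) \<le> Linf_nrm S f"
    unfolding AE_lebesgue_on_open[OF assms(2)] AE_lebesgue_on_open[OF assms(3)]
    by eventually_elim (use assms(4) in auto)
  then show le: "Linf_nrm T f \<le> Linf_nrm S f"
    unfolding Linf_nrm_def using m by (intro esssup_I) auto
  show "f \<in> Linf T" using m le assms(1) by (auto simp: Linf_def)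
qed

lemma W1inf_restrict:
  assumes "f \<in> W1inf S" "open S" "open T" "T \<subseteq> S"
  shows "f \<in> W1inf T"
proof -
  obtain g where g: "f \<in> Linf S" "g \<in> Linf S" "is_weak_deriv S f g"
    using assms(1) unfolding W1inf_def by blast
  show ?thesis
    unfolding W1inf_def
    using Linf_restrict(1)[OF g(1) assms(2-4)] Linf_restrict(1)[OF g(2) assms(2-4)]
      is_weak_deriv_mono[OF g(3) assms(2-4)] by blast
qed

lemma Linf_nrm_AE_cong:
  assumes "f \<in> borel_measurable (lebesgue_on S)" "g \<in> borel_measurable (lebesgue_on S)"
    "AE x in lebesgue_on S. f x = g x"
  shows "Linf_nrm S f = Linf_nrm S g"
  unfolding Linf_nrm_def
proof (rule esssup_AE_cong)
  show "AE x in lebesgue_on S. ereal (norm (f x)) = ereal (norm (g x))"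
    using assms(3) by eventually_elim simp
qed (use assms in auto)

lemma W1inf_weak_deriv:
  assumes "f \<in> W1inf S" "open S"
  shows "f \<in> Linf S" "is_weak_deriv S f (weak_deriv S f)" "weak_deriv S f \<in> Linf S"
proof -
  obtain g where g: "g \<in> Linf S" "is_weak_deriv S f g" using assms(1) by (auto simp: W1inf_def)
  show "f \<in> Linf S" using assms(1) by (simp add: W1inf_def)
  show w: "is_weak_deriv S f (weak_deriv S f)" by (rule is_weak_deriv_weak_deriv[OF g(2)])
  have m: "weak_deriv S f \<in> borel_measurable (lebesgue_on S)"
    by (rule locally_integrable_borel_measurable[OF assms(2) is_weak_derivD(2)[OF w assms(2)]])
  have "Linf_nrm S (weak_deriv S f) = Linf_nrm S g"
    using m g(1) weak_deriv_AE_eq[OF assms(2) g(2)] by (intro Linf_nrm_AE_cong) (auto simp: Linf_def)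
  then show "weak_deriv S f \<in> Linf S" using g(1) m by (simp add: Linf_def)
qed

text \<open>The two norms use derivatives chosen separately on \<open>S\<close> and on
  \<open>T\<close>; the one on \<open>S\<close> is also a weak derivative on \<open>T\<close>, and
  uniqueness identifies them there.\<close>

lemma W1inf_nrm_restrict:
  assumes "f \<in> W1inf S" "open S" "open T" "T \<subseteq> S"
  shows "W1inf_nrm T f \<le> W1inf_nrm S f"
proof -
  note f = W1inf_weak_deriv[OF assms(1,2)]
  note fT = W1inf_weak_deriv[OF W1inf_restrict[OF assms] assms(3)]
  have "Linf_nrm T (weak_deriv T f) = Linf_nrm T (weak_deriv S f)"
    using fT(3) Linf_restrict(1)[OF f(3) assms(2-4)] is_weak_deriv_unique[OF assms(3) fT(2) is_weak_deriv_mono[OF f(2) assms(2-4)]]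
    by (intro Linf_nrm_AE_cong) (auto simp: Linf_def)
  with Linf_restrict(2)[OF f(1) assms(2-4)] Linf_restrict(2)[OF f(3) assms(2-4)]
  show ?thesis by (simp add: W1inf_nrm_def add_mono)
qed

lemma Linf_diff:
  assumes "f \<in> Linf S" "g \<in> Linf S"
  shows "(\<lambda>x. f x - g x) \<in> Linf S"
proof -
  have m: "f \<in> borel_measurable (lebesgue_on S)" "g \<in> borel_measurable (lebesgue_on S)"
    using assms by (auto simp: Linf_def)
  have "Linf_nrm S (\<lambda>x. f x - g x) \<le> esssup (lebesgue_on S) (\<lambda>x. ereal (norm (f x)) + ereal (norm (g x)))"
    unfolding Linf_nrm_def using m by (intro esssup_mono) (auto intro: norm_triangle_ineq4)
  also have "\<dots> \<le> Linf_nrm S f + Linf_nrm S g"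
    unfolding Linf_nrm_def by (rule esssup_add)
  also have "\<dots> < \<infinity>" using assms by (cases "Linf_nrm S f"; cases "Linf_nrm S g") (auto simp: Linf_def)
  finally show ?thesis using m by (auto simp: Linf_def)
qed

lemma W1inf_diff:
  assumes "f \<in> W1inf S" "g \<in> W1inf S" "open S"
  shows "(\<lambda>x. f x - g x) \<in> W1inf S"
proof -
  note f = W1inf_weak_deriv[OF assms(1,3)] and g = W1inf_weak_deriv[OF assms(2,3)]
  show ?thesis
    unfolding W1inf_def
    using Linf_diff[OF f(1) g(1)] Linf_diff[OF f(3) g(3)] is_weak_deriv_diff[OF assms(3) f(2) g(2)] by blast
qed

subsection \<open>Reflection\<close>

lemma distr_lebesgue_uminus: "distr lebesgue lebesgue uminus = (lebesgue :: real measure)"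
  using lebesgue_real_affine[of "-1" 0] by (simp add: density_1)

lemma measurable_uminus_lebesgue: "uminus \<in> lebesgue \<rightarrow>\<^sub>M (lebesgue :: real measure)"
  using lebesgue_affine_measurable[where c = "\<lambda>x::real. -1" and t = 0] by (simp add: fun_Compl_def)

lemma AE_lebesgue_reflect:
  fixes P :: "real \<Rightarrow> bool"
  assumes "AE x in lebesgue. P x"
  shows "AE x in lebesgue. P (- x)"
proof (rule AE_distrD[OF measurable_uminus_lebesgue])
  show "AE x in distr lebesgue lebesgue uminus. P x" using assms unfolding distr_lebesgue_uminus .
qed

lemma integrable_lebesgue_reflect_iff:
  fixes f :: "real \<Rightarrow> 'b::euclidean_space"
  shows "integrable lebesgue (\<lambda>x. f (- x)) \<longleftrightarrow> integrable lebesgue f"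
proof -
  have "integrable lebesgue (\<lambda>x. f (- x))" if "integrable lebesgue f" for f :: "real \<Rightarrow> 'b"
    using that integrable_distr_eq[OF measurable_uminus_lebesgue, of f]
    by (simp add: distr_lebesgue_uminus borel_measurable_integrable)
  from this[of f] this[of "\<lambda>x. f (- x)"] show ?thesis by auto
qed

lemma integral_lebesgue_reflect:
  fixes f :: "real \<Rightarrow> 'b::euclidean_space"
  shows "(LINT x|lebesgue. f (- x)) = (LINT x|lebesgue. f x)"
proof (cases "integrable lebesgue f")
  case True
  then show ?thesis
    using integral_distr[OF measurable_uminus_lebesgue, of f]
    by (simp add: distr_lebesgue_uminus borel_measurable_integrable)
next
  \<comment> \<open>Integrability fails on both sides together, and then both integrals take the
    default value 0.\<close>
  case False
  then show ?thesis
    using integrable_lebesgue_reflect_iff[of f] by (simp add: not_integrable_integral_eq)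
qed

lemma uminus_image_iff: "x \<in> uminus ` S \<longleftrightarrow> - x \<in> (S :: real set)"
  by (metis image_iff minus_minus)

lemma indicator_uminus_image: "indicator (uminus ` S) x = indicator S (- x :: real)"
  by (simp add: indicator_def uminus_image_iff)

lemma sets_lebesgue_uminus: "S \<in> sets lebesgue \<Longrightarrow> uminus ` S \<in> sets (lebesgue :: real measure)"
proof -
  assume "S \<in> sets lebesgue"
  moreover have "uminus ` S = uminus -` S" by (auto simp: uminus_image_iff)
  ultimately show ?thesis using measurable_sets[OF measurable_uminus_lebesgue, of S] by simp
qed

lemma integrable_lebesgue_on_reflect:
  fixes f :: "real \<Rightarrow> 'b::euclidean_space"
  assumes "S \<in> sets lebesgue"
  shows "integrable (lebesgue_on (uminus ` S)) (\<lambda>x. f (- x)) \<longleftrightarrow> integrable (lebesgue_on S) f"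
  using assms sets_lebesgue_uminus[OF assms] integrable_lebesgue_reflect_iff[of "\<lambda>x. indicator S x *\<^sub>R f x"]
  by (simp add: integrable_restrict_space indicator_uminus_image)

lemma integral_lebesgue_on_reflect:
  fixes f :: "real \<Rightarrow> 'b::euclidean_space"
  assumes "S \<in> sets lebesgue"
  shows "(LINT x|lebesgue_on (uminus ` S). f (- x)) = (LINT x|lebesgue_on S. f x)"
  using assms sets_lebesgue_uminus[OF assms] integral_lebesgue_reflect[of "\<lambda>x. indicator S x *\<^sub>R f x"]
  by (simp add: integral_restrict_space indicator_uminus_image)

lemma L2_reflect:
  assumes "f \<in> L2 S" "S \<in> sets lebesgue"
  shows "(\<lambda>x. f (- x)) \<in> L2 (uminus ` S)"
proof -
  have "f \<in> borel_measurable (lebesgue_on S)" using assms by (simp add: L2_def)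
  moreover have "uminus \<in> lebesgue_on (uminus ` S) \<rightarrow>\<^sub>M lebesgue_on S"
    by (rule measurable_restrict_space3[OF measurable_uminus_lebesgue]) auto
  ultimately have "(\<lambda>x. f (- x)) \<in> borel_measurable (lebesgue_on (uminus ` S))"
    by (rule measurable_compose[rotated])
  with assms show ?thesis
    using integrable_lebesgue_on_reflect[OF assms(2), of "\<lambda>x. (norm (f x))\<^sup>2"] by (simp add: L2_def)
qed

lemma L2_nrm_reflect:
  assumes "S \<in> sets lebesgue"
  shows "L2_nrm (uminus ` S) (\<lambda>x. f (- x)) = L2_nrm S f"
  using integral_lebesgue_on_reflect[OF assms, of "\<lambda>x. (norm (f x))\<^sup>2"] by (simp add: L2_nrm_def)

lemma test_fun_reflect:
  assumes "test_fun S \<eta>"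
  shows "test_fun (uminus ` S) (\<lambda>x. \<eta> (- x))" "deriv (\<lambda>x. \<eta> (- x)) = (\<lambda>x. - deriv \<eta> (- x))"
proof -
  obtain K where K: "compact K" "K \<subseteq> S" "\<And>x. x \<notin> K \<Longrightarrow> \<eta> x = 0" "\<And>x. x \<notin> K \<Longrightarrow> deriv \<eta> x = 0"
    "\<And>x. (\<eta> has_real_derivative deriv \<eta> x) (at x)" "continuous_on UNIV \<eta>" "continuous_on UNIV (deriv \<eta>)"
    by (rule test_funE[OF assms], rule that)
  have d: "((\<lambda>x. \<eta> (- x)) has_real_derivative - deriv \<eta> (- x)) (at x)" for x
  proof -
    have "(uminus has_real_derivative -1) (at x)" by (auto intro!: derivative_eq_intros)
    from DERIV_chain2[OF K(5) this] show ?thesis by simp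
  qed
  then show "deriv (\<lambda>x. \<eta> (- x)) = (\<lambda>x. - deriv \<eta> (- x))"
    by (intro ext DERIV_imp_deriv)
  have "continuous_on UNIV (\<lambda>x. - deriv \<eta> (- x))"
    by (intro continuous_intros continuous_on_compose2[OF K(7)]) auto
  then have "(\<lambda>x. \<eta> (- x)) C1_differentiable_on UNIV"
    unfolding C1_differentiable_on_def
    by (intro exI[of _ "\<lambda>x. - deriv \<eta> (- x)"] conjI ballI d[unfolded has_real_derivative_iff_has_vector_derivative])
  moreover have "compact (uminus ` K)"
    by (intro compact_continuous_image K continuous_intros)
  moreover have "\<forall>x. x \<notin> uminus ` K \<longrightarrow> \<eta> (- x) = 0"
    using K(3) by (auto simp: uminus_image_iff)
  ultimately show "test_fun (uminus ` S) (\<lambda>x. \<eta> (- x))"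
    using K(2) unfolding test_fun_def by blast
qed

lemma locally_integrable_reflect:
  fixes f :: "real \<Rightarrow> 'b::euclidean_space"
  assumes "locally_integrable S f"
  shows "locally_integrable (uminus ` S) (\<lambda>x. f (- x))"
  unfolding locally_integrable_def
proof (intro allI impI, elim conjE)
  fix K :: "real set" assume K: "compact K" "K \<subseteq> uminus ` S"
  have c: "compact (uminus ` K)" by (intro compact_continuous_image K continuous_intros)
  have "uminus ` K \<subseteq> S" using K(2) by force
  with c assms have "integrable (lebesgue_on (uminus ` K)) f" by (simp add: locally_integrable_def)
  moreover have "uminus ` K \<in> sets lebesgue" using c by (simp add: lmeasurable_compact fmeasurableD)
  ultimately have "integrable (lebesgue_on (uminus ` (uminus ` K))) (\<lambda>x. f (- x))"
    by (subst integrable_lebesgue_on_reflect)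
  then show "integrable (lebesgue_on K) (\<lambda>x. f (- x))" by (simp add: image_image)
qed

lemma open_uminus_image: "open S \<Longrightarrow> open (uminus ` S :: real set)"
  by (simp add: open_negations)

text \<open>Substituting \<open>- x\<close> moves the reflection onto the test function, whose
  derivative changes sign. Derivatives therefore anticommute with reflection, one half of the sign
  in \<open>A_op_PT\<close>.\<close>

lemma is_weak_deriv_reflect:
  fixes f :: "real \<Rightarrow> 'b::euclidean_space"
  assumes "is_weak_deriv S f g" "open S"
  shows "is_weak_deriv (uminus ` S) (\<lambda>x. f (- x)) (\<lambda>x. - g (- x))"
proof (rule is_weak_derivI[OF open_uminus_image[OF assms(2)]])
  show "locally_integrable (uminus ` S) (\<lambda>x. f (- x))"
    by (rule locally_integrable_reflect[OF is_weak_derivD(1)[OF assms]])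
  show "locally_integrable (uminus ` S) (\<lambda>x. - g (- x))"
    by (rule locally_integrable_bounded_linear[OF bounded_linear_minus[OF bounded_linear_ident]
          locally_integrable_reflect[OF is_weak_derivD(2)[OF assms]]])
  fix \<eta> assume "test_fun (uminus ` S) \<eta>"
  note t = test_fun_reflect[OF this]
  have "uminus ` uminus ` S = S" by (simp add: image_image)
  with t(1) have t1: "test_fun S (\<lambda>x. \<eta> (- x))" by simp
  have "(LINT x|lebesgue. deriv \<eta> x *\<^sub>R f (- x)) = (LINT x|lebesgue. deriv \<eta> (- x) *\<^sub>R f x)"
    using integral_lebesgue_reflect[of "\<lambda>x. deriv \<eta> x *\<^sub>R f (- x)"] by simp
  also have "\<dots> = - (LINT x|lebesgue. deriv (\<lambda>x. \<eta> (- x)) x *\<^sub>R f x)"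
    unfolding t(2) by simp
  also have "\<dots> = (LINT x|lebesgue. \<eta> (- x) *\<^sub>R g x)"
    unfolding is_weak_derivD(3)[OF assms t1] by simp
  also have "\<dots> = - (LINT x|lebesgue. \<eta> x *\<^sub>R - g (- x))"
    using integral_lebesgue_reflect[of "\<lambda>x. \<eta> x *\<^sub>R g (- x)"] by simp
  finally show "(LINT x|lebesgue. deriv \<eta> x *\<^sub>R f (- x)) = - (LINT x|lebesgue. \<eta> x *\<^sub>R - g (- x))" .
qed

lemma L2_minus: "f \<in> L2 S \<Longrightarrow> (\<lambda>x. - f x) \<in> L2 S"
  by (simp add: L2_def)

lemma H1_reflect:
  assumes "f \<in> H1 S" "open S"
  shows "(\<lambda>x. f (- x)) \<in> H1 (uminus ` S)" "H1_nrm (uminus ` S) (\<lambda>x. f (- x)) = H1_nrm S f"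
proof -
  note f = H1_weak_deriv[OF assms]
  have S: "S \<in> sets lebesgue" using assms(2) by simp
  note w = is_weak_deriv_reflect[OF f(2) assms(2)] and l = L2_minus[OF L2_reflect[OF f(3) S]]
  show "(\<lambda>x. f (- x)) \<in> H1 (uminus ` S)"
    by (rule H1I[OF L2_reflect[OF f(1) S] w l])
  have "L2_nrm (uminus ` S) (\<lambda>x. - weak_deriv S f (- x)) = L2_nrm S (weak_deriv S f)"
    using L2_nrm_reflect[OF S, of "weak_deriv S f"] by (simp add: L2_nrm_def)
  then show "H1_nrm (uminus ` S) (\<lambda>x. f (- x)) = H1_nrm S f"
    unfolding H1_nrm_eq[OF open_uminus_image[OF assms(2)] w l] L2_nrm_reflect[OF S] by (simp add: H1_nrm_def)
qed

subsection \<open>Test functions as elements of the domain\<close>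

lemma integral_deriv_test_fun:
  assumes "test_fun S \<eta>"
  shows "(LINT x|lebesgue. deriv \<eta> x) = 0"
proof -
  obtain K where K: "compact K" "K \<subseteq> S" "\<And>x. x \<notin> K \<Longrightarrow> \<eta> x = 0" "\<And>x. x \<notin> K \<Longrightarrow> deriv \<eta> x = 0"
    "\<And>x. (\<eta> has_real_derivative deriv \<eta> x) (at x)" "continuous_on UNIV \<eta>" "continuous_on UNIV (deriv \<eta>)"
    by (rule test_funE[OF assms], rule that)
  obtain r where r: "\<And>x. x \<in> K \<Longrightarrow> norm x \<le> r" "r > 0"
    using compact_imp_bounded[OF K(1)] by (auto simp: bounded_pos)
  \<comment> \<open>One more than a bound for the support, so that \<open>a\<close> and
    \<open>- a\<close> lie outside it.\<close>
  define a where "a = r + 1"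
  have out: "\<eta> a = 0" "\<eta> (- a) = 0" "\<And>x. x \<notin> {-a..a} \<Longrightarrow> deriv \<eta> x = 0"
    using r by (auto simp: a_def intro!: K(3,4) dest!: r(1))
  have "(deriv \<eta> has_integral \<eta> a - \<eta> (- a)) {-a..a}"
    using r(2) K(5) by (intro fundamental_theorem_of_calculus)
      (auto simp: a_def has_real_derivative_iff_has_vector_derivative intro: has_vector_derivative_at_within)
  then have "(deriv \<eta> has_integral 0) {-a..a}" using out(1,2) by simp
  then have "(deriv \<eta> has_integral 0) UNIV"
    by (rule has_integral_on_superset) (use out(3) in auto)
  \<comment> \<open>Integrability identifies the gauge integral of the fundamental theorem of
    calculus with the Lebesgue integral.\<close>
  moreover have "integrable lebesgue (\<lambda>x. deriv \<eta> x)"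
  proof -
    have "locally_integrable UNIV (\<lambda>x. 1 :: real)"
      unfolding locally_integrable_def
    proof (intro allI impI, elim conjE)
      fix K :: "real set" assume "compact K"
      then have "K \<in> lmeasurable" by (rule lmeasurable_compact)
      then show "integrable (lebesgue_on K) (\<lambda>x. 1 :: real)"
        using integrable_real_indicator[of K lebesgue] fmeasurableD2[of K lebesgue]
        by (simp add: integrable_restrict_space top.not_eq_extremum fmeasurableD)
    qed
    from integrable_cont_locally_integrable[OF this K(1) subset_UNIV K(7,4)] show ?thesis by simp
  qed
  then have "(deriv \<eta> has_integral (LINT x|lebesgue. deriv \<eta> x)) UNIV"
    by (rule has_integral_integral_lebesgue)
  ultimately show ?thesis by (rule has_integral_unique[symmetric])
qed

lemma test_fun_mult:
  assumes "test_fun S \<eta>" "test_fun S \<zeta>"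
  shows "test_fun S (\<lambda>x. \<eta> x * \<zeta> x)" "deriv (\<lambda>x. \<eta> x * \<zeta> x) = (\<lambda>x. deriv \<eta> x * \<zeta> x + \<eta> x * deriv \<zeta> x)"
proof -
  obtain K where K: "compact K" "K \<subseteq> S" "\<And>x. x \<notin> K \<Longrightarrow> \<eta> x = 0" "\<And>x. x \<notin> K \<Longrightarrow> deriv \<eta> x = 0"
    "\<And>x. (\<eta> has_real_derivative deriv \<eta> x) (at x)" "continuous_on UNIV \<eta>" "continuous_on UNIV (deriv \<eta>)"
    by (rule test_funE[OF assms(1)], rule that)
  obtain K' where K': "compact K'" "K' \<subseteq> S" "\<And>x. x \<notin> K' \<Longrightarrow> \<zeta> x = 0" "\<And>x. x \<notin> K' \<Longrightarrow> deriv \<zeta> x = 0"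
    "\<And>x. (\<zeta> has_real_derivative deriv \<zeta> x) (at x)" "continuous_on UNIV \<zeta>" "continuous_on UNIV (deriv \<zeta>)"
    by (rule test_funE[OF assms(2)], rule that)
  have d: "((\<lambda>x. \<eta> x * \<zeta> x) has_real_derivative deriv \<eta> x * \<zeta> x + \<eta> x * deriv \<zeta> x) (at x)" for x
    using DERIV_mult[OF K(5) K'(5), of x] by (simp add: mult.commute add.commute)
  then show "deriv (\<lambda>x. \<eta> x * \<zeta> x) = (\<lambda>x. deriv \<eta> x * \<zeta> x + \<eta> x * deriv \<zeta> x)"
    by (intro ext DERIV_imp_deriv)
  have "continuous_on UNIV (\<lambda>x. deriv \<eta> x * \<zeta> x + \<eta> x * deriv \<zeta> x)"
    by (intro continuous_intros K K')
  then have "(\<lambda>x. \<eta> x * \<zeta> x) C1_differentiable_on UNIV"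
    unfolding C1_differentiable_on_def
    by (intro exI[of _ "\<lambda>x. deriv \<eta> x * \<zeta> x + \<eta> x * deriv \<zeta> x"] conjI ballI
        d[unfolded has_real_derivative_iff_has_vector_derivative])
  then show "test_fun S (\<lambda>x. \<eta> x * \<zeta> x)"
    using K(1-3) unfolding test_fun_def by auto
qed

lemma locally_integrable_continuous:
  fixes f :: "real \<Rightarrow> real"
  assumes "continuous_on UNIV f"
  shows "locally_integrable S f"
  unfolding locally_integrable_def
proof (intro allI impI, elim conjE)
  fix K :: "real set" assume K: "compact K"
  have "continuous_on K f" using assms by (rule continuous_on_subset) simp
  from borel_integrable_compact[OF K this] have "integrable lborel (\<lambda>x. indicator K x *\<^sub>R f x)" .
  then have "integrable lebesgue (\<lambda>x. indicator K x *\<^sub>R f x)"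
    by (subst integrable_completion) auto
  then show "integrable (lebesgue_on K) f"
    using lmeasurable_compact[OF K] by (simp add: integrable_restrict_space fmeasurableD)
qed

lemma test_fun_L2:
  assumes "test_fun S \<eta>"
  shows "\<eta> \<in> L2 UNIV" "deriv \<eta> \<in> L2 UNIV"
proof -
  obtain K where K: "compact K" "K \<subseteq> S" "\<And>x. x \<notin> K \<Longrightarrow> \<eta> x = 0" "\<And>x. x \<notin> K \<Longrightarrow> deriv \<eta> x = 0"
    "\<And>x. (\<eta> has_real_derivative deriv \<eta> x) (at x)" "continuous_on UNIV \<eta>" "continuous_on UNIV (deriv \<eta>)"
    by (rule test_funE[OF assms], rule that)
  have "f \<in> L2 UNIV" if f: "continuous_on UNIV f" "\<And>x. x \<notin> K \<Longrightarrow> f x = 0" for f :: "real \<Rightarrow> real"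
  proof -
    have "f \<in> borel_measurable lebesgue"
      using f(1) by (simp add: borel_measurable_continuous_onI measurable_completion)
    moreover have "integrable lebesgue (\<lambda>x. f x *\<^sub>R f x)"
      by (rule integrable_cont_locally_integrable[OF locally_integrable_continuous[OF f(1)] K(1) subset_UNIV f])
    ultimately show ?thesis by (simp add: L2_def power2_eq_square lebesgue_on_UNIV_eq)
  qed
  from this[OF K(6,3)] this[OF K(7,4)] show "\<eta> \<in> L2 UNIV" "deriv \<eta> \<in> L2 UNIV" by auto
qed

text \<open>Integration by parts: the derivative of the product of two test functions has integral
  0. This makes test functions usable as components of elements of \<open>D_A\<close>.\<close>

lemma is_weak_deriv_test_fun:
  assumes "test_fun UNIV \<eta>"
  shows "is_weak_deriv UNIV \<eta> (deriv \<eta>)"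
proof (rule is_weak_derivI[OF open_UNIV])
  show l: "locally_integrable UNIV \<eta>" "locally_integrable UNIV (deriv \<eta>)"
    using L2_locally_integrable[OF test_fun_L2(1)[OF assms]] L2_locally_integrable[OF test_fun_L2(2)[OF assms]]
    by auto
  fix \<zeta> assume z: "test_fun UNIV \<zeta>"
  have "0 = (LINT x|lebesgue. deriv \<zeta> x *\<^sub>R \<eta> x + \<zeta> x *\<^sub>R deriv \<eta> x)"
    using integral_deriv_test_fun[OF test_fun_mult(1)[OF z assms]] test_fun_mult(2)[OF z assms] by simp
  also have "\<dots> = (LINT x|lebesgue. deriv \<zeta> x *\<^sub>R \<eta> x) + (LINT x|lebesgue. \<zeta> x *\<^sub>R deriv \<eta> x)"
    by (rule Bochner_Integration.integral_add[OF integrable_test_fun(2)[OF l(1) z] integrable_test_fun(1)[OF l(2) z]])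
  finally show "(LINT x|lebesgue. deriv \<zeta> x *\<^sub>R \<eta> x) = - (LINT x|lebesgue. \<zeta> x *\<^sub>R deriv \<eta> x)"
    by simp
qed

lemma is_weak_deriv_zero: "is_weak_deriv S (\<lambda>x. 0) (\<lambda>x. 0)"
  by (simp add: is_weak_deriv_def locally_integrable_def)

subsection \<open>The operator and its symmetries\<close>

lemma norm_vec3: "norm (v :: complex^3) = sqrt ((cmod (v $ 1))\<^sup>2 + (cmod (v $ 2))\<^sup>2 + (cmod (v $ 3))\<^sup>2)"
  by (simp add: norm_vec_def L2_set_def sum_3)

lemma vec3_eq_iff: "v = w \<longleftrightarrow> v $ 1 = w $ 1 \<and> v $ 2 = w $ 2 \<and> v $ 3 = (w :: 'a^3) $ 3"
  by (simp add: vec_eq_iff forall_3)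

lemma cnjv_nth [simp]: "cnjv v $ i = cnj (v $ i)"
  by (simp add: cnjv_def)

lemma norm_cnjv [simp]: "norm (cnjv v) = norm v"
  by (simp add: norm_vec3)

lemma cnjv_smult: "cnjv (c *s v) = cnj c *s cnjv v"
  by (simp add: vec_eq_iff)

lemma bounded_linear_cnjv: "bounded_linear cnjv"
  by (rule linear_conv_bounded_linear[THEN iffD1], rule linearI) (simp_all add: vec_eq_iff complex_cnj_scaleR)

lemma bounded_linear_smult: "bounded_linear (\<lambda>v :: complex^3. c *s v)"
  by (rule linear_conv_bounded_linear[THEN iffD1], rule linearI)
    (simp_all add: vec_eq_iff algebra_simps)

lemma norm_smult_unit: "cmod c = 1 \<Longrightarrow> norm (c *s (v :: complex^3)) = norm v"
  by (simp add: norm_vec3 norm_mult)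

definition PT :: "(real \<Rightarrow> complex^3) \<Rightarrow> real \<Rightarrow> complex^3" where
  "PT u x = cnjv (u (- x))"

lemma PT_nth: "PT u x $ i = cnj (u (- x) $ i)"
  by (simp add: PT_def)

lemma L2_smult: "u \<in> L2 S \<Longrightarrow> (\<lambda>x. c *s (u x :: complex^3)) \<in> L2 S"
  by (rule L2_bounded_linear[OF bounded_linear_smult])

lemma L2_PT: "u \<in> L2 UNIV \<Longrightarrow> PT u \<in> L2 UNIV"
  using L2_bounded_linear[OF bounded_linear_cnjv L2_reflect[of u UNIV]]
  by (simp add: PT_def[abs_def])

lemma L2_nrm_PT: "L2_nrm UNIV (PT u) = L2_nrm UNIV u"
  using L2_nrm_reflect[of UNIV u] L2_nrm_isometry[of cnjv UNIV "\<lambda>x. u (- x)"]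
  by (simp add: PT_def[abs_def])

lemma L2_nth: "u \<in> L2 S \<Longrightarrow> (\<lambda>x. (u x :: complex^3) $ i) \<in> L2 S"
  by (rule L2_bounded_linear[OF bounded_linear_vec_nth])

lemma H1_cnj_reflect:
  assumes "f \<in> H1 UNIV"
  shows "(\<lambda>x. cnj (f (- x))) \<in> H1 UNIV"
    "AE x in lebesgue. weak_deriv UNIV (\<lambda>x. cnj (f (- x))) x = - cnj (weak_deriv UNIV f (- x))"
proof -
  have U: "uminus ` UNIV = (UNIV :: real set)" by simp
  show "(\<lambda>x. cnj (f (- x))) \<in> H1 UNIV"
    using H1_bounded_linear[OF bounded_linear_cnj H1_reflect(1)[OF assms open_UNIV]] by simp
  have "is_weak_deriv UNIV (\<lambda>x. cnj (f (- x))) (\<lambda>x. cnj (- weak_deriv UNIV f (- x)))"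
    using is_weak_deriv_bounded_linear[OF open_UNIV bounded_linear_cnj
        is_weak_deriv_reflect[OF H1_weak_deriv(2)[OF assms open_UNIV] open_UNIV, unfolded U]] .
  from weak_deriv_AE_eq[OF open_UNIV this]
  show "AE x in lebesgue. weak_deriv UNIV (\<lambda>x. cnj (f (- x))) x = - cnj (weak_deriv UNIV f (- x))"
    unfolding lebesgue_on_UNIV_eq complex_cnj_minus .
qed

lemma H1_cmult:
  fixes f :: "real \<Rightarrow> complex"
  assumes "f \<in> H1 UNIV"
  shows "(\<lambda>x. c * f x) \<in> H1 UNIV"
    "AE x in lebesgue. weak_deriv UNIV (\<lambda>x. c * f x) x = c * weak_deriv UNIV f x"
proof -
  show "(\<lambda>x. c * f x) \<in> H1 UNIV"
    by (rule H1_bounded_linear[OF bounded_linear_mult_right assms open_UNIV])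
  show "AE x in lebesgue. weak_deriv UNIV (\<lambda>x. c * f x) x = c * weak_deriv UNIV f x"
    using weak_deriv_AE_eq[OF open_UNIV is_weak_deriv_bounded_linear[OF open_UNIV bounded_linear_mult_right
          H1_weak_deriv(2)[OF assms open_UNIV]]]
    unfolding lebesgue_on_UNIV_eq .
qed

lemma D_AD:
  assumes "u \<in> D_A"
  shows "u \<in> L2 UNIV" "(\<lambda>x. u x $ 2) \<in> H1 UNIV" "(\<lambda>x. u x $ 3) \<in> H1 UNIV"
  using assms by (auto simp: D_A_def)

lemma D_A_PT: "u \<in> D_A \<Longrightarrow> PT u \<in> D_A"
  using H1_cnj_reflect(1)[of "\<lambda>x. u x $ 2"] H1_cnj_reflect(1)[of "\<lambda>x. u x $ 3"] L2_PT[of u]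
  by (simp add: D_A_def PT_nth)

lemma D_A_smult: "u \<in> D_A \<Longrightarrow> (\<lambda>x. c *s u x) \<in> D_A"
  using H1_cmult(1)[of "\<lambda>x. u x $ 2"] H1_cmult(1)[of "\<lambda>x. u x $ 3"] L2_smult[of u]
  by (simp add: D_A_def)

text \<open>Conjugation reverses the sign of the entries containing \<open>\<i>\<close>, reflection
  that of the derivatives, so all entries acquire the same minus sign.\<close>

lemma A_op_PT:
  assumes "u \<in> D_A"
  shows "AE x in lebesgue. A_op k (PT u) x = - cnjv (A_op k u (- x))"
  using H1_cnj_reflect(2)[OF D_AD(2)[OF assms]] H1_cnj_reflect(2)[OF D_AD(3)[OF assms]]
proof eventually_elim
  case (elim x)
  have "weak_deriv UNIV (\<lambda>y. PT u y $ i) = weak_deriv UNIV (\<lambda>y. cnj (u (- y) $ i))" for i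
    by (simp add: PT_nth)
  with elim show ?case by (simp add: A_op_def vec3_eq_iff PT_nth)
qed

lemma A_op_smult:
  assumes "u \<in> D_A"
  shows "AE x in lebesgue. A_op k (\<lambda>x. c *s u x) x = c *s A_op k u x"
  using H1_cmult(2)[OF D_AD(2)[OF assms], of c] H1_cmult(2)[OF D_AD(3)[OF assms], of c]
  by eventually_elim (simp add: A_op_def vec3_eq_iff algebra_simps)

lemma B_mat_mult_vec:
  "B_mat V x w *v v = vector [\<i> * V x w * v $ 1, \<i> * V x w * v $ 2, \<i> * w * v $ 3]"
  by (simp add: B_mat_def diag3_def vec3_eq_iff matrix_vector_mult_def sum_3)

text \<open>The factor \<open>\<i>\<close> in \<open>B_mat\<close> yields the sign already found for
  \<open>A_op\<close>; its third diagonal entry, the frequency itself, is what forces passing to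
  \<open>cnj w\<close>.\<close>

lemma L_op_PT:
  assumes "u \<in> D_A" "AE x in lebesgue. V x (cnj w) = cnj (V (- x) w)"
  shows "AE x in lebesgue. L_op k V (cnj w) (PT u) x = - cnjv (L_op k V w u (- x))"
  using A_op_PT[OF assms(1), of k] assms(2)
  by eventually_elim (simp add: L_op_def B_mat_mult_vec vec3_eq_iff PT_nth algebra_simps)

lemma L_op_smult:
  assumes "u \<in> D_A"
  shows "AE x in lebesgue. L_op k V w (\<lambda>x. c *s u x) x = c *s L_op k V w u x"
  using A_op_smult[OF assms, of k c]
  by eventually_elim (simp add: L_op_def B_mat_mult_vec vec3_eq_iff algebra_simps)

section \<open>Covariance of the nonlinearity, the inner product and the layered norm\<close>

lemma h_nl_cnjv:
  assumes "chi x (cnj w) = cnj (chi (- x) w)"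
  shows "h_nl e m chi x (cnj w) (cnjv v) = - cnjv (h_nl e m chi (- x) w v)"
  using assms by (simp add: h_nl_def vec3_eq_iff E_part_def norm_vec3)

text \<open>Gauge covariance: each cubic term carries two factors \<open>c\<close> and one factor
  \<open>cnj c\<close>, and for a phase their product is \<open>c\<close>.\<close>

lemma h_nl_smult:
  assumes "cmod c = 1"
  shows "h_nl e m chi x w (c *s v) = c *s h_nl e m chi x w v"
proof -
  have E: "E_part (c *s v) = c *s E_part v" by (simp add: E_part_def vec3_eq_iff)
  have c: "c * cnj c = 1" using assms by (metis complex_norm_square mult.right_neutral of_real_1 power_one)
  have "c * (c * cnj c) = c" by (simp add: c)
  then have c2: "c * c * cnj c = c" by (simp add: mult.assoc)
  have q: "((c *s v) $ 1)\<^sup>2 + ((c *s v) $ 2)\<^sup>2 = c\<^sup>2 * ((v $ 1)\<^sup>2 + (v $ 2)\<^sup>2)"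
    by (simp add: power_mult_distrib algebra_simps)
  have "c\<^sup>2 * cnj c = c" using c2 by (simp add: power2_eq_square)
  then have r: "(c\<^sup>2 * a) *s cnjv (c *s w) = c *s (a *s cnjv w)" for a w
    by (simp add: vec_eq_iff ac_simps)
  have r': "a *s (c *s w) = c *s (a *s w)" for a and w :: "complex^3"
    by (simp add: vec_eq_iff)
  show ?thesis
    unfolding h_nl_def E q norm_smult_unit[OF assms] r r' by (simp add: vec_eq_iff distrib_left)
qed

lemma L2_inner_smult: "L2_inner (\<lambda>x. c *s f x) (\<lambda>x. d *s g x) = c * cnj d * L2_inner f g"
proof -
  have "(\<Sum>i\<in>UNIV. (c *s f x) $ i * cnj ((d *s g x) $ i)) = (c * cnj d) * (\<Sum>i\<in>UNIV. f x $ i * cnj (g x $ i))" for x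
    by (simp add: sum_distrib_left algebra_simps)
  then show ?thesis unfolding L2_inner_def by simp
qed

lemma L2_inner_PT: "L2_inner (PT f) (PT g) = cnj (L2_inner f g)"
proof -
  have "L2_inner (PT f) (PT g) = (LINT x|lebesgue. cnj (\<Sum>i\<in>UNIV. f (- x) $ i * cnj (g (- x) $ i)))"
    by (simp add: L2_inner_def PT_nth)
  also have "\<dots> = (LINT x|lebesgue. cnj (\<Sum>i\<in>UNIV. f x $ i * cnj (g x $ i)))"
    by (rule integral_lebesgue_reflect)
  also have "\<dots> = cnj (L2_inner f g)"
    unfolding L2_inner_def by (rule Bochner_Integration.integral_cnj)
  finally show ?thesis .
qed

lemma borel_measurable_vec_nth:
  "f \<in> borel_measurable M \<Longrightarrow> (\<lambda>x. (f x :: complex^3) $ i) \<in> borel_measurable M"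
  by (rule measurable_compose[OF _ borel_measurable_continuous_onI[OF linear_continuous_on[OF bounded_linear_vec_nth]]])

text \<open>Lebesgue measure is complete, so \<open>f'\<close> and \<open>g'\<close> inherit
  measurability from \<open>f\<close> and \<open>g\<close>.\<close>

lemma L2_inner_AE_cong:
  assumes "f \<in> borel_measurable lebesgue" "g \<in> borel_measurable lebesgue"
    "AE x in lebesgue. f x = f' x" "AE x in lebesgue. g x = g' x"
  shows "L2_inner f g = L2_inner f' g'"
proof -
  have m: "f' \<in> borel_measurable lebesgue" "g' \<in> borel_measurable lebesgue"
    using borel_measurable_AE[OF assms(1,3)] borel_measurable_AE[OF assms(2,4)] .
  have c: "(\<lambda>x. cnj (h x)) \<in> borel_measurable lebesgue" if "h \<in> borel_measurable lebesgue" for h :: "real \<Rightarrow> complex"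
    by (rule measurable_compose[OF that borel_measurable_continuous_onI[OF linear_continuous_on[OF bounded_linear_cnj]]])
  show ?thesis
    unfolding L2_inner_def
  proof (rule integral_cong_AE)
    show "AE x in lebesgue. (\<Sum>i\<in>UNIV. f x $ i * cnj (g x $ i)) = (\<Sum>i\<in>UNIV. f' x $ i * cnj (g' x $ i))"
      using assms(3,4) by eventually_elim simp
  qed (intro borel_measurable_sum borel_measurable_times borel_measurable_vec_nth c assms m)+
qed

lemma PH1_smult: "f \<in> PH1 m X \<Longrightarrow> (\<And>j. open (layer X j)) \<Longrightarrow> (\<lambda>x. c *s f x) \<in> PH1 m X"
  by (auto simp: PH1_def intro: L2_smult H1_bounded_linear[OF bounded_linear_smult])

lemma PH1_nrm_smult:
  assumes "f \<in> PH1 m X" "\<And>j. open (layer X j)" "cmod c = 1"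
  shows "PH1_nrm m X (\<lambda>x. c *s f x) = PH1_nrm m X f"
  unfolding PH1_nrm_def
  by (intro sum.cong refl H1_nrm_isometry[OF bounded_linear_smult norm_smult_unit[OF assms(3)]])
    (use assms in \<open>auto simp: PH1_def\<close>)

lemma open_layer: "open (layer X j)"
proof -
  have "layer X j = ereal -` {X (j - 1)<..} \<inter> ereal -` {..<X j}" by (auto simp: layer_def)
  also have "open \<dots>" by (intro open_Int open_vimage continuous_on_ereal continuous_on_id) auto
  finally show ?thesis .
qed

subsection \<open>Layers\<close>

text \<open>For the least \<open>j\<close> with \<open>ereal x < X j\<close>, which is positive
  because \<open>X 0 = -\<infinity>\<close>, minimality gives
  \<open>X (j - 1) \<le> ereal x\<close>: strict inequality puts \<open>x\<close> in layer
  \<open>j\<close>, equality makes it an interface.\<close>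

lemma layer_cover:
  assumes "layers m X"
  shows "(\<exists>j\<in>{1..m}. x \<in> layer X j) \<or> (\<exists>j\<in>{..m}. X j = ereal x)"
proof -
  define j where "j = (LEAST j. ereal x < X j)"
  have ex: "ereal x < X m" using assms by (simp add: layers_def)
  have j: "ereal x < X j" unfolding j_def by (rule LeastI[of "\<lambda>j. ereal x < X j", OF ex])
  have jm: "j \<le> m" unfolding j_def by (rule Least_le[of "\<lambda>j. ereal x < X j", OF ex])
  have j1: "j \<noteq> 0" using j assms by (cases "j = 0") (auto simp: layers_def)
  have "\<not> ereal x < X (j - 1)"
    using j1 not_less_Least[of "j - 1" "\<lambda>j. ereal x < X j"] by (auto simp: j_def[symmetric])
  then have "X (j - 1) < ereal x \<or> X (j - 1) = ereal x" by (auto simp: not_less order_le_less)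
  then show ?thesis
  proof
    assume "X (j - 1) < ereal x"
    then have "x \<in> layer X j" using j by (simp add: layer_def)
    then show ?thesis using jm j1 by (intro disjI1 bexI[of _ j]) auto
  next
    assume "X (j - 1) = ereal x"
    then show ?thesis using jm by (intro disjI2 bexI[of _ "j - 1"]) auto
  qed
qed

lemma finite_interface_points: "finite {x. \<exists>j\<in>{..m::nat}. X j = ereal x}"
proof (rule finite_subset)
  show "{x. \<exists>j\<in>{..m}. X j = ereal x} \<subseteq> (\<lambda>j. real_of_ereal (X j)) ` {..m}" by force
qed simp

lemma AE_layers:
  assumes "layers m X" "\<And>j. j \<in> {1..m} \<Longrightarrow> AE x in lebesgue_on (layer X j). P x"
  shows "AE x in lebesgue. P x"
proof -
  have "AE x in lebesgue. \<forall>j\<in>{1..m}. x \<in> layer X j \<longrightarrow> P x"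
    using assms(2) by (subst AE_ball_countable) (auto simp: AE_lebesgue_on_open[OF open_layer])
  moreover have "AE x in lebesgue. x \<notin> {x. \<exists>j\<in>{..m}. X j = ereal x}"
    using finite_interface_points[of m X] by (intro AE_not_in) (simp add: negligible_finite negligible_iff_null_sets[symmetric])
  ultimately show ?thesis
    by eventually_elim (use layer_cover[OF assms(1)] in blast)
qed

lemma borel_measurable_layers:
  fixes f :: "real \<Rightarrow> 'b::euclidean_space"
  assumes "layers m X" "\<And>j. j \<in> {1..m} \<Longrightarrow> f \<in> borel_measurable (lebesgue_on (layer X j))"
  shows "f \<in> borel_measurable lebesgue"
proof -
  let ?N = "{x. \<exists>j\<in>{..m}. X j = ereal x}"
  \<comment> \<open>The interfaces are added as singletons, so that finitely many measurable pieces
    cover the line.\<close>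
  let ?C = "layer X ` {1..m} \<union> (\<lambda>x. {x}) ` ?N"
  have fin: "finite ?C" using finite_interface_points[of m X] by auto
  show ?thesis
  proof (rule measurable_piecewise_restrict[of ?C])
    show "countable ?C" using fin by (rule countable_finite)
    show "space lebesgue \<subseteq> \<Union> ?C" using layer_cover[OF assms(1)] by auto
    fix S assume "S \<in> ?C"
    then consider j where "j \<in> {1..m}" "S = layer X j" | x where "S = {x}" by blast
    then show "f \<in> borel_measurable (lebesgue_on S)"
    proof cases
      case 1 then show ?thesis using assms(2) by simp
    next
      case 2
      have "(\<lambda>_. f x) \<in> borel_measurable (lebesgue_on S)" by simp
      then show ?thesis by (rule measurable_cong[THEN iffD1, rotated]) (use 2 in auto)
    qed
    show "S \<inter> space lebesgue \<in> sets lebesgue"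
      using \<open>S \<in> ?C\<close> open_layer by auto
  qed
qed

lemma Linf_layers:
  fixes f :: "real \<Rightarrow> 'b::euclidean_space"
  assumes "layers m X" "\<And>j. j \<in> {1..m} \<Longrightarrow> f \<in> Linf (layer X j)"
  obtains B where "f \<in> borel_measurable lebesgue" "AE x in lebesgue. norm (f x) \<le> B" "B \<ge> 0"
proof -
  have m: "f \<in> borel_measurable lebesgue"
    using borel_measurable_layers[OF assms(1)] assms(2) by (auto simp: Linf_def)
  have "\<exists>B. AE x in lebesgue_on (layer X j). norm (f x) \<le> B" if j: "j \<in> {1..m}" for j
  proof -
    have "Linf_nrm (layer X j) f < \<infinity>" using assms(2)[OF j] by (simp add: Linf_def)
    moreover have "AE x in lebesgue_on (layer X j). ereal (norm (f x)) \<le> Linf_nrm (layer X j) f"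
      unfolding Linf_nrm_def by (rule esssup_AE)
    ultimately show ?thesis
      by (cases "Linf_nrm (layer X j) f") auto
  qed
  then obtain B where B: "\<And>j. j \<in> {1..m} \<Longrightarrow> AE x in lebesgue_on (layer X j). norm (f x) \<le> B j" by metis
  define C where "C = (\<Sum>j\<in>{1..m}. \<bar>B j\<bar>)"
  have C: "B j \<le> C" if "j \<in> {1..m}" for j
  proof -
    have "\<bar>B j\<bar> \<le> C" unfolding C_def using that by (intro member_le_sum) auto
    then show ?thesis by linarith
  qed
  have "AE x in lebesgue. norm (f x) \<le> C"
  proof (rule AE_layers[OF assms(1)])
    fix j assume j: "j \<in> {1..m}"
    show "AE x in lebesgue_on (layer X j). norm (f x) \<le> C"
      using B[OF j] by eventually_elim (use C[OF j] in auto)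
  qed
  then show ?thesis using that[OF m] by (simp add: C_def sum_nonneg)
qed

subsection \<open>The kernel of the adjoint\<close>

lemma L2_mult_bounded:
  fixes f g :: "real \<Rightarrow> complex"
  assumes "f \<in> borel_measurable lebesgue" "AE x in lebesgue. norm (f x) \<le> B" "g \<in> L2 UNIV"
  shows "(\<lambda>x. f x * g x) \<in> L2 UNIV"
proof -
  have g: "g \<in> borel_measurable lebesgue" "integrable lebesgue (\<lambda>x. (norm (g x))\<^sup>2)"
    using assms(3) by (auto simp: L2_def lebesgue_on_UNIV_eq)
  have m: "(\<lambda>x. f x * g x) \<in> borel_measurable lebesgue" using assms(1) g(1) by (rule borel_measurable_times)
  have "integrable lebesgue (\<lambda>x. (norm (f x * g x))\<^sup>2)"
  proof (rule Bochner_Integration.integrable_bound)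
    show "integrable lebesgue (\<lambda>x. B\<^sup>2 * (norm (g x))\<^sup>2)" using g(2) by simp
    show "AE x in lebesgue. norm ((norm (f x * g x))\<^sup>2) \<le> norm (B\<^sup>2 * (norm (g x))\<^sup>2)"
      using assms(2)
    proof eventually_elim
      case (elim x)
      have "(norm (f x))\<^sup>2 * (norm (g x))\<^sup>2 \<le> B\<^sup>2 * (norm (g x))\<^sup>2"
        using elim by (intro mult_right_mono power_mono) auto
      then show ?case by (simp add: norm_mult power_mult_distrib)
    qed
  qed (use m in simp)
  with m show ?thesis by (simp add: L2_def lebesgue_on_UNIV_eq)
qed

lemma L2_add:
  fixes f g :: "real \<Rightarrow> 'b::euclidean_space"
  assumes "f \<in> L2 S" "g \<in> L2 S"
  shows "(\<lambda>x. f x + g x) \<in> L2 S"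
proof -
  have fg: "f \<in> borel_measurable (lebesgue_on S)" "g \<in> borel_measurable (lebesgue_on S)"
    "integrable (lebesgue_on S) (\<lambda>x. (norm (f x))\<^sup>2)" "integrable (lebesgue_on S) (\<lambda>x. (norm (g x))\<^sup>2)"
    using assms by (auto simp: L2_def)
  have m: "(\<lambda>x. f x + g x) \<in> borel_measurable (lebesgue_on S)" using fg by simp
  have "integrable (lebesgue_on S) (\<lambda>x. (norm (f x + g x))\<^sup>2)"
  proof (rule Bochner_Integration.integrable_bound)
    show "integrable (lebesgue_on S) (\<lambda>x. 2 * (norm (f x))\<^sup>2 + 2 * (norm (g x))\<^sup>2)" using fg by simp
    show "AE x in lebesgue_on S. norm ((norm (f x + g x))\<^sup>2) \<le> norm (2 * (norm (f x))\<^sup>2 + 2 * (norm (g x))\<^sup>2)"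
    proof (rule AE_I2)
      fix x
      have "(norm (f x + g x))\<^sup>2 \<le> (norm (f x) + norm (g x))\<^sup>2"
        by (intro power_mono norm_triangle_ineq) simp
      also have "\<dots> \<le> 2 * (norm (f x))\<^sup>2 + 2 * (norm (g x))\<^sup>2"
        using zero_le_power2[of "norm (f x) - norm (g x)"] unfolding power2_diff power2_sum by linarith
      finally show "norm ((norm (f x + g x))\<^sup>2) \<le> norm (2 * (norm (f x))\<^sup>2 + 2 * (norm (g x))\<^sup>2)" by simp
    qed
  qed (use m in simp)
  with m show ?thesis by (simp add: L2_def)
qed

lemma L2_cmult: "f \<in> L2 S \<Longrightarrow> (\<lambda>x. c * f x :: complex) \<in> L2 S"
  by (rule L2_bounded_linear[OF bounded_linear_mult_right])

text \<open>Such fields with a constant vector \<open>e\<close> are enough to read off the adjoint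
  equation componentwise; the vector multiplying \<open>deriv \<eta>\<close> is the action of the
  derivative entries of \<open>A_op\<close> on \<open>e\<close>.\<close>

lemma test_fun_scaleR:
  fixes e :: "complex^3"
  assumes "test_fun UNIV \<eta>"
  shows "(\<lambda>x. \<eta> x *\<^sub>R e) \<in> D_A"
    "AE x in lebesgue. L_op k V w (\<lambda>x. \<eta> x *\<^sub>R e) x =
       deriv \<eta> x *\<^sub>R vector [0, - e $ 3, e $ 2] +
       \<eta> x *\<^sub>R (vector [\<i> * of_real k * e $ 3, 0, - \<i> * of_real k * e $ 1] - B_mat V x w *v e)"
proof -
  let ?u = "\<lambda>x. \<eta> x *\<^sub>R e"
  have w: "is_weak_deriv UNIV (\<lambda>x. ?u x $ i) (\<lambda>x. deriv \<eta> x *\<^sub>R e $ i)" for i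
    using is_weak_deriv_bounded_linear[OF open_UNIV bounded_linear_scaleR_left is_weak_deriv_test_fun[OF assms], of "e $ i"]
    by simp
  have l: "(\<lambda>x. \<eta> x *\<^sub>R b) \<in> L2 UNIV" "(\<lambda>x. deriv \<eta> x *\<^sub>R b) \<in> L2 UNIV" for b :: "'c::euclidean_space"
    using L2_bounded_linear[OF bounded_linear_scaleR_left test_fun_L2(1)[OF assms]]
      L2_bounded_linear[OF bounded_linear_scaleR_left test_fun_L2(2)[OF assms]] .
  have "(\<lambda>x. ?u x $ i) \<in> H1 UNIV" for i
    using H1I[OF _ w[of i] l(2)] l(1)[of "e $ i"] by simp
  then show "?u \<in> D_A" using l(1)[of e] by (simp add: D_A_def)
  have "AE x in lebesgue. weak_deriv UNIV (\<lambda>x. ?u x $ i) x = deriv \<eta> x *\<^sub>R e $ i" for i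
    using weak_deriv_AE_eq[OF open_UNIV w[of i]] unfolding lebesgue_on_UNIV_eq .
  from this[of 2] this[of 3]
  show "AE x in lebesgue. L_op k V w (\<lambda>x. \<eta> x *\<^sub>R e) x =
       deriv \<eta> x *\<^sub>R vector [0, - e $ 3, e $ 2] +
       \<eta> x *\<^sub>R (vector [\<i> * of_real k * e $ 3, 0, - \<i> * of_real k * e $ 1] - B_mat V x w *v e)"
  proof eventually_elim
    case (elim x)
    then show ?case
      unfolding L_op_def A_op_def
      by (simp only: elim, simp add: B_mat_mult_vec vec3_eq_iff scaleR_conv_of_real[where 'a = complex] algebra_simps)
  qed
qed

text \<open>
  The operator is symmetric for the bilinear pairing, up to the sign of the first component:
  conjugation and this sign change map the kernel of the adjoint to the kernel.
\<close>

lemma adjoint_kernel_imp_kernel: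
  assumes X: "layers m X" and w: "w \<in> pencil_dom m X V" and v: "adjoint_L k V w v (\<lambda>_. 0)"
  shows "(\<lambda>x. vector [- cnj (v x $ 1), cnj (v x $ 2), cnj (v x $ 3)]) \<in> ker_L k V w"
proof -
  define p where "p i x = cnj (v x $ i)" for i x
  obtain B where B: "(\<lambda>x. V x w) \<in> borel_measurable lebesgue" "AE x in lebesgue. norm (V x w) \<le> B" "B \<ge> 0"
    using w by (auto simp: pencil_dom_def intro: Linf_layers[OF X, of "\<lambda>x. V x w"])
  have v2: "v \<in> L2 UNIV" using v by (simp add: adjoint_L_def)
  have p: "p i \<in> L2 UNIV" for i
    unfolding p_def[abs_def] by (rule L2_bounded_linear[OF bounded_linear_cnj L2_nth[OF v2]])
  have Vp: "(\<lambda>x. V x w * p i x) \<in> L2 UNIV" for i by (rule L2_mult_bounded[OF B(1,2) p])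
  \<comment> \<open>In the pairing of \<open>L_op k V w (\<lambda>x. \<eta> x *\<^sub>R e)\<close>
    with \<open>v\<close>, \<open>F e\<close> is the factor of \<open>deriv \<eta>\<close> and
    \<open>G e\<close> that of \<open>\<eta>\<close>. Vanishing of the pairing for all
    \<open>\<eta>\<close> says precisely that \<open>G e\<close> is the weak derivative of
    \<open>F e\<close>.\<close>
  define F where "F e x = - e $ 3 * p 2 x + e $ 2 * p 3 x" for e :: "complex^3" and x
  define G where "G e x = (\<i> * of_real k * e $ 3) * p 1 x + (- \<i> * of_real k * e $ 1) * p 3 x +
      ((- \<i> * e $ 1) * (V x w * p 1 x) + ((- \<i> * e $ 2) * (V x w * p 2 x) + (- \<i> * w * e $ 3) * p 3 x))"
    for e :: "complex^3" and x
  have F: "F e \<in> L2 UNIV" and G: "G e \<in> L2 UNIV" for e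
    unfolding F_def[abs_def] G_def[abs_def] by (intro L2_add L2_cmult p Vp)+
  have wd: "is_weak_deriv UNIV (F e) (G e)" for e
  proof (rule is_weak_derivI[OF open_UNIV])
    show l: "locally_integrable UNIV (F e)" "locally_integrable UNIV (G e)"
      using L2_locally_integrable[OF F open_UNIV] L2_locally_integrable[OF G open_UNIV] .
    fix \<eta> assume t: "test_fun UNIV \<eta>"
    let ?u = "\<lambda>x. \<eta> x *\<^sub>R e" and ?H = "\<lambda>x. deriv \<eta> x *\<^sub>R F e x + \<eta> x *\<^sub>R G e x"
    have i: "integrable lebesgue (\<lambda>x. deriv \<eta> x *\<^sub>R F e x)" "integrable lebesgue (\<lambda>x. \<eta> x *\<^sub>R G e x)"
      using integrable_test_fun(2)[OF l(1) t] integrable_test_fun(1)[OF l(2) t] .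
    have ae: "AE x in lebesgue. ?H x = (\<Sum>i\<in>UNIV. L_op k V w ?u x $ i * cnj (v x $ i))"
      using test_fun_scaleR(2)[OF t, of k V w e]
      by eventually_elim (simp only:, simp add: sum_3 F_def G_def p_def B_mat_mult_vec scaleR_conv_of_real[where 'a = complex] algebra_simps)
    have Hm: "?H \<in> borel_measurable lebesgue" using i by (intro borel_measurable_add) auto
    have "(LINT x|lebesgue. deriv \<eta> x *\<^sub>R F e x) + (LINT x|lebesgue. \<eta> x *\<^sub>R G e x) = (LINT x|lebesgue. ?H x)"
      by (rule Bochner_Integration.integral_add[OF i, symmetric])
    also have "\<dots> = L2_inner (L_op k V w ?u) v"
      unfolding L2_inner_def by (rule integral_cong_AE[OF Hm borel_measurable_AE[OF Hm ae] ae])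
    also have "\<dots> = L2_inner ?u (\<lambda>_. 0)"
      using v test_fun_scaleR(1)[OF t, of e] by (simp add: adjoint_L_def)
    also have "\<dots> = 0" by (simp add: L2_inner_def)
    finally show "(LINT x|lebesgue. deriv \<eta> x *\<^sub>R F e x) = - (LINT x|lebesgue. \<eta> x *\<^sub>R G e x)"
      by (rule eq_neg_iff_add_eq_0[THEN iffD2])
  qed
  have wd': "is_weak_deriv UNIV f g" if "f = F e" "g = G e" for f g e
    using wd[of e] that by simp
  \<comment> \<open>The three unit vectors give the three equations. For the first one
    \<open>F\<close> is 0, so its equation is algebraic rather than differential.\<close>
  have w1: "is_weak_deriv UNIV (\<lambda>x. 0) (\<lambda>x. - (\<i> * of_real k * p 3 x) - \<i> * V x w * p 1 x)"
    by (rule wd'[of _ "vector [1, 0, 0]"]) (auto simp: fun_eq_iff F_def G_def)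
  have w3: "is_weak_deriv UNIV (p 3) (\<lambda>x. - \<i> * (V x w * p 2 x))"
    by (rule wd'[of _ "vector [0, 1, 0]"]) (auto simp: fun_eq_iff F_def G_def)
  have w2: "is_weak_deriv UNIV (p 2) (\<lambda>x. (- \<i> * of_real k) * p 1 x + (\<i> * w) * p 3 x)"
    using is_weak_deriv_bounded_linear[OF open_UNIV bounded_linear_minus[OF bounded_linear_ident] wd[of "vector [0, 0, 1]"]]
    by (simp add: F_def[abs_def] G_def[abs_def])
  \<comment> \<open>Compared with the kernel equations, those for \<open>p\<close> have the opposite
    sign in the terms with \<open>k\<close>. These couple component 1 to component 3, so negating
    component 1 restores the sign.\<close>
  let ?q = "\<lambda>x. vector [- p 1 x, p 2 x, p 3 x] :: complex^3"
  have q: "?q \<in> D_A"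
  proof -
    have "(\<lambda>x. vector [- cnj (v x $ 1), cnj (v x $ 2), cnj (v x $ 3)] :: complex^3) \<in> L2 UNIV"
    proof (rule L2_bounded_linear[OF _ v2])
      show "bounded_linear (\<lambda>v :: complex^3. vector [- cnj (v $ 1), cnj (v $ 2), cnj (v $ 3)] :: complex^3)"
        by (rule linear_conv_bounded_linear[THEN iffD1], rule linearI) (simp_all add: vec3_eq_iff complex_cnj_scaleR)
    qed
    then have "?q \<in> L2 UNIV" by (simp add: p_def)
    moreover have "p 2 \<in> H1 UNIV" by (rule H1I[OF p w2]) (intro L2_add L2_cmult p)
    moreover have "p 3 \<in> H1 UNIV" by (rule H1I[OF p w3]) (intro L2_cmult Vp)
    ultimately show ?thesis by (simp add: D_A_def)
  qed
  \<comment> \<open>Both this expression and 0 are weak derivatives of 0.\<close>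
  have "AE x in lebesgue. - (\<i> * of_real k * p 3 x) - \<i> * V x w * p 1 x = 0"
    using is_weak_deriv_unique[OF open_UNIV w1 is_weak_deriv_zero] unfolding lebesgue_on_UNIV_eq .
  moreover have "AE x in lebesgue. weak_deriv UNIV (p 2) x = (- \<i> * of_real k) * p 1 x + (\<i> * w) * p 3 x"
    using weak_deriv_AE_eq[OF open_UNIV w2] unfolding lebesgue_on_UNIV_eq .
  moreover have "AE x in lebesgue. weak_deriv UNIV (p 3) x = - \<i> * (V x w * p 2 x)"
    using weak_deriv_AE_eq[OF open_UNIV w3] unfolding lebesgue_on_UNIV_eq .
  ultimately have "AE x in lebesgue. L_op k V w ?q x = 0"
  proof eventually_elim
    case (elim x)
    have "(\<lambda>y. ?q y $ 2) = p 2" "(\<lambda>y. ?q y $ 3) = p 3" by (simp_all add: fun_eq_iff)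
    moreover have "\<i> * of_real k * p 3 x + \<i> * V x w * p 1 x = 0"
      using elim(1) by (metis add.inverse_neutral minus_diff_eq diff_minus_eq_add minus_minus add.commute)
    ultimately show ?case
      unfolding L_op_def A_op_def B_mat_mult_vec
      by (simp only: elim(2,3)) (simp add: vec3_eq_iff algebra_simps)
  qed
  with q show ?thesis by (simp add: ker_L_def p_def)
qed

subsection \<open>Symmetric refinement of the layers\<close>

text \<open>The new interfaces are the old ones together with their mirror images, in increasing
  order. An interval free of old interfaces lies in one old layer, and symmetry of the set of
  interfaces turns into the index reversal \<open>j\<close> to \<open>n + 1 - j\<close>.\<close>

lemma ex_symmetric_refinement:
  assumes X: "layers m X"
  obtains n Y where "layers n Y"
    "\<And>j. j \<in> {1..n} \<Longrightarrow> \<exists>i\<in>{1..m}. layer Y j \<subseteq> layer X i"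
    "\<And>j. j \<in> {1..n} \<Longrightarrow> uminus ` layer Y j = layer Y (n + 1 - j)"
proof -
  define F where "F = {x. \<exists>j\<in>{..m}. X j = ereal x} \<union> uminus ` {x. \<exists>j\<in>{..m}. X j = ereal x}"
  define L where "L = sorted_list_of_set F"
  define N where "N = length L"
  \<comment> \<open>List positions are shifted by one to make room for the end point at index 0;
    \<open>N\<close> interfaces, possibly none, give \<open>N + 1\<close> layers.\<close>
  define Y where "Y j = (if j = 0 then -\<infinity> else if j \<le> N then ereal (L ! (j - 1)) else \<infinity>)" for j
  have finF: "finite F" unfolding F_def using finite_interface_points[of m X] by simp
  have symF: "uminus ` F = F" unfolding F_def by (auto simp: image_Un image_image)
  have L: "sorted L" "distinct L" "set L = F"
    using finF by (auto simp: L_def)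
  have Lmono: "L ! i < L ! j" if "i < j" "j < N" for i j
    using L(1,2) that by (metis N_def distinct_conv_nth le_neq_trans less_imp_le_nat less_trans order_less_imp_not_eq2 sorted_nth_mono order.strict_trans)
  \<comment> \<open>Negating and reversing gives again a sorted list without repetitions, with the
    same elements, hence the same list.\<close>
  have "rev (map uminus L) = L"
  proof (rule sorted_distinct_set_unique)
    show "sorted (rev (map uminus L))"
      using L(1) by (auto simp: sorted_wrt_rev sorted_wrt_map intro: sorted_wrt_mono_rel)
    show "distinct (rev (map uminus L))" using L(2) by (simp add: distinct_map)
    show "set (rev (map uminus L)) = set L" using L(3) symF by simp
  qed (use L in auto)
  then have Lsym: "L ! (N - 1 - i) = - L ! i" if "i < N" for i
    using that rev_nth[of "N - 1 - i" "map uminus L"] by (auto simp: N_def Suc_diff_Suc)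
  have Y: "layers (N + 1) Y"
    unfolding layers_def
  proof (intro conjI allI impI)
    fix j assume "j < N + 1"
    then show "Y j < Y (Suc j)" using Lmono[of "j - 1" j] by (auto simp: Y_def)
  qed (auto simp: Y_def)
  have noF: "t \<notin> F" if t: "t \<in> layer Y j" for t j
  proof
    assume "t \<in> F"
    then obtain i where i: "i < N" "t = L ! i" using L(3) by (metis N_def in_set_conv_nth)
    have lt: "Y (j - 1) < ereal (L ! i)" "ereal (L ! i) < Y j" using t i by (auto simp: layer_def)
    have "j \<noteq> 0" using lt by (cases "j = 0") (auto simp: Y_def)
    \<comment> \<open>The point \<open>L ! i\<close> is either at most the left end
      \<open>Y (j - 1)\<close>, which is list entry \<open>j - 2\<close>, or at least the right end
      \<open>Y j\<close>, which is list entry \<open>j - 1\<close>.\<close>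
    show False
    proof (cases "i < j - 1")
      case True
      have "\<not> Y (j - 1) < ereal (L ! i)"
      proof (cases "j - 1 \<le> N")
        case le: True
        then have "i = j - 1 - 1 \<or> i < j - 1 - 1 \<and> j - 1 - 1 < N" using True by arith
        then have "L ! i \<le> L ! (j - 1 - 1)" using Lmono[of i "j - 1 - 1"] by auto
        then show ?thesis using le True by (simp add: Y_def)
      qed (use True in \<open>auto simp: Y_def\<close>)
      then show False using lt by simp
    next
      case False
      then have "j \<le> N" "j - 1 \<le> i" using i(1) by auto
      then have "\<not> ereal (L ! i) < Y j" using Lmono[of "j - 1" i] i(1) \<open>j \<noteq> 0\<close>
        by (cases "i = j - 1") (auto simp: Y_def)
      then show False using lt by simp
    qed
  qed
  \<comment> \<open>All indices \<open>j\<close> are covered at once: those outside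
    \<open>{1..N + 1}\<close> give the empty layer, since both end points are then the same
    infinity.\<close>
  have ref: "\<exists>i\<in>{1..m}. layer Y j \<subseteq> layer X i" for j
  proof (cases "layer Y j = {}")
    case True
    have "m \<noteq> 0" using X by (cases "m = 0") (auto simp: layers_def)
    with True show ?thesis by (intro bexI[of _ 1]) auto
  next
    case False
    then obtain t where t: "t \<in> layer Y j" by blast
    have "t \<notin> F" by (rule noF[OF t])
    then obtain i where i: "i \<in> {1..m}" "t \<in> layer X i"
      using layer_cover[OF X, of t] by (auto simp: F_def)
    \<comment> \<open>A point \<open>s\<close> of \<open>layer Y j\<close> outside
      \<open>layer X i\<close> would have an end point of \<open>layer X i\<close> between itself
      and \<open>t\<close>. That end point is an interface, yet it would lie in
      \<open>layer Y j\<close>.\<close>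
    have "layer Y j \<subseteq> layer X i"
    proof
      fix s assume s: "s \<in> layer Y j"
      have btw: "r \<in> layer Y j" if "min s t \<le> r" "r \<le> max s t" for r
      proof -
        have a: "Y (j - 1) < ereal (min s t)" and b: "ereal (max s t) < Y j"
          using s t by (auto simp: layer_def min_def max_def)
        have "Y (j - 1) < ereal r" "ereal r < Y j"
          by (rule less_le_trans[OF a], simp only: ereal_less_eq that,
              rule le_less_trans[OF _ b], simp only: ereal_less_eq that)
        then show ?thesis by (simp add: layer_def)
      qed
      have mem: "r \<in> F" if "X l = ereal r" "l \<le> m" for r l
        using that by (auto simp: F_def)
      show "s \<in> layer X i"
      proof (rule ccontr)
        assume "s \<notin> layer X i"
        then consider "ereal s \<le> X (i - 1)" | "X i \<le> ereal s" by (auto simp: layer_def not_less)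
        then show False
        proof cases
          case 1
          then obtain r where r: "X (i - 1) = ereal r"
            using i(2) by (cases "X (i - 1)") (auto simp: layer_def)
          then have "r \<in> F" using i(1) by (intro mem[of "i - 1"]) auto
          moreover have "r \<in> layer Y j"
            using 1 r i(2) by (intro btw) (auto simp: layer_def)
          ultimately show False using noF by blast
        next
          case 2
          then obtain r where r: "X i = ereal r"
            using i(2) by (cases "X i") (auto simp: layer_def)
          then have "r \<in> F" using i(1) by (intro mem[of i]) auto
          moreover have "r \<in> layer Y j"
            using 2 r i(2) by (intro btw) (auto simp: layer_def)
          ultimately show False using noF by blast
        qed
      qed
    qed
    with i(1) show ?thesis by blast
  qed
  have Ysym: "Y (N + 1 - j) = - Y j" if "j \<le> N + 1" for j
  proof -
    consider "j = 0" | "j = N + 1" | "1 \<le> j" "j \<le> N" using \<open>j \<le> N + 1\<close> by linarith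
    then show ?thesis
    proof cases
      case 3
      then have "N + 1 - j - 1 = N - 1 - (j - 1)" by simp
      with 3 Lsym[of "j - 1"] show ?thesis by (simp add: Y_def)
    qed (auto simp: Y_def)
  qed
  have "uminus ` layer Y j = layer Y (N + 1 + 1 - j)" if j: "j \<in> {1..N + 1}" for j
  proof -
    have e1: "N + 1 + 1 - j - 1 = N + 1 - j" and e2: "N + 1 + 1 - j = N + 1 - (j - 1)" using j by auto
    have y1: "Y (N + 1 + 1 - j - 1) = - Y j" unfolding e1 using j by (intro Ysym) auto
    have y2: "Y (N + 1 + 1 - j) = - Y (j - 1)" unfolding e2 using j by (intro Ysym) auto
    have "t \<in> layer Y (N + 1 + 1 - j) \<longleftrightarrow> - Y j < ereal t \<and> ereal t < - Y (j - 1)" for t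
      unfolding layer_def mem_Collect_eq y1 y2 ..
    also have "\<dots> t \<longleftrightarrow> - t \<in> layer Y j" for t
      unfolding layer_def mem_Collect_eq ereal_uminus_less_reorder[of "Y j"] ereal_less_uminus_reorder[of "ereal t"]
      by auto
    finally have "t \<in> layer Y (N + 1 + 1 - j) \<longleftrightarrow> - t \<in> layer Y j" for t .
    then show ?thesis by (intro set_eqI) (simp only: uminus_image_iff)
  qed
  then show ?thesis by (rule that[OF Y ref])
qed

lemma sum_uminus_layers: "(\<Sum>j=1..n. f (n + 1 - j)) = (\<Sum>j=1..n. f j)" for f :: "nat \<Rightarrow> real"
  using sum.atLeastAtMost_rev[of f 1 n] by (simp add: add.commute)

text \<open>Reflection permutes symmetric layers and hence the summands of the norm. For general
  layers it would lead into the space of the mirrored layering.\<close>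

lemma PH1_PT:
  assumes sym: "\<And>j. j \<in> {1..n} \<Longrightarrow> uminus ` layer Y j = layer Y (n + 1 - j)"
    and f: "f \<in> PH1 n Y"
  shows "PT f \<in> PH1 n Y" "PH1_nrm n Y (PT f) = PH1_nrm n Y f"
proof -
  have *: "PT f \<in> H1 (layer Y j) \<and> H1_nrm (layer Y j) (PT f) = H1_nrm (layer Y (n + 1 - j)) f"
    if j: "j \<in> {1..n}" for j
  proof -
    have j': "n + 1 - j \<in> {1..n}" "n + 1 - (n + 1 - j) = j" using j by auto
    have eq: "uminus ` layer Y (n + 1 - j) = layer Y j" using sym[OF j'(1)] j'(2) by simp
    have fj: "f \<in> H1 (layer Y (n + 1 - j))" using f j'(1) by (simp add: PH1_def)
    note r = H1_reflect[OF fj open_layer, unfolded eq]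
    show ?thesis
      using H1_bounded_linear[OF bounded_linear_cnjv r(1) open_layer]
        H1_nrm_isometry[OF bounded_linear_cnjv norm_cnjv r(1) open_layer] r(2)
      by (simp add: PT_def[abs_def])
  qed
  show "PT f \<in> PH1 n Y" using * f L2_PT by (auto simp: PH1_def)
  show "PH1_nrm n Y (PT f) = PH1_nrm n Y f"
    unfolding PH1_nrm_def using * sum_uminus_layers[of "\<lambda>j. H1_nrm (layer Y j) f" n] by simp
qed

section \<open>Passing the spaces and assumptions to a refined layering\<close>

lemma H1_nrm_nonneg: "H1_nrm S f \<ge> 0"
  by (simp add: H1_nrm_def)

text \<open>Each fine layer lies in a coarse one, whose summand is bounded by the full norm. The
  crude factor \<open>n\<close> is harmless because only convergence to 0 is to be
  transferred.\<close>

lemma PH1_refine: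
  assumes ref: "\<And>j. j \<in> {1..n} \<Longrightarrow> \<exists>i\<in>{1..m}. layer Y j \<subseteq> layer X i"
    and f: "f \<in> PH1 m X"
  shows "f \<in> PH1 n Y" "PH1_nrm n Y f \<le> real n * PH1_nrm m X f"
proof -
  have *: "f \<in> H1 (layer Y j) \<and> H1_nrm (layer Y j) f \<le> PH1_nrm m X f" if j: "j \<in> {1..n}" for j
  proof -
    obtain i where i: "i \<in> {1..m}" "layer Y j \<subseteq> layer X i" using ref[OF j] by blast
    have fi: "f \<in> H1 (layer X i)" using f i(1) by (simp add: PH1_def)
    have "H1_nrm (layer X i) f \<le> PH1_nrm m X f"
      unfolding PH1_nrm_def using i(1) by (intro member_le_sum) (auto simp: H1_nrm_nonneg)
    with H1_restrict[OF fi open_layer open_layer i(2)] show ?thesis by auto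
  qed
  show "f \<in> PH1 n Y" using * f by (auto simp: PH1_def)
  have "PH1_nrm n Y f \<le> (\<Sum>j=1..n. PH1_nrm m X f)"
    unfolding PH1_nrm_def[of n Y] using * by (intro sum_mono) auto
  then show "PH1_nrm n Y f \<le> real n * PH1_nrm m X f" by simp
qed

lemma pencil_dom_refine:
  assumes ref: "\<And>j. j \<in> {1..n} \<Longrightarrow> \<exists>i\<in>{1..m}. layer Y j \<subseteq> layer X i"
    and "w \<in> pencil_dom m X V"
  shows "w \<in> pencil_dom n Y V"
  unfolding pencil_dom_def
proof (intro CollectI ballI)
  fix j assume "j \<in> {1..n}"
  then obtain i where i: "i \<in> {1..m}" "layer Y j \<subseteq> layer X i" using ref by blast
  have "(\<lambda>x. V x w) \<in> Linf (layer X i)" using assms(2) i(1) by (simp add: pencil_dom_def)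
  then show "(\<lambda>x. V x w) \<in> Linf (layer Y j)" by (rule Linf_restrict(1)[OF _ open_layer open_layer i(2)])
qed

lemma A_E_refine:
  assumes ref: "\<And>j. j \<in> {1..n} \<Longrightarrow> \<exists>i\<in>{1..m}. layer Y j \<subseteq> layer X i"
    and "A_E m X k V \<omega>0 \<phi>0 \<phi>0s"
  shows "A_E n Y k V \<omega>0 \<phi>0 \<phi>0s"
  using assms(2) pencil_dom_refine[OF ref] unfolding A_E_def pencil_eigenvalue_def by blast

lemma A_V_refine:
  assumes ref: "\<And>j. j \<in> {1..n} \<Longrightarrow> \<exists>i\<in>{1..m}. layer Y j \<subseteq> layer X i"
    and A: "A_V m X V \<omega>0 \<delta>"
  shows "A_V n Y V \<omega>0 \<delta>"
  unfolding A_V_def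
proof (intro ballI conjI)
  fix j assume "j \<in> {1..n}"
  then obtain i where i: "i \<in> {1..m}" "layer Y j \<subseteq> layer X i" using ref by blast
  have AE: "AE x in lebesgue_on (layer Y j). P x" if "AE x in lebesgue_on (layer X i). P x" for P
    using that unfolding AE_lebesgue_on_open[OF open_layer]
    by eventually_elim (use i(2) in blast)
  note W = W1inf_restrict[OF _ open_layer open_layer i(2)]
  show "AE x in lebesgue_on (layer Y j). V x holomorphic_on ball (of_real \<omega>0) \<delta>"
    using A i(1) unfolding A_V_def by (intro AE) blast
  fix w assume w: "w \<in> ball (complex_of_real \<omega>0) \<delta>"
  show "AE x in lebesgue_on (layer Y j). V x w \<noteq> 0" using A i(1) w unfolding A_V_def by (intro AE) blast
  show "(\<lambda>x. V x w) \<in> W1inf (layer Y j)" "(\<lambda>x. 1 / V x w) \<in> W1inf (layer Y j)"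
    "(\<lambda>x. deriv (V x) w) \<in> W1inf (layer Y j)" "(\<lambda>x. (deriv ^^ 2) (V x) w) \<in> W1inf (layer Y j)"
    using A i(1) w unfolding A_V_def by (blast intro: W)+
qed

text \<open>Serves both for \<open>chi3\<close> itself, with \<open>g\<close> the identity, and for
  its modification, with \<open>g\<close> the real part; a nonexpansive \<open>g\<close> preserves
  the Lipschitz constant.\<close>

lemma A_Na_refine:
  assumes Y: "layers n Y" and ref: "\<And>j. j \<in> {1..n} \<Longrightarrow> \<exists>i\<in>{1..m}. layer Y j \<subseteq> layer X i"
    and A: "A_Na m X chi \<omega>0 \<delta>"
    and g: "\<And>w. w \<in> ball (of_real \<omega>0) \<delta> \<Longrightarrow> g w \<in> ball (of_real \<omega>0) \<delta>"
    and contr: "\<And>w w'. cmod (g w - g w') \<le> cmod (w - w')"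
  shows "A_Na n Y (\<lambda>x w. chi x (g w)) \<omega>0 \<delta>"
proof -
  obtain La where La: "La > 0"
    "\<And>j w. j \<in> {1..m} \<Longrightarrow> w \<in> ball (of_real \<omega>0) \<delta> \<Longrightarrow> (\<lambda>x. chi x w) \<in> W1inf (layer X j)"
    "\<And>w w'. w \<in> ball (of_real \<omega>0) \<delta> \<Longrightarrow> w' \<in> ball (of_real \<omega>0) \<delta> \<Longrightarrow>
        (MAX j\<in>{1..m}. W1inf_nrm (layer X j) (\<lambda>x. chi x w - chi x w')) \<le> ereal (La * cmod (w - w'))"
    using A unfolding A_Na_def by blast
  have n: "n \<noteq> 0" using Y by (cases "n = 0") (auto simp: layers_def)
  show ?thesis
    unfolding A_Na_def
  proof (intro exI[of _ La] conjI ballI)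
    show "La > 0" by fact
  next
    fix j w assume j: "j \<in> {1..n}" and w: "w \<in> ball (complex_of_real \<omega>0) \<delta>"
    obtain i where i: "i \<in> {1..m}" "layer Y j \<subseteq> layer X i" using ref[OF j] by blast
    show "(\<lambda>x. chi x (g w)) \<in> W1inf (layer Y j)"
      by (rule W1inf_restrict[OF La(2)[OF i(1) g[OF w]] open_layer open_layer i(2)])
  next
    fix w w' assume w: "w \<in> ball (complex_of_real \<omega>0) \<delta>" "w' \<in> ball (complex_of_real \<omega>0) \<delta>"
    have "W1inf_nrm (layer Y j) (\<lambda>x. chi x (g w) - chi x (g w')) \<le> ereal (La * cmod (w - w'))"
      if j: "j \<in> {1..n}" for j
    proof -
      obtain i where i: "i \<in> {1..m}" "layer Y j \<subseteq> layer X i" using ref[OF j] by blast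
      have "W1inf_nrm (layer Y j) (\<lambda>x. chi x (g w) - chi x (g w'))
        \<le> W1inf_nrm (layer X i) (\<lambda>x. chi x (g w) - chi x (g w'))"
        by (rule W1inf_nrm_restrict[OF W1inf_diff[OF La(2)[OF i(1) g[OF w(1)]] La(2)[OF i(1) g[OF w(2)]] open_layer]
              open_layer open_layer i(2)])
      also have "\<dots> \<le> (MAX j\<in>{1..m}. W1inf_nrm (layer X j) (\<lambda>x. chi x (g w) - chi x (g w')))"
        using i(1) by (intro Max_ge) auto
      also have "\<dots> \<le> ereal (La * cmod (g w - g w'))"
        by (rule La(3)[OF g[OF w(1)] g[OF w(2)]])
      also have "\<dots> \<le> ereal (La * cmod (w - w'))"
        using La(1) contr[of w w'] by simp
      finally show ?thesis .
    qed
    then show "(MAX j\<in>{1..n}. W1inf_nrm (layer Y j) (\<lambda>x. chi x (g w) - chi x (g w'))) \<le> ereal (La * cmod (w - w'))"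
      using n by (subst Max_le_iff) auto
  qed
qed

subsection \<open>Symmetry of the potential at complex frequencies\<close>

text \<open>Schwarz reflection: \<open>cnj \<circ> g \<circ> cnj\<close> is holomorphic on the same
  ball and agrees with \<open>f\<close> on a real segment that accumulates at the centre, so the
  identity theorem applies.\<close>

lemma holomorphic_PT_extension:
  assumes f: "f holomorphic_on ball (of_real a) r" and g: "g holomorphic_on ball (of_real a) r"
    and r: "r > 0" "s > 0" and eq: "\<And>t. t \<in> {a - s<..<a + s} \<Longrightarrow> f (of_real t) = cnj (g (of_real t))"
    and w: "w \<in> ball (of_real a) r"
  shows "f (cnj w) = cnj (g w)"
proof -
  let ?B = "ball (complex_of_real a) r"
  have cB: "cnj ` ?B = ?B"
  proof -
    have "cnj z \<in> ?B" if "z \<in> ?B" for z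
    proof -
      have "cmod (complex_of_real a - cnj z) = cmod (complex_of_real a - z)"
        by (metis complex_cnj_complex_of_real complex_cnj_diff complex_mod_cnj)
      with that show ?thesis by (simp add: dist_norm)
    qed
    then have "cnj ` ?B \<subseteq> ?B" "cnj ` cnj ` ?B \<subseteq> cnj ` ?B" by blast+
    then show ?thesis by (simp add: image_image)
  qed
  have cg: "(cnj \<circ> g \<circ> cnj) holomorphic_on ?B"
    using g cB by (intro holomorphic_on_compose_cnj_cnj) auto
  \<comment> \<open>The minimum keeps the segment inside the ball and inside the interval on which
    the symmetry is known.\<close>
  define s' where "s' = min r s"
  have s': "s' > 0" "s' \<le> r" "s' \<le> s" using r by (auto simp: s'_def)
  define U where "U = complex_of_real ` {a - s'<..<a + s'}"
  have UB: "U \<subseteq> ?B"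
    using s' by (auto simp: U_def dist_norm simp flip: of_real_diff)
  have lim: "complex_of_real a islimpt U"
    unfolding islimpt_approachable
  proof (intro allI impI)
    fix e :: real assume e: "e > 0"
    define t where "t = min (e / 2) (s' / 2)"
    have t: "0 < t" "t < e" "t < s'" using e s' by (auto simp: t_def)
    have "complex_of_real (a + t) \<in> U" unfolding U_def using t by (intro imageI) auto
    then show "\<exists>x'\<in>U. x' \<noteq> complex_of_real a \<and> dist x' (complex_of_real a) < e"
      using t by (intro bexI[of _ "complex_of_real (a + t)"]) (auto simp: dist_norm)
  qed
  have "f z - (cnj \<circ> g \<circ> cnj) z = 0" if z: "z \<in> ?B" for z
  proof (rule analytic_continuation[of "\<lambda>z. f z - (cnj \<circ> g \<circ> cnj) z", OF _ _ _ UB _ lim _ z])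
    show "(\<lambda>z. f z - (cnj \<circ> g \<circ> cnj) z) holomorphic_on ?B"
      by (intro holomorphic_intros f cg)
    show "complex_of_real a \<in> ?B" using r by simp
    fix z assume "z \<in> U"
    then obtain t where "t \<in> {a - s'<..<a + s'}" "z = of_real t" by (auto simp: U_def)
    then show "f z - (cnj \<circ> g \<circ> cnj) z = 0" using eq[of t] s' by auto
  qed auto
  moreover have "cnj w \<in> ?B" using w cB by blast
  ultimately show ?thesis by fastforce
qed

text \<open>Holomorphy is required at \<open>x\<close> and \<open>- x\<close> simultaneously;
  reflection preserves null sets, so this holds for almost every \<open>x\<close>.\<close>

lemma PT_material_complex:
  assumes X: "layers m X" and A: "A_V m X V \<omega>0 \<delta>" "\<delta> > 0"
    and PT: "PT_material V \<omega>0 s" "s > 0" and w: "w \<in> ball (of_real \<omega>0) \<delta>"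
  shows "AE x in lebesgue. V x (cnj w) = cnj (V (- x) w)"
proof -
  have "AE x in lebesgue. V x holomorphic_on ball (of_real \<omega>0) \<delta>"
    by (rule AE_layers[OF X]) (use A in \<open>auto simp: A_V_def\<close>)
  with AE_lebesgue_reflect[OF this] show ?thesis
  proof eventually_elim
    case (elim x)
    show ?case
    proof (rule holomorphic_PT_extension[OF elim(2,1) A(2) PT(2) _ w])
      show "V x (of_real t) = cnj (V (- x) (of_real t))" if "t \<in> {\<omega>0 - s<..<\<omega>0 + s}" for t
        using PT(1) that unfolding PT_material_def by blast
    qed
  qed
qed

subsection \<open>Symmetry of solutions and eigenfunctions\<close>

lemma solves_smult:
  assumes "cmod c = 1" "solves m X k e \<mu> V chi w v"
  shows "solves m X k e \<mu> V chi w (\<lambda>x. c *s v x)"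
proof -
  have v: "w \<in> pencil_dom m X V" "v \<in> D_A" "v \<in> PH1 m X"
    "AE x in lebesgue. L_op k V w v x = h_nl e \<mu> chi x w (v x)"
    using assms(2) by (auto simp: solves_def)
  have "AE x in lebesgue. L_op k V w (\<lambda>x. c *s v x) x = h_nl e \<mu> chi x w (c *s v x)"
    using L_op_smult[OF v(2), of k V w c] v(4)
    by eventually_elim (simp add: h_nl_smult[OF assms(1)])
  then show ?thesis
    using v D_A_smult PH1_smult[OF _ open_layer] by (simp add: solves_def)
qed

lemma solves_PT:
  assumes sym: "\<And>j. j \<in> {1..n} \<Longrightarrow> uminus ` layer Y j = layer Y (n + 1 - j)"
    and v: "solves n Y k e \<mu> V chi w v"
    and V: "AE x in lebesgue. V x (cnj w) = cnj (V (- x) w)"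
    and chi: "\<And>x. chi x (cnj w) = cnj (chi (- x) w)"
    and dom: "cnj w \<in> pencil_dom n Y V"
  shows "solves n Y k e \<mu> V chi (cnj w) (PT v)"
proof -
  have v': "v \<in> D_A" "v \<in> PH1 n Y" "AE x in lebesgue. L_op k V w v x = h_nl e \<mu> chi x w (v x)"
    using v by (auto simp: solves_def)
  have "AE x in lebesgue. L_op k V (cnj w) (PT v) x = h_nl e \<mu> chi x (cnj w) (PT v x)"
    using L_op_PT[OF v'(1) V, of k] AE_lebesgue_reflect[OF v'(3)]
    by eventually_elim (simp add: PT_def h_nl_cnjv[of chi _ w, OF chi])
  then show ?thesis
    using dom D_A_PT[OF v'(1)] PH1_PT(1)[OF sym v'(2)] by (simp add: solves_def)
qed

lemma ker_L_PT:
  assumes "u \<in> ker_L k V w" "AE x in lebesgue. V x (cnj w) = cnj (V (- x) w)"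
  shows "PT u \<in> ker_L k V (cnj w)"
proof -
  have u: "u \<in> D_A" "AE x in lebesgue. L_op k V w u x = 0" using assms(1) by (auto simp: ker_L_def)
  have "AE x in lebesgue. L_op k V (cnj w) (PT u) x = 0"
    using L_op_PT[OF u(1) assms(2), of k] AE_lebesgue_reflect[OF u(2)]
    by eventually_elim (simp add: vec_eq_iff)
  then show ?thesis using D_A_PT[OF u(1)] by (simp add: ker_L_def)
qed

lemma PT_AE_cong: "AE x in lebesgue. u x = v x \<Longrightarrow> AE x in lebesgue. PT u x = PT v x"
  using AE_lebesgue_reflect[of "\<lambda>x. u x = v x"] by (auto simp: PT_def elim: AE_mp)

lemma L2_nrm_phase:
  fixes u v :: "real \<Rightarrow> complex^3"
  assumes "L2_nrm UNIV u = 1" "u \<in> L2 UNIV" "v \<in> L2 UNIV" "L2_nrm UNIV v = 1" "AE x in lebesgue. v x = d *s u x"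
  shows "cmod d = 1"
proof -
  have "L2_nrm UNIV v = L2_nrm UNIV (\<lambda>x. d *s u x)"
  proof (rule L2_nrm_AE_cong)
    show "AE x in lebesgue_on UNIV. norm (v x) = norm (d *s u x)"
      unfolding lebesgue_on_UNIV_eq using assms(5) by eventually_elim simp
  qed (use assms L2_smult[OF assms(2), of d] in \<open>auto simp: L2_def\<close>)
  also have "\<dots> = cmod d * L2_nrm UNIV u"
  proof -
    have "(norm (d *s u x))\<^sup>2 = (cmod d)\<^sup>2 * (norm (u x))\<^sup>2" for x
      by (simp add: norm_vec3 norm_mult power_mult_distrib distrib_left)
    then show ?thesis by (simp add: L2_nrm_def real_sqrt_mult)
  qed
  finally show ?thesis using assms by simp
qed

text \<open>\<open>PT\<close> preserves the norm, so its factor \<open>d\<close> on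
  \<open>\<phi>0\<close> is a phase. It has some factor \<open>e\<close> on \<open>\<phi>0s\<close>
  because \<open>J\<close> turns \<open>\<phi>0s\<close> into a multiple of \<open>\<phi>0\<close>.
  The pairing, which equals 1 before and after \<open>PT\<close>, gives
  \<open>d * cnj e = 1\<close>.\<close>

lemma eigenfunction_phases:
  assumes X: "layers m X" and A: "A_E m X k V \<omega>0 \<phi>0 \<phi>0s"
    and V: "\<And>x. V x (of_real \<omega>0) = cnj (V (- x) (of_real \<omega>0))"
  obtains d where "cmod d = 1" "AE x in lebesgue. PT \<phi>0 x = d *s \<phi>0 x" "AE x in lebesgue. PT \<phi>0s x = d *s \<phi>0s x"
proof -
  let ?w = "complex_of_real \<omega>0"
  have dom: "?w \<in> pencil_dom m X V" and ker: "\<phi>0 \<in> ker_L k V ?w" and nrm: "L2_nrm UNIV \<phi>0 = 1"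
    and adj: "adjoint_L k V ?w \<phi>0s (\<lambda>_. 0)" and inner: "L2_inner \<phi>0 \<phi>0s = 1"
    using A by (auto simp: A_E_def pencil_eigenvalue_def)
  obtain u0 where u0: "\<And>u. u \<in> ker_L k V ?w \<Longrightarrow> \<exists>c. AE x in lebesgue. u x = c *s u0 x"
    using A unfolding A_E_def alg_simple_def by blast
  obtain c0 where c0: "AE x in lebesgue. \<phi>0 x = c0 *s u0 x" using u0[OF ker] by blast
  have L: "\<phi>0 \<in> L2 UNIV" "\<phi>0s \<in> L2 UNIV"
    using ker adj by (auto simp: ker_L_def D_A_def adjoint_L_def)
  have meas: "\<phi>0 \<in> borel_measurable lebesgue" "\<phi>0s \<in> borel_measurable lebesgue"
    using L by (auto simp: L2_def lebesgue_on_UNIV_eq)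
  have c0nz: "c0 \<noteq> 0"
  proof
    assume "c0 = 0"
    with c0 have "AE x in lebesgue. \<phi>0 x = 0" by simp
    then have "L2_inner \<phi>0 \<phi>0s = L2_inner (\<lambda>_. 0) \<phi>0s" by (intro L2_inner_AE_cong meas) auto
    with inner show False by (simp add: L2_inner_def)
  qed
  \<comment> \<open>The generator provided by simplicity is replaced by \<open>\<phi>0\<close>, a
    nonzero multiple of it because its pairing with \<open>\<phi>0s\<close> is 1.\<close>
  have span: "\<exists>c. AE x in lebesgue. u x = c *s \<phi>0 x" if u: "u \<in> ker_L k V ?w" for u
  proof -
    obtain c where "AE x in lebesgue. u x = c *s u0 x" using u0[OF u] by blast
    with c0 have "AE x in lebesgue. u x = (c / c0) *s \<phi>0 x"
      by eventually_elim (use c0nz in \<open>simp add: vec_eq_iff\<close>)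
    then show ?thesis by blast
  qed
  have "AE x in lebesgue. V x (cnj ?w) = cnj (V (- x) ?w)"
    unfolding complex_cnj_complex_of_real by (intro AE_I2 V)
  from ker_L_PT[OF ker this] have PTker: "PT \<phi>0 \<in> ker_L k V ?w" by simp
  obtain d where d: "AE x in lebesgue. PT \<phi>0 x = d *s \<phi>0 x" using span[OF PTker] by blast
  have d1: "cmod d = 1"
    by (rule L2_nrm_phase[OF nrm L(1) L2_PT[OF L(1)] _ d]) (simp add: L2_nrm_PT nrm)
  \<comment> \<open>The conjugate-linear involution from the adjoint kernel to the kernel; it
    commutes with \<open>cnjv\<close>, so the action of \<open>PT\<close> can be carried across
    it.\<close>
  define J where "J v = (vector [- cnj (v $ 1), cnj (v $ 2), cnj (v $ 3)] :: complex^3)" for v :: "complex^3"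
  have JJ: "J (J v) = v" for v by (simp add: J_def vec3_eq_iff)
  have Js: "J (a *s v) = cnj a *s J v" for a v by (simp add: J_def vec3_eq_iff)
  have Jc: "J (cnjv v) = cnjv (J v)" for v by (simp add: J_def vec3_eq_iff)
  have "(\<lambda>x. J (\<phi>0s x)) \<in> ker_L k V ?w"
    unfolding J_def by (rule adjoint_kernel_imp_kernel[OF X dom adj])
  then obtain a where a: "AE x in lebesgue. J (\<phi>0s x) = a *s \<phi>0 x" using span by blast
  have a': "AE x in lebesgue. \<phi>0s x = cnj a *s J (\<phi>0 x)"
    using a by eventually_elim (metis JJ Js)
  have anz: "a \<noteq> 0"
  proof
    assume "a = 0"
    with a' have "AE x in lebesgue. \<phi>0s x = 0" by simp
    then have "L2_inner \<phi>0 \<phi>0s = L2_inner \<phi>0 (\<lambda>_. 0)" by (intro L2_inner_AE_cong meas) auto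
    with inner show False by (simp add: L2_inner_def)
  qed
  \<comment> \<open>Applying \<open>PT\<close> to \<open>\<phi>0s = cnj a *s J \<phi>0\<close>
    conjugates the coefficient, and \<open>J\<close> conjugates the factor \<open>d\<close> of
    \<open>PT \<phi>0\<close>; dividing by \<open>cnj a\<close> returns to
    \<open>\<phi>0s\<close>.\<close>
  define e where "e = a * cnj d / cnj a"
  have e: "AE x in lebesgue. PT \<phi>0s x = e *s \<phi>0s x"
    using AE_lebesgue_reflect[OF a'] a' d
  proof eventually_elim
    case (elim x)
    have "PT \<phi>0s x = a *s J (PT \<phi>0 x)"
      using elim(1) by (simp add: PT_def cnjv_smult Jc)
    also have "\<dots> = (a * cnj d) *s J (\<phi>0 x)" unfolding elim(3) Js by (simp add: vec_eq_iff)
    also have "\<dots> = e *s \<phi>0s x" using elim(2) anz by (simp add: e_def vec_eq_iff)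
    finally show ?case .
  qed
  have "1 = L2_inner (PT \<phi>0) (PT \<phi>0s)" by (simp add: L2_inner_PT inner)
  also have "\<dots> = L2_inner (\<lambda>x. d *s \<phi>0 x) (\<lambda>x. e *s \<phi>0s x)"
    using L2_PT[OF L(1)] L2_PT[OF L(2)] d e by (intro L2_inner_AE_cong) (auto simp: L2_def lebesgue_on_UNIV_eq)
  also have "\<dots> = d * cnj e" by (simp add: L2_inner_smult inner)
  finally have de: "d * cnj e = 1" by simp
  \<comment> \<open>A phase has a unique inverse, so \<open>cnj d\<close> and \<open>cnj e\<close>
    coincide.\<close>
  have "d * cnj d = 1" using d1 by (metis complex_norm_square mult.right_neutral of_real_1 power_one)
  then have "cnj d = cnj e" using de d1 by (metis mult_cancel_left norm_zero zero_neq_one)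
  then have "e = d" by simp
  with e show ?thesis using that[OF d1 d] by simp
qed

subsection \<open>Rotation of a branch\<close>

lemma rotated_smult_cancel: "cmod c = 1 \<Longrightarrow> cnj c *s (c *s v) = (v :: complex^3)"
proof -
  assume "cmod c = 1"
  then have "cnj c * c = 1" by (metis complex_norm_square mult.commute of_real_1 power_one)
  then show ?thesis by (simp add: vec_eq_iff flip: mult.assoc)
qed

lemma L2_inner_rotate:
  assumes "cmod c = 1"
  shows "L2_inner (\<lambda>x. c *s f x) (\<lambda>x. c *s g x) = L2_inner f g"
proof -
  have "c * cnj c = 1" using assms by (metis complex_norm_square of_real_1 power_one)
  then show ?thesis by (simp add: L2_inner_smult)
qed

text \<open>In each pairing both arguments acquire the same phase, by gauge covariance of
  \<open>h_nl\<close> and linearity of \<open>dB_mat\<close>, so the phases cancel.\<close>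

lemma nu_coeff_rotate:
  assumes "cmod c = 1"
  shows "nu_coeff e \<mu> V chi \<omega>0 (\<lambda>x. c *s \<phi>0 x) (\<lambda>x. c *s \<phi>0s x) = nu_coeff e \<mu> V chi \<omega>0 \<phi>0 \<phi>0s"
  unfolding nu_coeff_def h_nl_smult[OF assms] vector_scalar_commute L2_inner_rotate[OF assms] ..

lemma perp_space_rotate:
  assumes "cmod c = 1" "f \<in> perp_space m X \<phi>0s"
  shows "(\<lambda>x. c *s f x) \<in> perp_space m X (\<lambda>x. c *s \<phi>0s x)"
  using assms(2) D_A_smult PH1_smult[OF _ open_layer]
  by (simp add: perp_space_def L2_inner_rotate[OF assms(1)])

lemma phi_eq_rotate:
  assumes c: "cmod c = 1" and f: "\<phi> \<in> D_A" "phi_eq k e \<mu> V chi \<omega>0 \<phi>0 \<phi>0s \<phi>"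
  shows "phi_eq k e \<mu> V chi \<omega>0 (\<lambda>x. c *s \<phi>0 x) (\<lambda>x. c *s \<phi>0s x) (\<lambda>x. c *s \<phi> x)"
  unfolding phi_eq_def nu_coeff_rotate[OF c] h_nl_smult[OF c] vector_scalar_commute
  using L_op_smult[OF f(1), of k V "of_real \<omega>0" c] f(2)[unfolded phi_eq_def]
  by eventually_elim (simp add: vec_eq_iff algebra_simps)

lemma is_phi_rotate:
  assumes c: "cmod c = 1" and f: "is_phi m X k e \<mu> V chi \<omega>0 \<phi>0 \<phi>0s \<phi>"
  shows "is_phi m X k e \<mu> V chi \<omega>0 (\<lambda>x. c *s \<phi>0 x) (\<lambda>x. c *s \<phi>0s x) (\<lambda>x. c *s \<phi> x)"
proof -
  have f': "\<phi> \<in> perp_space m X \<phi>0s" "phi_eq k e \<mu> V chi \<omega>0 \<phi>0 \<phi>0s \<phi>"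
    "\<And>\<phi>'. \<phi>' \<in> perp_space m X \<phi>0s \<Longrightarrow> phi_eq k e \<mu> V chi \<omega>0 \<phi>0 \<phi>0s \<phi>' \<Longrightarrow> AE x in lebesgue. \<phi>' x = \<phi> x"
    using f unfolding is_phi_def by blast+
  have c': "cmod (cnj c) = 1" using c by simp
  have "AE x in lebesgue. \<phi>' x = c *s \<phi> x"
    if p: "\<phi>' \<in> perp_space m X (\<lambda>x. c *s \<phi>0s x)"
      and q: "phi_eq k e \<mu> V chi \<omega>0 (\<lambda>x. c *s \<phi>0 x) (\<lambda>x. c *s \<phi>0s x) \<phi>'" for \<phi>'
  proof -
    have "\<phi>' \<in> D_A" using p by (simp add: perp_space_def)
    \<comment> \<open>A competitor for the rotated problem is rotated back by \<open>cnj c\<close>,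
      compared with \<open>\<phi>\<close>, and rotated forward again.\<close>
    from f'(3)[OF perp_space_rotate[OF c' p, unfolded rotated_smult_cancel[OF c]]
        phi_eq_rotate[OF c' this q, unfolded rotated_smult_cancel[OF c]]]
    show ?thesis
    proof eventually_elim
      case (elim x)
      then have "c *s (cnj c *s \<phi>' x) = c *s \<phi> x" by simp
      then show ?case using rotated_smult_cancel[OF c', of "\<phi>' x"] by simp
    qed
  qed
  moreover have "\<phi> \<in> D_A" using f'(1) by (simp add: perp_space_def)
  ultimately show ?thesis
    using perp_space_rotate[OF c f'(1)] phi_eq_rotate[OF c _ f'(2)] unfolding is_phi_def by blast
qed

text \<open>All ingredients of a branch are covariant under a common phase. The interval may shrink
  at the same time, as the symmetry will be known for small \<open>\<epsilon>\<close> only.\<close>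

lemma bifurcating_branch_rotate:
  assumes c: "cmod c = 1" and b: "bifurcating_branch m X k e \<mu> V chi \<omega>0 \<phi>0 \<phi>0s \<epsilon>0 \<omega> u"
    and \<epsilon>1: "0 < \<epsilon>1" "\<epsilon>1 \<le> \<epsilon>0"
  shows "bifurcating_branch m X k e \<mu> V chi \<omega>0 (\<lambda>x. c *s \<phi>0 x) (\<lambda>x. c *s \<phi>0s x) \<epsilon>1 \<omega> (\<lambda>\<epsilon> x. c *s u \<epsilon> x)"
proof -
  obtain \<phi> where phi: "is_phi m X k e \<mu> V chi \<omega>0 \<phi>0 \<phi>0s \<phi>"
    and s: "\<And>\<epsilon>. \<epsilon> \<in> {0<..<\<epsilon>0} \<Longrightarrow> solves m X k e \<mu> V chi (\<omega> \<epsilon>) (u \<epsilon>)"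
    and i: "\<And>\<epsilon>. \<epsilon> \<in> {0<..<\<epsilon>0} \<Longrightarrow> L2_inner (u \<epsilon>) \<phi>0s = of_real (\<epsilon> powr (1/2))"
    and o: "\<And>\<epsilon>. \<epsilon> \<in> {0<..<\<epsilon>0} \<Longrightarrow> \<exists>\<sigma>. \<omega> \<epsilon> = of_real \<omega>0 + of_real \<epsilon> * nu_coeff e \<mu> V chi \<omega>0 \<phi>0 \<phi>0s +
                 of_real (\<epsilon>\<^sup>2) * \<sigma>"
    and p: "\<And>\<epsilon>. \<epsilon> \<in> {0<..<\<epsilon>0} \<Longrightarrow> \<exists>\<psi> \<in> perp_space m X \<phi>0s. AE x in lebesgue.
              u \<epsilon> x = (\<epsilon> powr (1/2)) *\<^sub>R \<phi>0 x + (\<epsilon> powr (3/2)) *\<^sub>R \<phi> x + (\<epsilon> powr (5/2)) *\<^sub>R \<psi> x"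
    and lim: "(\<omega> \<longlongrightarrow> of_real \<omega>0) (at_right 0)" "((\<lambda>\<epsilon>. PH1_nrm m X (u \<epsilon>)) \<longlongrightarrow> 0) (at_right 0)"
    using b unfolding bifurcating_branch_def by blast
  have "((\<lambda>\<epsilon>. PH1_nrm m X (\<lambda>x. c *s u \<epsilon> x)) \<longlongrightarrow> 0) (at_right 0)"
  proof (rule tendsto_cong[THEN iffD2, OF _ lim(2)])
    have "0 < \<epsilon>0" using \<epsilon>1 by simp
    then show "\<forall>\<^sub>F \<epsilon> in at_right 0. PH1_nrm m X (\<lambda>x. c *s u \<epsilon> x) = PH1_nrm m X (u \<epsilon>)"
      using s by (auto simp: eventually_at_right solves_def intro!: exI[of _ \<epsilon>0] PH1_nrm_smult open_layer c)
  qed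
  moreover have "\<exists>\<psi> \<in> perp_space m X (\<lambda>x. c *s \<phi>0s x). AE x in lebesgue.
      c *s u \<epsilon> x = (\<epsilon> powr (1/2)) *\<^sub>R (c *s \<phi>0 x) + (\<epsilon> powr (3/2)) *\<^sub>R (c *s \<phi> x) + (\<epsilon> powr (5/2)) *\<^sub>R \<psi> x"
    if eps: "\<epsilon> \<in> {0<..<\<epsilon>0}" for \<epsilon>
  proof -
    obtain \<psi> where psi: "\<psi> \<in> perp_space m X \<phi>0s" "AE x in lebesgue.
        u \<epsilon> x = (\<epsilon> powr (1/2)) *\<^sub>R \<phi>0 x + (\<epsilon> powr (3/2)) *\<^sub>R \<phi> x + (\<epsilon> powr (5/2)) *\<^sub>R \<psi> x"
      using p[OF eps] by blast
    have "AE x in lebesgue.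
        c *s u \<epsilon> x = (\<epsilon> powr (1/2)) *\<^sub>R (c *s \<phi>0 x) + (\<epsilon> powr (3/2)) *\<^sub>R (c *s \<phi> x) + (\<epsilon> powr (5/2)) *\<^sub>R (c *s \<psi> x)"
      using psi(2) by eventually_elim (simp add: vec_eq_iff distrib_left)
    with perp_space_rotate[OF c psi(1)] show ?thesis by (intro bexI[of _ "\<lambda>x. c *s \<psi> x"])
  qed
  ultimately show ?thesis
    unfolding bifurcating_branch_def nu_coeff_rotate[OF c]
    using is_phi_rotate[OF c phi] solves_smult[OF c s] i o lim(1) \<epsilon>1
    by (intro conjI exI[of _ "\<lambda>x. c *s \<phi> x"] ballI) (auto simp: L2_inner_rotate[OF c])
qed

subsection \<open>Comparison with the unique branch\<close>

text \<open>Convergence to \<open>(\<omega>0, 0)\<close> brings the family within the radius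
  \<open>r\<close> of uniqueness. All branches below are identified through this comparison.\<close>

lemma unique_branch_eventually_eq:
  assumes U: "unique_branch n Y k e \<mu> V chi \<omega>0 \<phi>0 \<phi>0s \<epsilon>1 \<omega>' u'"
    and s: "\<forall>\<^sub>F \<epsilon> in at_right 0. solves n Y k e \<mu> V chi (w \<epsilon>) (v \<epsilon>) \<and> L2_inner (v \<epsilon>) \<phi>0s = of_real (\<epsilon> powr (1/2))"
    and lim: "(w \<longlongrightarrow> of_real \<omega>0) (at_right 0)" "((\<lambda>\<epsilon>. PH1_nrm n Y (v \<epsilon>)) \<longlongrightarrow> 0) (at_right 0)"
  shows "\<forall>\<^sub>F \<epsilon> in at_right 0. w \<epsilon> = \<omega>' \<epsilon> \<and> (AE x in lebesgue. v \<epsilon> x = u' \<epsilon> x)"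
proof -
  obtain r where r: "r > 0" and un: "\<And>\<epsilon> w v. \<epsilon> \<in> {0<..<\<epsilon>1} \<Longrightarrow>
      solves n Y k e \<mu> V chi w v \<Longrightarrow> L2_inner v \<phi>0s = of_real (\<epsilon> powr (1/2)) \<Longrightarrow>
      cmod (w - of_real \<omega>0) < r \<Longrightarrow> PH1_nrm n Y v < r \<Longrightarrow> w = \<omega>' \<epsilon> \<and> (AE x in lebesgue. v x = u' \<epsilon> x)"
    and pos: "\<epsilon>1 > 0"
    using U unfolding unique_branch_def bifurcating_branch_def by blast
  have "\<forall>\<^sub>F \<epsilon> in at_right 0. \<epsilon> \<in> {0<..<\<epsilon>1}"
    using pos by (auto simp: eventually_at_right)
  moreover have "\<forall>\<^sub>F \<epsilon> in at_right 0. cmod (w \<epsilon> - of_real \<omega>0) < r"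
    using tendstoD[OF lim(1) r] by (simp add: dist_norm)
  moreover have "\<forall>\<^sub>F \<epsilon> in at_right 0. PH1_nrm n Y (v \<epsilon>) < r"
    using order_tendstoD(2)[OF lim(2) r] .
  ultimately show ?thesis
    using s by eventually_elim (use un in blast)
qed

lemma bifurcating_branch_eventually:
  assumes "bifurcating_branch m X k e \<mu> V chi \<omega>0 \<phi>0 \<phi>0s \<epsilon>0 \<omega> u"
  shows "\<forall>\<^sub>F \<epsilon> in at_right 0. solves m X k e \<mu> V chi (\<omega> \<epsilon>) (u \<epsilon>) \<and> L2_inner (u \<epsilon>) \<phi>0s = of_real (\<epsilon> powr (1/2))"
    "(\<omega> \<longlongrightarrow> of_real \<omega>0) (at_right 0)" "((\<lambda>\<epsilon>. PH1_nrm m X (u \<epsilon>)) \<longlongrightarrow> 0) (at_right 0)"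
  using assms unfolding bifurcating_branch_def by (auto simp: eventually_at_right intro!: exI[of _ \<epsilon>0])

text \<open>The mirrored branch, corrected by \<open>cnj d\<close>, competes with the branch itself:
  the correction undoes the phase of \<open>\<phi>0s\<close>, and the normalisation survives
  conjugation because it is real.\<close>

lemma unique_branch_PT:
  assumes sym: "\<And>j. j \<in> {1..n} \<Longrightarrow> uminus ` layer Y j = layer Y (n + 1 - j)"
    and U: "unique_branch n Y k e \<mu> V chi \<omega>0 \<phi>0 \<phi>0s \<epsilon>1 w u"
    and \<delta>: "\<delta> > 0"
    and V: "\<And>z. z \<in> ball (of_real \<omega>0) \<delta> \<Longrightarrow> AE x in lebesgue. V x (cnj z) = cnj (V (- x) z)"
    and dom: "\<And>z. z \<in> ball (of_real \<omega>0) \<delta> \<Longrightarrow> z \<in> pencil_dom n Y V"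
    and chi: "\<And>x z. z \<in> ball (of_real \<omega>0) \<delta> \<Longrightarrow> chi x (cnj z) = cnj (chi (- x) z)"
    and d: "cmod d = 1" and p: "\<phi>0s \<in> L2 UNIV" "AE x in lebesgue. PT \<phi>0s x = d *s \<phi>0s x"
  shows "\<forall>\<^sub>F \<epsilon> in at_right 0. w \<epsilon> \<in> \<real> \<and> (AE x in lebesgue. cnj d *s PT (u \<epsilon>) x = u \<epsilon> x)"
proof -
  have "bifurcating_branch n Y k e \<mu> V chi \<omega>0 \<phi>0 \<phi>0s \<epsilon>1 w u"
    using U by (simp add: unique_branch_def)
  note b = bifurcating_branch_eventually[OF this]
  have d': "cmod (cnj d) = 1" using d by simp
  have cb: "cnj z \<in> ball (of_real \<omega>0) \<delta>" if "z \<in> ball (complex_of_real \<omega>0) \<delta>" for z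
  proof -
    have "cmod (of_real \<omega>0 - cnj z) = cmod (of_real \<omega>0 - z)"
      by (metis complex_cnj_complex_of_real complex_cnj_diff complex_mod_cnj)
    with that show ?thesis by (simp add: dist_norm)
  qed
  have near: "\<forall>\<^sub>F \<epsilon> in at_right 0. w \<epsilon> \<in> ball (of_real \<omega>0) \<delta>"
    using tendstoD[OF b(2) \<delta>] by (simp add: dist_commute)
  have sol: "\<forall>\<^sub>F \<epsilon> in at_right 0. solves n Y k e \<mu> V chi (cnj (w \<epsilon>)) (\<lambda>x. cnj d *s PT (u \<epsilon>) x) \<and>
      L2_inner (\<lambda>x. cnj d *s PT (u \<epsilon>) x) \<phi>0s = of_real (\<epsilon> powr (1/2))"
    using b(1) near
  proof eventually_elim
    case (elim \<epsilon>)
    have s: "solves n Y k e \<mu> V chi (cnj (w \<epsilon>)) (PT (u \<epsilon>))"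
      by (rule solves_PT[where chi = chi and w = "w \<epsilon>", OF sym _ V[OF elim(2)] chi[OF elim(2)] dom[OF cb[OF elim(2)]]]) (use elim in auto)
    have uL: "u \<epsilon> \<in> L2 UNIV" using elim(1) by (auto simp: solves_def D_A_def)
    \<comment> \<open>Writing \<open>\<phi>0s\<close> as \<open>cnj d *s PT \<phi>0s\<close> puts
      the same phase and the same \<open>PT\<close> on both arguments; the phase cancels and
      \<open>PT\<close> leaves a conjugate.\<close>
    have "L2_inner (\<lambda>x. cnj d *s PT (u \<epsilon>) x) \<phi>0s = L2_inner (\<lambda>x. cnj d *s PT (u \<epsilon>) x) (\<lambda>x. cnj d *s PT \<phi>0s x)"
    proof (rule L2_inner_AE_cong)
      show "AE x in lebesgue. \<phi>0s x = cnj d *s PT \<phi>0s x"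
        using p(2) by eventually_elim (simp only: rotated_smult_cancel[OF d])
    qed (use L2_smult[OF L2_PT[OF uL], of "cnj d"] p(1) in \<open>auto simp: L2_def lebesgue_on_UNIV_eq\<close>)
    also have "\<dots> = cnj (L2_inner (u \<epsilon>) \<phi>0s)"
      unfolding L2_inner_rotate[OF d'] L2_inner_PT ..
    finally show ?case using elim(1) solves_smult[OF d' s] by simp
  qed
  have "((\<lambda>\<epsilon>. cnj (w \<epsilon>)) \<longlongrightarrow> of_real \<omega>0) (at_right 0)"
    using tendsto_cnj[OF b(2)] by simp
  moreover have "((\<lambda>\<epsilon>. PH1_nrm n Y (\<lambda>x. cnj d *s PT (u \<epsilon>) x)) \<longlongrightarrow> 0) (at_right 0)"
  proof (rule tendsto_cong[THEN iffD2, OF _ b(3)])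
    show "\<forall>\<^sub>F \<epsilon> in at_right 0. PH1_nrm n Y (\<lambda>x. cnj d *s PT (u \<epsilon>) x) = PH1_nrm n Y (u \<epsilon>)"
      using b(1)
    proof eventually_elim
      case (elim \<epsilon>)
      then have "u \<epsilon> \<in> PH1 n Y" by (simp add: solves_def)
      then show ?case
        using PH1_PT[OF sym, of "u \<epsilon>"] PH1_nrm_smult[of "PT (u \<epsilon>)" n Y "cnj d"] open_layer d' by simp
    qed
  qed
  ultimately have "\<forall>\<^sub>F \<epsilon> in at_right 0. cnj (w \<epsilon>) = w \<epsilon> \<and> (AE x in lebesgue. cnj d *s PT (u \<epsilon>) x = u \<epsilon> x)"
    by (rule unique_branch_eventually_eq[OF U sol])
  then show ?thesis by eventually_elim (simp add: Reals_cnj_iff)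
qed

text \<open>The freedom in choosing \<open>u\<close> is the phase of the eigenfunctions:
  \<open>c *s u\<close> is a branch for \<open>c *s \<phi>0\<close> and
  \<open>c *s \<phi>0s\<close>, which keep their normalisation, and has the same frequencies. The
  final interval \<open>(0, \<epsilon>1)\<close> is where the comparison with the unique branches is
  effective.\<close>

theorem theorem1p2:
  fixes m :: nat and X :: "nat \<Rightarrow> ereal"
    and k eps0 mu0 \<omega>0 \<delta> \<delta>PT \<epsilon>0 :: real
    and chi1 chi3 V :: "real \<Rightarrow> complex \<Rightarrow> complex"
    and \<phi>0 \<phi>0s :: "real \<Rightarrow> complex^3"
    and \<omega> :: "real \<Rightarrow> complex" and u :: "real \<Rightarrow> real \<Rightarrow> complex^3"
  assumes "layers m X"
    and "eps0 > 0" and "mu0 > 0"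
    and "V = (\<lambda>x w. - w * of_real eps0 * of_real mu0 * (1 + chi1 x w))"
    and "A_E m X k V \<omega>0 \<phi>0 \<phi>0s"
    and "A_T V \<omega>0 \<phi>0 \<phi>0s"
    and "\<delta> > 0" and "A_V m X V \<omega>0 \<delta>" and "A_Na m X chi3 \<omega>0 \<delta>"
    and "\<delta>PT > 0" and "PT_material V \<omega>0 \<delta>PT" and "PT_material chi3 \<omega>0 \<delta>PT"
    and "bifurcation_thm k eps0 mu0 V \<omega>0 \<phi>0 \<phi>0s"
    and "bifurcating_branch m X k eps0 mu0 V chi3 \<omega>0 \<phi>0 \<phi>0s \<epsilon>0 \<omega> u"
  shows "\<exists>\<epsilon>1. 0 < \<epsilon>1 \<and> \<epsilon>1 \<le> \<epsilon>0 \<and>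
    (\<forall>\<epsilon> \<in> {0<..<\<epsilon>1}. \<omega> \<epsilon> \<in> \<real>) \<and>
    (\<exists>c. cmod c = 1 \<and>
       bifurcating_branch m X k eps0 mu0 V chi3 \<omega>0
         (\<lambda>x. c *s \<phi>0 x) (\<lambda>x. c *s \<phi>0s x) \<epsilon>1 \<omega> (\<lambda>\<epsilon> x. c *s u \<epsilon> x) \<and>
       (\<forall>\<epsilon> \<in> {0<..<\<epsilon>1}. PT_symmetric (\<lambda>x. c *s u \<epsilon> x)))"
proof -
  note X = assms(1) and A = assms(5) and AT = assms(6) and \<delta> = assms(7) and AV = assms(8)
    and ANa = assms(9) and \<delta>PT = assms(10) and PTV = assms(11) and PTchi = assms(12)
    and bif = assms(13) and branch = assms(14)
  obtain n Y where Y: "layers n Y"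
    and ref: "\<And>j. j \<in> {1..n} \<Longrightarrow> \<exists>i\<in>{1..m}. layer Y j \<subseteq> layer X i"
    and sym: "\<And>j. j \<in> {1..n} \<Longrightarrow> uminus ` layer Y j = layer Y (n + 1 - j)"
    by (rule ex_symmetric_refinement[OF X], rule that)
  have AY: "A_E n Y k V \<omega>0 \<phi>0 \<phi>0s" by (rule A_E_refine[OF ref A])
  have AVY: "A_V n Y V \<omega>0 \<delta>" by (rule A_V_refine[OF ref AV])
  \<comment> \<open>On this ball \<open>V\<close> is holomorphic almost everywhere and real parts of
    frequencies stay in the interval of symmetry.\<close>
  define r where "r = min \<delta> \<delta>PT"
  have r: "r > 0" "r \<le> \<delta>" "r \<le> \<delta>PT" using \<delta> \<delta>PT by (auto simp: r_def)
  have ball_r: "z \<in> ball (of_real \<omega>0) \<delta>" if "z \<in> ball (complex_of_real \<omega>0) r" for z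
    using that r(2) by simp
  have Re_diff: "cmod (of_real (Re z) - of_real (Re z')) \<le> cmod (z - z')" for z z'
    using abs_Re_le_cmod[of "z - z'"] by (simp flip: of_real_diff)
  have Re_ball: "of_real (Re z) \<in> ball (complex_of_real \<omega>0) s" if "z \<in> ball (of_real \<omega>0) s" for z s
    using Re_diff[of "of_real \<omega>0" z] that by (simp add: dist_norm)
  \<comment> \<open>\<open>chi3\<close> is symmetric at real frequencies only and need not be holomorphic, so it is
    replaced by its values at the real part; the two problems agree at real frequencies.\<close>
  define chi where "chi x w = chi3 x (of_real (Re w))" for x w
  have chiNa: "A_Na n Y chi \<omega>0 \<delta>"
    unfolding chi_def[abs_def] by (rule A_Na_refine[OF Y ref ANa Re_ball Re_diff])
  have chi3Na: "A_Na n Y chi3 \<omega>0 \<delta>"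
    by (rule A_Na_refine[OF Y ref ANa, where g = "\<lambda>w. w"]) auto
  have ex_branch: "\<exists>\<epsilon>0 \<omega> u. unique_branch n Y k eps0 mu0 V ch \<omega>0 \<phi>0 \<phi>0s \<epsilon>0 \<omega> u"
    if "A_Na n Y ch \<omega>0 \<delta>" for ch
    by (rule bif[unfolded bifurcation_thm_def, rule_format, of n Y \<delta> ch])
      (intro conjI Y \<delta> AY AT AVY that)
  \<comment> \<open>Two unique branches on the symmetric layers: the one for \<open>chi\<close> can
    be shown symmetric, and the one for \<open>chi3\<close> links it to the given branch.\<close>
  obtain \<epsilon>1 \<omega>1 u1 where U1: "unique_branch n Y k eps0 mu0 V chi \<omega>0 \<phi>0 \<phi>0s \<epsilon>1 \<omega>1 u1"
    using ex_branch[OF chiNa] by (elim exE)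
  obtain \<epsilon>2 \<omega>2 u2 where U2: "unique_branch n Y k eps0 mu0 V chi3 \<omega>0 \<phi>0 \<phi>0s \<epsilon>2 \<omega>2 u2"
    using ex_branch[OF chi3Na] by (elim exE)
  have Vx: "V x (of_real \<omega>0) = cnj (V (- x) (of_real \<omega>0))" for x
    by (rule PTV[unfolded PT_material_def, rule_format]) (use \<delta>PT in simp)
  obtain d where d: "cmod d = 1" "AE x in lebesgue. PT \<phi>0s x = d *s \<phi>0s x"
    by (rule eigenfunction_phases[OF X A Vx], rule that)
  have \<phi>0s: "\<phi>0s \<in> L2 UNIV" using A by (auto simp: A_E_def adjoint_L_def)
  have dom: "z \<in> pencil_dom n Y V" if "z \<in> ball (of_real \<omega>0) \<delta>" for z
    using AVY that by (auto simp: A_V_def pencil_dom_def W1inf_def)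
  have chiPT: "chi x (cnj z) = cnj (chi (- x) z)" if "z \<in> ball (of_real \<omega>0) r" for x z
  proof -
    have "\<bar>\<omega>0 - Re z\<bar> < \<delta>PT"
      using Re_ball[OF that] r(3) by (simp add: dist_norm flip: of_real_diff)
    then have "Re z \<in> {\<omega>0 - \<delta>PT<..<\<omega>0 + \<delta>PT}" by (auto simp: abs_less_iff)
    from PTchi[unfolded PT_material_def, rule_format, OF this, of x]
    show ?thesis unfolding chi_def by simp
  qed
  have sym1: "\<forall>\<^sub>F \<epsilon> in at_right 0. \<omega>1 \<epsilon> \<in> \<real> \<and> (AE x in lebesgue. cnj d *s PT (u1 \<epsilon>) x = u1 \<epsilon> x)"
    by (rule unique_branch_PT[OF sym U1 r(1) PT_material_complex[OF Y AVY \<delta> PTV \<delta>PT ball_r]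
          dom[OF ball_r] chiPT d(1) \<phi>0s d(2)])
  have "bifurcating_branch n Y k eps0 mu0 V chi \<omega>0 \<phi>0 \<phi>0s \<epsilon>1 \<omega>1 u1"
    using U1 by (simp add: unique_branch_def)
  note b1 = bifurcating_branch_eventually[OF this]
  have "\<forall>\<^sub>F \<epsilon> in at_right 0. solves n Y k eps0 mu0 V chi3 (\<omega>1 \<epsilon>) (u1 \<epsilon>) \<and>
      L2_inner (u1 \<epsilon>) \<phi>0s = of_real (\<epsilon> powr (1/2))"
    using b1(1) sym1
  proof eventually_elim
    case (elim \<epsilon>)
    \<comment> \<open>The frequency is already known to be real here, so replacing it by its real
      part changes nothing.\<close>
    then have "chi x (\<omega>1 \<epsilon>) = chi3 x (\<omega>1 \<epsilon>)" for x by (simp add: chi_def of_real_Re)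
    then have "h_nl eps0 mu0 chi x (\<omega>1 \<epsilon>) v = h_nl eps0 mu0 chi3 x (\<omega>1 \<epsilon>) v" for x v
      by (simp add: h_nl_def)
    with elim show ?case by (simp add: solves_def)
  qed
  then have eq1: "\<forall>\<^sub>F \<epsilon> in at_right 0. \<omega>1 \<epsilon> = \<omega>2 \<epsilon> \<and> (AE x in lebesgue. u1 \<epsilon> x = u2 \<epsilon> x)"
    by (rule unique_branch_eventually_eq[OF U2 _ b1(2,3)])
  note b = bifurcating_branch_eventually[OF branch]
  \<comment> \<open>Solutions with respect to the given layers remain solutions on the refinement,
    so the given branch can also be compared with \<open>u2\<close>.\<close>
  have sol: "\<forall>\<^sub>F \<epsilon> in at_right 0. solves n Y k eps0 mu0 V chi3 (\<omega> \<epsilon>) (u \<epsilon>) \<and>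
      L2_inner (u \<epsilon>) \<phi>0s = of_real (\<epsilon> powr (1/2))"
    using b(1) by eventually_elim
      (auto simp: solves_def intro: PH1_refine(1)[OF ref] pencil_dom_refine[OF ref])
  have "((\<lambda>\<epsilon>. PH1_nrm n Y (u \<epsilon>)) \<longlongrightarrow> 0) (at_right 0)"
  proof (rule Lim_null_comparison)
    show "\<forall>\<^sub>F \<epsilon> in at_right 0. norm (PH1_nrm n Y (u \<epsilon>)) \<le> real n * PH1_nrm m X (u \<epsilon>)"
      using b(1)
    proof eventually_elim
      case (elim \<epsilon>)
      then have "u \<epsilon> \<in> PH1 m X" by (simp add: solves_def)
      from PH1_refine(2)[OF ref this] show ?case
        by (simp add: PH1_nrm_def sum_nonneg H1_nrm_nonneg)
    qed
    show "((\<lambda>\<epsilon>. real n * PH1_nrm m X (u \<epsilon>)) \<longlongrightarrow> 0) (at_right 0)"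
      using tendsto_mult_left[OF b(3), of "real n"] by simp
  qed
  then have eq2: "\<forall>\<^sub>F \<epsilon> in at_right 0. \<omega> \<epsilon> = \<omega>2 \<epsilon> \<and> (AE x in lebesgue. u \<epsilon> x = u2 \<epsilon> x)"
    by (rule unique_branch_eventually_eq[OF U2 sol b(2)])
  \<comment> \<open>From \<open>u = cnj d *s PT u\<close> it follows that
    \<open>c *s u = (c * cnj d) *s PT u\<close>. This equals \<open>PT (c *s u)\<close>, that is
    \<open>cnj c *s PT u\<close>, as soon as \<open>c * cnj d = cnj c\<close>, which a square root
    of \<open>d\<close> achieves.\<close>
  define c where "c = csqrt d"
  have c2: "c * c = d" by (simp add: c_def flip: power2_eq_square)
  have "cmod c * cmod c = 1" using d(1) c2 by (simp flip: norm_mult)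
  then have c: "cmod c = 1" by (simp add: abs_square_eq_1 flip: power2_eq_square)
  have cc: "c * cnj d = cnj c"
  proof -
    have "c * cnj c = 1" using c by (metis complex_norm_square of_real_1 power_one)
    then show ?thesis by (simp add: mult.assoc flip: c2)
  qed
  have "\<forall>\<^sub>F \<epsilon> in at_right 0. \<omega> \<epsilon> \<in> \<real> \<and> PT_symmetric (\<lambda>x. c *s u \<epsilon> x)"
    using sym1 eq1 eq2
  proof eventually_elim
    case (elim \<epsilon>)
    have uu: "AE x in lebesgue. u \<epsilon> x = u1 \<epsilon> x"
      using elim(2,3) by (auto elim: AE_mp)
    have "AE x in lebesgue. c *s u \<epsilon> x = cnjv (c *s u \<epsilon> (- x))"
      using uu PT_AE_cong[OF uu] conjunct2[OF elim(1)]
    proof eventually_elim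
      case (elim x)
      have "c *s u \<epsilon> x = c *s (cnj d *s PT (u \<epsilon>) x)" using elim by simp
      also have "\<dots> = (c * cnj d) *s PT (u \<epsilon>) x" by (simp add: vec_eq_iff)
      also have "\<dots> = cnjv (c *s u \<epsilon> (- x))" unfolding cc by (simp add: PT_def cnjv_smult)
      finally show ?case .
    qed
    with elim show ?case by (simp add: PT_symmetric_def)
  qed
  then obtain s where s: "s > 0" "\<And>\<epsilon>. 0 < \<epsilon> \<Longrightarrow> \<epsilon> < s \<Longrightarrow> \<omega> \<epsilon> \<in> \<real> \<and> PT_symmetric (\<lambda>x. c *s u \<epsilon> x)"
    unfolding eventually_at_right_field by blast
  have \<epsilon>0: "\<epsilon>0 > 0" using branch by (simp add: bifurcating_branch_def)
  have "0 < min s \<epsilon>0" "min s \<epsilon>0 \<le> \<epsilon>0" using s(1) \<epsilon>0 by auto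
  with s(2) c bifurcating_branch_rotate[OF c branch this] show ?thesis
    by (intro exI[of _ "min s \<epsilon>0"] conjI exI[of _ c]) auto
qed

end
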